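(* Let $W$ be a standard Brownian motion with positive drift, i.e. $W(x)=\mu x+B_x$ with $\mu>0$ and $B$ a standard Brownian motion, and let $a\equiv1$. Then the system of Stratonovich equations $$\frac{\mathrm du_n}{\mathrm dx}+u_n^2+2W_n'(x)\,u_n=0,\qquad n=0,1,2,\ldots,$$ where $$W_0':=W',\qquad W_n'=\frac{a'}{2a}-u_{n-1}-W_{n-1}'=-u_{n-1}-W_{n-1}'\quad(n\ge1),$$ has a stationary solution such that $u_0=0$ and, for $n\ge1$, the $u_n$ are independent random variables with the same gamma distribution.
   Context: All equations are driven by the single Brownian motion $B$ and are stochastic differential equations in the "time" variable $x$, interpreted in the sense of Stratonovich: $\mathrm du_n=-u_n^2\,\mathrm dx-2u_n\circ\mathrm dW_n$, with $\mathrm dW_0=\mu\,\mathrm dx+\mathrm dB_x$ and $\mathrm dW_n=-u_{n-1}\,\mathrm dx-\mathrm dW_{n-1}$. A stationary solution is one for which the joint law of $(u_n(x))_{n\ge0}$ does not depend on $x$; independence of the $u_n$, $n\ge1$, refers to the random variables $u_n(x)$ at a fixed $x$. A gamma distribution is a law on $(0,\infty)$ with density proportional to $y^{\kappa-1}e^{-y/\theta}$ for some $\kappa,\theta>0$. *)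

theory Defs
  imports "HOL-Probability.Probability"
begin

text \<open>
  Stochastic processes are functions \<open>X :: real \<Rightarrow> 'a \<Rightarrow> real\<close> of a time, of which only the values
  \<open>x \<ge> 0\<close> matter, and a sample point.
\<close>

definition continuous_paths :: "'a measure \<Rightarrow> (real \<Rightarrow> 'a \<Rightarrow> real) \<Rightarrow> bool" where
  "continuous_paths M X \<longleftrightarrow> (\<forall>\<omega>\<in>space M. continuous_on {0..} (\<lambda>x. X x \<omega>))"

definition standard_brownian_motion :: "'a measure \<Rightarrow> (real \<Rightarrow> 'a \<Rightarrow> real) \<Rightarrow> bool" where
  "standard_brownian_motion M B \<longleftrightarrow>
     prob_space M \<and>
     (\<forall>x\<ge>0. B x \<in> borel_measurable M) \<and>
     (AE \<omega> in M. B 0 \<omega> = 0) \<and>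
     (\<forall>s t. 0 \<le> s \<and> s < t \<longrightarrow>
        distributed M lborel (\<lambda>\<omega>. B t \<omega> - B s \<omega>) (normal_density 0 (sqrt (t - s)))) \<and>
     (\<forall>k (t :: nat \<Rightarrow> real). 0 \<le> t 0 \<and> (\<forall>i<k. t i \<le> t (Suc i)) \<longrightarrow>
        prob_space.indep_vars M (\<lambda>_. borel) (\<lambda>i \<omega>. B (t (Suc i)) \<omega> - B (t i) \<omega>) {..<k}) \<and>
     continuous_paths M B"

definition adapted :: "(real \<Rightarrow> 'a measure) \<Rightarrow> (real \<Rightarrow> 'a \<Rightarrow> real) \<Rightarrow> bool" where
  "adapted F X \<longleftrightarrow> (\<forall>x\<ge>0. X x \<in> borel_measurable (F x))"

definition brownian_motion_wrt ::
    "'a measure \<Rightarrow> (real \<Rightarrow> 'a measure) \<Rightarrow> (real \<Rightarrow> 'a \<Rightarrow> real) \<Rightarrow> bool" where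
  "brownian_motion_wrt M F B \<longleftrightarrow>
     standard_brownian_motion M B \<and>
     filtration (space M) F \<and> (\<forall>x. subalgebra M (F x)) \<and>
     adapted F B \<and>
     (\<forall>s t. 0 \<le> s \<and> s \<le> t \<longrightarrow>
        prob_space.indep_set M (sets (F s))
          {(\<lambda>\<omega>. B t \<omega> - B s \<omega>) -` A \<inter> space M | A. A \<in> sets borel})"

definition is_partition :: "real \<Rightarrow> nat \<Rightarrow> (nat \<Rightarrow> real) \<Rightarrow> bool" where
  "is_partition x k t \<longleftrightarrow> t 0 = 0 \<and> t k = x \<and> (\<forall>i<k. t i \<le> t (Suc i))"

definition stratonovich_sum ::
    "(real \<Rightarrow> 'a \<Rightarrow> real) \<Rightarrow> (real \<Rightarrow> 'a \<Rightarrow> real) \<Rightarrow> nat \<Rightarrow> (nat \<Rightarrow> real) \<Rightarrow> 'a \<Rightarrow> real" where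
  "stratonovich_sum X Y k t \<omega> =
     (\<Sum>i<k. (X (t i) \<omega> + X (t (Suc i)) \<omega>) / 2 * (Y (t (Suc i)) \<omega> - Y (t i) \<omega>))"

text \<open>
  The Stratonovich integral of \<open>X\<close> against \<open>Y\<close> over \<open>[0, x]\<close> is the limit in probability of the
  trapezoidal sums as the mesh of the (deterministic) partition tends to 0. The measurability
  conditions are needed because \<^const>\<open>measure\<close> is 0 on non-measurable sets.
\<close>

definition has_stratonovich_integral ::
    "'a measure \<Rightarrow> (real \<Rightarrow> 'a \<Rightarrow> real) \<Rightarrow> (real \<Rightarrow> 'a \<Rightarrow> real) \<Rightarrow> real \<Rightarrow> ('a \<Rightarrow> real) \<Rightarrow> bool" where
  "has_stratonovich_integral M X Y x J \<longleftrightarrow>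
     J \<in> borel_measurable M \<and>
     (\<forall>y\<in>{0..x}. X y \<in> borel_measurable M \<and> Y y \<in> borel_measurable M) \<and>
     (\<forall>\<epsilon>>0. \<exists>\<delta>>0. \<forall>k t. is_partition x k t \<and> (\<forall>i<k. t (Suc i) - t i < \<delta>) \<longrightarrow>
        measure M {\<omega> \<in> space M. \<bar>stratonovich_sum X Y k t \<omega> - J \<omega>\<bar> > \<epsilon>} < \<epsilon>)"

text \<open>
  The processes \<open>W\<^sub>n\<close>, given by \<open>W\<^sub>0 = W\<close> and
  \<open>dW\<^sub>n = (a' / (2 a) - u\<^sub>n\<^sub>-\<^sub>1) dx - dW\<^sub>n\<^sub>-\<^sub>1\<close>. Only their increments enter the equations, so
  the value at 0 is immaterial.
\<close>

primrec W_seq ::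
    "(real \<Rightarrow> real) \<Rightarrow> (real \<Rightarrow> 'a \<Rightarrow> real) \<Rightarrow> (nat \<Rightarrow> real \<Rightarrow> 'a \<Rightarrow> real) \<Rightarrow> nat \<Rightarrow> real \<Rightarrow> 'a \<Rightarrow> real" where
  "W_seq a W u 0 = W"
| "W_seq a W u (Suc n) =
     (\<lambda>x \<omega>. integral {0..x} (\<lambda>y. deriv a y / (2 * a y) - u n y \<omega>) - W_seq a W u n x \<omega>)"

text \<open>
  \<open>du\<^sub>n = - u\<^sub>n\<^sup>2 dx - 2 u\<^sub>n \<circ> dW\<^sub>n\<close> for all \<open>n\<close>, in integrated form.
\<close>

definition solves_system ::
    "'a measure \<Rightarrow> (real \<Rightarrow> 'a measure) \<Rightarrow> (real \<Rightarrow> real) \<Rightarrow> (real \<Rightarrow> 'a \<Rightarrow> real) \<Rightarrow>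
     (nat \<Rightarrow> real \<Rightarrow> 'a \<Rightarrow> real) \<Rightarrow> bool" where
  "solves_system M F a W u \<longleftrightarrow>
     (\<forall>n. adapted F (u n) \<and> continuous_paths M (u n) \<and>
        (\<exists>J. (\<forall>x\<ge>0. has_stratonovich_integral M (u n) (W_seq a W u n) x (J x)) \<and>
             (AE \<omega> in M. \<forall>x\<ge>0.
                u n x \<omega> = u n 0 \<omega> - integral {0..x} (\<lambda>y. (u n y \<omega>)\<^sup>2) - 2 * J x \<omega>)))"

definition stationary_sequence :: "'a measure \<Rightarrow> (nat \<Rightarrow> real \<Rightarrow> 'a \<Rightarrow> real) \<Rightarrow> bool" where
  "stationary_sequence M u \<longleftrightarrow>
     (\<forall>x\<ge>0. distr M (PiM UNIV (\<lambda>_. borel)) (\<lambda>\<omega> n. u n x \<omega>) =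
            distr M (PiM UNIV (\<lambda>_. borel)) (\<lambda>\<omega> n. u n 0 \<omega>))"

text \<open>Shape \<open>\<kappa>\<close> and scale \<open>\<theta>\<close>.\<close>

definition gamma_density :: "real \<Rightarrow> real \<Rightarrow> real \<Rightarrow> real" where
  "gamma_density \<kappa> \<theta> y =
     (if y > 0 then y powr (\<kappa> - 1) * exp (- y / \<theta>) / (Gamma \<kappa> * \<theta> powr \<kappa>) else 0)"

text \<open>
  The process \<open>X\<close> viewed on an enlarged sample space, with \<open>X\<close> independent of the new coordinate
  under a product measure. A stationary solution on \<open>x \<ge> 0\<close> needs an enlargement: its initial value
  is random and independent of the driving Brownian motion.
\<close>

definition lift_process :: "(real \<Rightarrow> 'a \<Rightarrow> real) \<Rightarrow> real \<Rightarrow> 'a \<times> 'b \<Rightarrow> real" where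
  "lift_process X x = (\<lambda>\<omega>. X x (fst \<omega>))"

end

theory Submission
  imports Defs
begin

text \<open>
  With \<open>W\<^sub>1 = - W\<close> each equation is of Bernoulli type and is solved pathwise by
  \<open>u\<^sub>n = v exp (- 2 W\<^sub>n) / (1 + v \<integral> exp (- 2 W\<^sub>n) dx)\<close>, so that \<open>W\<^sub>n\<^sub>+\<^sub>1 = - W\<^sub>n - ln (1 + v \<integral> exp (- 2 W\<^sub>n) dx)\<close>.
  Start all levels from independent gamma variables \<open>v\<close> of shape \<open>\<mu>\<close> and scale 2. In the coordinate
  \<open>l = ln u\<close> the first equation is a Langevin diffusion that is reversible for this law, and reversing time
  exchanges the driver \<open>W\<^sub>n\<close> with \<open>W\<^sub>n\<^sub>+\<^sub>1\<close>; this is a Burke-type property of the system.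

  Stationarity at fixed \<open>x\<close> needs neither a change of measure on path space nor stochastic calculus.
  Replacing the integrals by Riemann sums with step \<open>h\<close> gives a Markov chain, one step of which applies to the
  levels in turn the map \<open>(l, y) \<mapsto> (l - 2 y - ln (1 + h exp l), - y - ln (1 + h exp l))\<close>.
  Comparing the law of the old and the new \<open>l\<close> with a law that is symmetric under their exchange shows that this map preserves
  the product of the log-gamma and the Gaussian law up to an error \<open>O(h\<^sup>3\<^sup>/\<^sup>2)\<close> on Lipschitz functions. The chain is
  non-expansive, so the errors of the \<open>1 / h\<close> steps add up to \<open>O(h\<^sup>1\<^sup>/\<^sup>2)\<close> and vanish as \<open>h \<rightarrow> 0\<close>.

  The Stratonovich integral is obtained from \<open>d (ln u) = - u dx - 2 dW\<^sub>n\<close>: the trapezoidal sums telescope up to the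
  cubic variation of the Brownian path, whose expectation tends to 0 with the mesh.
\<close>

section \<open>The log-gamma law\<close>

text \<open>The parameters come from the first equation: as \<open>W_1 = - W\<close>, the coordinate
  l = ln u satisfies dl = (2 \<mu> - exp l) dx + 2 dB, whose reversible density is proportional to
  exp (\<mu> l - exp l / 2). This is the law of ln v for a gamma variable v of shape \<mu> and scale
  2. The exponent 3/2 of the one-step error is essential, since errors of order h would not vanish
  after 1 / h steps. It arises as a product. Under a symmetric law of the old and the new state,
  antisymmetric functions have mean 0, so only the deviation from the symmetric law counts. The
  logarithm of that density ratio is of order h, and the function integrated against it is a
  difference of a Lipschitz function at the two states, hence of the order sqrt h of one
  displacement. The obstacle is the drift exp l, which is neither bounded nor Lipschitz. Local
  errors are therefore not uniform in l; they carry exponential weights that are integrable under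
  the log-gamma and the Gaussian law.\<close>

definition log_gamma_density :: "real \<Rightarrow> real \<Rightarrow> real" where
  "log_gamma_density \<mu> l = exp (\<mu> * l - exp l / 2) / (Gamma \<mu> * 2 powr \<mu>)"

definition log_gamma :: "real \<Rightarrow> real measure" where
  "log_gamma \<mu> = density lborel (\<lambda>l. ennreal (log_gamma_density \<mu> l))"

lemma borel_measurable_log_gamma_density[measurable]: "log_gamma_density \<mu> \<in> borel_measurable borel"
  unfolding log_gamma_density_def by measurable

lemma borel_measurable_gamma_density[measurable]: "gamma_density \<kappa> \<theta> \<in> borel_measurable borel"
  unfolding gamma_density_def[abs_def] by measurable

lemma sets_log_gamma[measurable_cong, simp]: "sets (log_gamma \<mu>) = sets borel"
  and space_log_gamma[simp]: "space (log_gamma \<mu>) = UNIV"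
  by (simp_all add: log_gamma_def)

lemma log_gamma_density_pos: "\<mu> > 0 \<Longrightarrow> log_gamma_density \<mu> l > 0"
  by (simp add: log_gamma_density_def Gamma_real_pos)

lemma gamma_density_nonneg: "\<kappa> > 0 \<Longrightarrow> \<theta> > 0 \<Longrightarrow> gamma_density \<kappa> \<theta> x \<ge> 0"
  by (simp add: gamma_density_def Gamma_real_pos less_imp_le)

text \<open>The factor \<open>exp l\<close> is the Jacobian of the substitution v =
  \<open>exp l\<close>.\<close>

lemma gamma_density_exp:
  "gamma_density \<mu> 2 (exp l) * exp l = log_gamma_density \<mu> l"
proof -
  have "exp l powr (\<mu> - 1) * exp l = exp (\<mu> * l)"
    by (simp add: powr_def algebra_simps flip: exp_add)
  then have "gamma_density \<mu> 2 (exp l) * exp l = exp (\<mu> * l) * exp (- (exp l / 2)) / (Gamma \<mu> * 2 powr \<mu>)"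
    by (simp add: gamma_density_def)
  also have "exp (\<mu> * l) * exp (- (exp l / 2)) = exp (\<mu> * l - exp l / 2)"
    by (simp flip: exp_add)
  finally show ?thesis by (simp add: log_gamma_density_def)
qed

text \<open>Substitution on the compact interval from \<open>- n\<close> to \<open>n\<close>; both
  sides increase with \<open>n\<close>, so monotone convergence yields the whole line. The indicator
  on the right marks the range of \<open>exp\<close>.\<close>

lemma nn_integral_exp_substitution:
  fixes f :: "real \<Rightarrow> real"
  assumes [measurable]: "f \<in> borel_measurable borel" and nn: "\<And>x. f x \<ge> 0"
  shows "(\<integral>\<^sup>+l. ennreal (f (exp l) * exp l) \<partial>lborel) = (\<integral>\<^sup>+v. ennreal (f v) * indicator {0<..} v \<partial>lborel)"
proof -
  have eq: "(\<integral>\<^sup>+v. ennreal (f v) * indicator {exp (- real n)..exp (real n)} v \<partial>lborel)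
      = (\<integral>\<^sup>+l. ennreal (f (exp l) * exp l) * indicator {- real n..real n} l \<partial>lborel)" for n :: nat
  proof -
    have "(\<integral>\<^sup>+v. f v * indicator {exp (- real n)..exp (real n)} v \<partial>lborel) =
        (\<integral>\<^sup>+l. f (exp l) * exp l * indicator {- real n..real n} l \<partial>lborel)"
      by (rule nn_integral_substitution)
        (auto simp: set_borel_measurable_def intro!: derivative_eq_intros continuous_intros)
    then show ?thesis
      by (simp add: ennreal_mult' nn ennreal_indicator[symmetric])
  qed
  have lim1: "(\<lambda>n. \<integral>\<^sup>+v. ennreal (f v) * indicator {exp (- real n)..exp (real n)} v \<partial>lborel)
     \<longlonglongrightarrow> (\<integral>\<^sup>+v. ennreal (f v) * indicator {0<..} v \<partial>lborel)"
  proof (rule nn_integral_LIMSEQ)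
    show "incseq (\<lambda>n v. ennreal (f v) * indicator {exp (- real n)..exp (real n)} v)"
      by (auto simp: incseq_def le_fun_def split: split_indicator
          intro: order_trans[rotated] order_trans)
    fix v :: real
    show "(\<lambda>n. ennreal (f v) * indicator {exp (- real n)..exp (real n)} v)
        \<longlonglongrightarrow> ennreal (f v) * indicator {0<..} v"
    proof (cases "v > 0")
      case True
      obtain N where N: "\<bar>ln v\<bar> \<le> real N" using real_arch_simple by blast
      have "v \<in> {exp (- real n)..exp (real n)}" if "n \<ge> N" for n
      proof -
        have "- real n \<le> ln v" "ln v \<le> real n" using N that by linarith+
        then have "exp (- real n) \<le> exp (ln v)" "exp (ln v) \<le> exp (real n)" by simp_all
        then show ?thesis using True by simp
      qed
      then have "\<forall>\<^sub>F n in sequentially. ennreal (f v) * indicator {exp (- real n)..exp (real n)} v = ennreal (f v) * indicator {0<..} v"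
        using True by (auto simp: eventually_sequentially intro!: exI[of _ N])
      then show ?thesis by (rule tendsto_eventually)
    next
      case False
      then have "v \<notin> {exp (- real n)..exp (real n)}" for n
        by (auto simp: not_less dest: order_trans)
      then show ?thesis using False by simp
    qed
  qed measurable
  have lim2: "(\<lambda>n. \<integral>\<^sup>+l. ennreal (f (exp l) * exp l) * indicator {- real n..real n} l \<partial>lborel)
     \<longlonglongrightarrow> (\<integral>\<^sup>+l. ennreal (f (exp l) * exp l) \<partial>lborel)"
  proof (rule nn_integral_LIMSEQ)
    show "incseq (\<lambda>n l. ennreal (f (exp l) * exp l) * indicator {- real n..real n} l)"
      by (auto simp: incseq_def le_fun_def split: split_indicator)
    fix v :: real
    obtain N where N: "\<bar>v\<bar> \<le> real N" using real_arch_simple by blast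
    have "\<forall>\<^sub>F n in sequentially. ennreal (f (exp v) * exp v) * indicator {- real n..real n} v = ennreal (f (exp v) * exp v)"
      using N by (auto simp: eventually_sequentially indicator_def intro!: exI[of _ N])
    then show "(\<lambda>n. ennreal (f (exp v) * exp v) * indicator {- real n..real n} v)
        \<longlonglongrightarrow> ennreal (f (exp v) * exp v)" by (rule tendsto_eventually)
  qed measurable
  show ?thesis
    using LIMSEQ_unique[OF lim2 lim1[unfolded eq]] .
qed

text \<open>Scaling by \<theta> reduces the claim to Euler's integral for
  \<open>Gamma \<kappa>\<close>.\<close>

lemma nn_integral_gamma_density:
  assumes "\<kappa> > 0" "\<theta> > 0"
  shows "(\<integral>\<^sup>+v. ennreal (gamma_density \<kappa> \<theta> v) \<partial>lborel) = 1"
proof -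
  have "(\<integral>\<^sup>+v. ennreal (gamma_density \<kappa> \<theta> v) \<partial>lborel) = \<bar>\<theta>\<bar> * (\<integral>\<^sup>+v. ennreal (gamma_density \<kappa> \<theta> (0 + \<theta> * v)) \<partial>lborel)"
    by (rule nn_integral_real_affine) (use assms in auto)
  also have "\<dots> = (\<integral>\<^sup>+v. ennreal (\<theta> * gamma_density \<kappa> \<theta> (\<theta> * v)) \<partial>lborel)"
    using assms by (subst nn_integral_cmult[symmetric]) (auto simp: ennreal_mult' gamma_density_nonneg)
  also have "\<dots> = (\<integral>\<^sup>+v. ennreal (1 / Gamma \<kappa>) * ennreal (indicator {0..} v * v powr (\<kappa> - 1) / exp v) \<partial>lborel)"
  proof (intro nn_integral_cong)
    fix v :: real
    have "\<theta> * gamma_density \<kappa> \<theta> (\<theta> * v) = 1 / Gamma \<kappa> * (indicator {0..} v * v powr (\<kappa> - 1) / exp v)"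
    proof (cases "v > 0")
      case True
      have "\<theta> * (\<theta> * v) powr (\<kappa> - 1) = \<theta> powr \<kappa> * v powr (\<kappa> - 1)"
        using assms True by (simp add: powr_mult powr_diff)
      then show ?thesis
        using True assms by (simp add: gamma_density_def exp_minus field_simps)
    next
      case False
      then show ?thesis using assms by (auto simp: gamma_density_def zero_less_mult_iff split: split_indicator)
    qed
    then show "ennreal (\<theta> * gamma_density \<kappa> \<theta> (\<theta> * v)) =
      ennreal (1 / Gamma \<kappa>) * ennreal (indicator {0..} v * v powr (\<kappa> - 1) / exp v)"
      using assms by (simp add: ennreal_mult'[symmetric] Gamma_real_pos less_imp_le)
  qed
  also have "\<dots> = ennreal (1 / Gamma \<kappa>) * ennreal (Gamma \<kappa>)"
    using assms by (subst nn_integral_cmult) (auto simp: Gamma_conv_nn_integral_real)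
  also have "\<dots> = 1"
    using Gamma_real_pos[OF assms(1)] by (simp add: ennreal_mult'[symmetric] less_imp_le)
  finally show ?thesis .
qed

lemma nn_integral_log_gamma_density:
  assumes "\<mu> > 0"
  shows "(\<integral>\<^sup>+l. ennreal (log_gamma_density \<mu> l) \<partial>lborel) = 1"
proof -
  have "(\<integral>\<^sup>+l. ennreal (log_gamma_density \<mu> l) \<partial>lborel) =
      (\<integral>\<^sup>+v. ennreal (gamma_density \<mu> 2 v) * indicator {0<..} v \<partial>lborel)"
    using nn_integral_exp_substitution[of "gamma_density \<mu> 2"] assms
    by (simp add: gamma_density_exp gamma_density_nonneg)
  also have "\<dots> = (\<integral>\<^sup>+v. ennreal (gamma_density \<mu> 2 v) \<partial>lborel)"
    by (intro nn_integral_cong) (auto simp: gamma_density_def split: split_indicator)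
  finally show ?thesis using nn_integral_gamma_density[of \<mu> 2] assms by simp
qed

lemma prob_space_log_gamma: "\<mu> > 0 \<Longrightarrow> prob_space (log_gamma \<mu>)"
  by (rule prob_spaceI) (simp add: log_gamma_def emeasure_density nn_integral_log_gamma_density)

text \<open>Multiplication by \<open>exp (k * l)\<close> turns the density of shape \<mu> into that
  of shape \<mu> + k up to the ratio \<open>c\<close> of the normalising constants, so the integral
  is \<open>c\<close>. These moments pay for the unbounded drift.\<close>

lemma nn_integral_exp_log_gamma:
  assumes "\<mu> > 0" "k \<ge> 0"
  shows "(\<integral>\<^sup>+l. ennreal (exp (k * l)) \<partial>log_gamma \<mu>) < \<infinity>"
proof -
  define c where "c = Gamma (\<mu> + k) * 2 powr (\<mu> + k) / (Gamma \<mu> * 2 powr \<mu>)"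
  have "c \<ge> 0" using assms by (simp add: c_def Gamma_real_pos less_imp_le)
  have eq: "log_gamma_density \<mu> l * exp (k * l) = c * log_gamma_density (\<mu> + k) l" for l
  proof -
    have g: "Gamma (\<mu> + k) \<noteq> 0" "Gamma \<mu> \<noteq> 0"
      using assms Gamma_real_pos[of "\<mu> + k"] Gamma_real_pos[of "\<mu>"] by linarith+
    have "exp (\<mu> * l - exp l / 2) * exp (k * l) = exp ((\<mu> + k) * l - exp l / 2)"
      by (simp add: algebra_simps flip: exp_add)
    then have "log_gamma_density \<mu> l * exp (k * l) = exp ((\<mu> + k) * l - exp l / 2) / (Gamma \<mu> * 2 powr \<mu>)"
      by (simp add: log_gamma_density_def)
    also have "\<dots> = c * log_gamma_density (\<mu> + k) l"
      using g by (simp add: c_def log_gamma_density_def)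
    finally show ?thesis .
  qed
  have "(\<integral>\<^sup>+l. ennreal (exp (k * l)) \<partial>log_gamma \<mu>) =
      (\<integral>\<^sup>+l. ennreal c * ennreal (log_gamma_density (\<mu> + k) l) \<partial>lborel)"
    unfolding log_gamma_def using log_gamma_density_pos[of "\<mu>"] log_gamma_density_pos[of "\<mu> + k"] assms \<open>c \<ge> 0\<close>
    by (subst nn_integral_density) (auto simp: ennreal_mult'[symmetric] less_imp_le eq)
  also have "\<dots> = ennreal c"
    using assms by (simp add: nn_integral_cmult nn_integral_log_gamma_density)
  finally show ?thesis by simp
qed

lemma distr_log_gamma_exp:
  assumes "\<mu> > 0"
  shows "distr (log_gamma \<mu>) lborel exp = density lborel (\<lambda>v. ennreal (gamma_density \<mu> 2 v))"
proof (rule measure_eqI)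
  fix A :: "real set" assume "A \<in> sets (distr (log_gamma \<mu>) lborel exp)"
  then have [measurable]: "A \<in> sets borel" by simp
  have m: "exp -` A \<in> sets borel"
    using measurable_sets[of exp borel borel A] by simp
  have "emeasure (distr (log_gamma \<mu>) lborel exp) A =
      (\<integral>\<^sup>+l. ennreal (log_gamma_density \<mu> l) * indicator (exp -` A) l \<partial>lborel)"
    unfolding log_gamma_def using m
    by (subst emeasure_distr) (auto simp: emeasure_density)
  also have "\<dots> = (\<integral>\<^sup>+l. ennreal ((gamma_density \<mu> 2 (exp l) * indicator A (exp l)) * exp l) \<partial>lborel)"
    by (intro nn_integral_cong)
       (auto simp: gamma_density_exp[symmetric] split: split_indicator)
  also have "\<dots> = (\<integral>\<^sup>+v. ennreal (gamma_density \<mu> 2 v * indicator A v) * indicator {0<..} v \<partial>lborel)"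
    by (rule nn_integral_exp_substitution[where f="\<lambda>v. gamma_density \<mu> 2 v * indicator A v"]) (use assms in \<open>auto simp: gamma_density_nonneg\<close>)
  also have "\<dots> = (\<integral>\<^sup>+v. ennreal (gamma_density \<mu> 2 v) * indicator A v \<partial>lborel)"
    by (intro nn_integral_cong) (auto simp: gamma_density_def split: split_indicator)
  finally show "emeasure (distr (log_gamma \<mu>) lborel exp) A = emeasure (density lborel (\<lambda>v. ennreal (gamma_density \<mu> 2 v))) A"
    by (simp add: emeasure_density)
qed simp

section \<open>Almost invariance under one step\<close>

definition std_normal :: "real measure" where
  "std_normal = density lborel (\<lambda>x. ennreal (std_normal_density x))"

text \<open>\<open>lnp\<close> is the discrete counterpart of \<open>\<integral> u dx\<close> over one step of length \<open>h\<close>, and \<open>noise\<close> that of \<open>dW\<^sub>1 = - dW\<close>.\<close>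

definition lnp :: "real \<Rightarrow> real \<Rightarrow> real" where
  "lnp h l = ln (1 + h * exp l)"

definition noise :: "real \<Rightarrow> real \<Rightarrow> real \<Rightarrow> real" where
  "noise \<mu> h \<zeta> = - (\<mu> * h + sqrt h * \<zeta>)"

lemma sets_std_normal[measurable_cong, simp]: "sets std_normal = sets borel"
  and space_std_normal[simp]: "space std_normal = UNIV"
  by (simp_all add: std_normal_def)

lemma prob_space_std_normal: "prob_space std_normal"
  unfolding std_normal_def by (rule prob_space_normal_density) simp

lemma measurable_lnp[measurable]: "lnp h \<in> borel_measurable borel"
  unfolding lnp_def[abs_def] by measurable

lemma measurable_noise[measurable]: "noise \<mu> h \<in> borel_measurable borel"
  unfolding noise_def[abs_def] by measurable

lemma distributed_std_normal_affine:
  assumes "s > 0"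
  shows "distributed std_normal lborel (\<lambda>\<zeta>. c + s * \<zeta>) (normal_density c s)"
proof -
  interpret prob_space std_normal by (rule prob_space_std_normal)
  have "distributed std_normal lborel (\<lambda>\<zeta>. \<zeta>) (normal_density 0 1)"
    unfolding distributed_def by (simp add: distr_id2 std_normal_def)
  from normal_density_affine[OF this, of s c] assms show ?thesis by simp
qed

text \<open>Dominate \<open>exp (a * \<bar>\<zeta>\<bar>)\<close> by the sum of the exponentials
  with slopes \<open>a\<close> and \<open>- a\<close>; completing the square evaluates each as
  \<open>exp (a\<^sup>2 / 2)\<close>.\<close>

lemma nn_integral_exp_abs_std_normal:
  assumes "a \<ge> 0"
  shows "(\<integral>\<^sup>+\<zeta>. ennreal (exp (a * \<bar>\<zeta>\<bar>)) \<partial>std_normal) < \<infinity>"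
proof -
  have eq: "std_normal_density x * exp (a * x) = exp (a\<^sup>2 / 2) * normal_density a 1 x" for a x
    by (simp add: normal_density_def field_simps power2_eq_square flip: exp_add)
  have fin: "(\<integral>\<^sup>+x. ennreal (std_normal_density x * exp (a * x)) \<partial>lborel) = ennreal (exp (a\<^sup>2 / 2))" for a
    unfolding eq using prob_space.emeasure_space_1[OF prob_space_normal_density[of 1 a]]
    by (simp add: ennreal_mult' nn_integral_cmult emeasure_density)
  have "(\<integral>\<^sup>+\<zeta>. ennreal (exp (a * \<bar>\<zeta>\<bar>)) \<partial>std_normal) = (\<integral>\<^sup>+\<zeta>. ennreal (std_normal_density \<zeta> * exp (a * \<bar>\<zeta>\<bar>)) \<partial>lborel)"
    unfolding std_normal_def by (subst nn_integral_density) (auto simp: ennreal_mult')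
  also have "\<dots> \<le> (\<integral>\<^sup>+\<zeta>. ennreal (std_normal_density \<zeta> * exp (a * \<zeta>)) + ennreal (std_normal_density \<zeta> * exp (- a * \<zeta>)) \<partial>lborel)"
    by (intro nn_integral_mono) (auto simp: abs_if ennreal_plus[symmetric] simp del: ennreal_plus intro!: ennreal_leI)
  also have "\<dots> = ennreal (exp (a\<^sup>2 / 2)) + ennreal (exp (a\<^sup>2 / 2))"
    using fin[of a] fin[of "-a"] by (subst nn_integral_add) auto
  also have "\<dots> < \<infinity>" by simp
  finally show ?thesis .
qed

section \<open>Elementary inequalities for \<open>lnp\<close> and the exponential\<close>

lemma lnp_nonneg: "h \<ge> 0 \<Longrightarrow> lnp h l \<ge> 0"
  by (simp add: lnp_def)

lemma lnp_le: "h \<ge> 0 \<Longrightarrow> lnp h l \<le> h * exp l"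
  unfolding lnp_def by (intro ln_add_one_self_le_self) simp

text \<open>For x = \<open>h * exp l\<close> this is x - x^2 \<le> ln (1 + x): the usual lower bound
  of the logarithm if x \<le> 1, and a comparison of signs otherwise.\<close>

lemma lnp_ge:
  assumes "h \<ge> 0"
  shows "h * exp l - h\<^sup>2 * exp (2 * l) \<le> lnp h l"
proof -
  define x where "x = h * exp l"
  have x: "x \<ge> 0" using assms by (simp add: x_def)
  have "x - x\<^sup>2 \<le> ln (1 + x)"
  proof (cases "x \<le> 1")
    case True then show ?thesis using ln_one_plus_pos_lower_bound[OF x] by simp
  next
    case False
    then have "x * 1 \<le> x * x" by (intro mult_left_mono) auto
    then have "x - x\<^sup>2 \<le> 0" by (simp add: power2_eq_square)
    also have "0 \<le> ln (1 + x)" using x by simp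
    finally show ?thesis .
  qed
  moreover have "x\<^sup>2 = h\<^sup>2 * exp (2 * l)"
    by (simp add: x_def power_mult_distrib exp_double)
  ultimately show ?thesis by (simp add: lnp_def x_def)
qed

text \<open>The slope of \<open>lnp h\<close> is h exp l / (1 + h exp l), which lies between 0 and
  1. The upper bound is obtained without differentiation from 1 + h exp a \<le> exp (a - b) (1 + h
  exp b).\<close>

lemma lnp_diff:
  assumes "h \<ge> 0" "b \<le> a"
  shows "0 \<le> lnp h a - lnp h b" "lnp h a - lnp h b \<le> a - b"
proof -
  have p: "1 + h * exp l > 0" for l using assms(1) by (simp add: add_pos_nonneg)
  show "0 \<le> lnp h a - lnp h b"
    using assms p by (simp add: lnp_def mult_left_mono)
  have "1 + h * exp a \<le> exp (a - b) * (1 + h * exp b)"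
    using assms by (simp add: algebra_simps flip: exp_add)
  then have "lnp h a \<le> ln (exp (a - b) * (1 + h * exp b))"
    unfolding lnp_def using p by (intro ln_mono) auto
  also have "\<dots> = a - b + lnp h b"
    using p[of b] by (simp add: ln_mult lnp_def)
  finally show "lnp h a - lnp h b \<le> a - b" by simp
qed

lemma lnp_lipschitz: "h \<ge> 0 \<Longrightarrow> \<bar>lnp h a - lnp h b\<bar> \<le> \<bar>a - b\<bar>"
  using lnp_diff[of h b a] lnp_diff[of h a b] by (cases "b \<le> a") auto

text \<open>
  The equality, and not just the Lipschitz bound, makes a time step non-expansive below: the part
  of a perturbation of \<open>l\<close> that is passed on to the next levels is lost by \<open>l\<close> itself.
\<close>

lemma lnp_contraction: "h \<ge> 0 \<Longrightarrow> \<bar>(a - lnp h a) - (b - lnp h b)\<bar> + \<bar>lnp h a - lnp h b\<bar> = \<bar>a - b\<bar>"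
  using lnp_diff[of h b a] lnp_diff[of h a b] by (cases "b \<le> a") auto

lemma exp_diff_le:
  fixes x y :: real
  shows "\<bar>exp x - exp y\<bar> \<le> \<bar>x - y\<bar> * (exp x + exp y)"
proof -
  have *: "exp y - exp x \<le> (y - x) * (exp x + exp y)" if "x \<le> y" for x y :: real
  proof -
    have "1 + (x - y) \<le> exp (x - y)" by (rule exp_ge_add_one_self)
    then have "exp y * (1 + (x - y)) \<le> exp y * exp (x - y)" by simp
    also have "\<dots> = exp x" by (simp flip: exp_add)
    finally have "exp y - exp x \<le> (y - x) * exp y" by (simp add: algebra_simps)
    moreover have "(y - x) * exp x \<ge> 0" using that by simp
    ultimately show ?thesis by (simp add: distrib_left)
  qed
  show ?thesis
  proof (cases "x \<le> y")
    case True then show ?thesis using *[OF True] by (simp add: abs_if)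
  next
    case False then show ?thesis using *[of y x] by (simp add: abs_if add.commute)
  qed
qed

text \<open>Convexity at both ends: the tangent at \<open>l\<close> makes the remainder nonnegative,
  and the tangent at \<open>b\<close> bounds it by (b - l) (exp b - exp l), to which
  \<open>exp_diff_le\<close> applies.\<close>

lemma exp_taylor2:
  fixes l b :: real
  shows "\<bar>exp b - exp l - (b - l) * exp l\<bar> \<le> (b - l)\<^sup>2 * (exp l + exp b)"
proof -
  have tangent: "exp x + (y - x) * exp x \<le> exp y" for x y :: real
  proof -
    have "exp x * (1 + (y - x)) \<le> exp x * exp (y - x)"
      using exp_ge_add_one_self[of "y - x"] by simp
    then show ?thesis by (simp add: algebra_simps flip: exp_add)
  qed
  have "exp b - exp l - (b - l) * exp l \<le> (b - l) * (exp b - exp l)"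
    using tangent[of b l] by (simp add: algebra_simps)
  also have "\<dots> \<le> \<bar>b - l\<bar> * \<bar>exp b - exp l\<bar>" by (metis abs_ge_self abs_mult)
  also have "\<dots> \<le> \<bar>b - l\<bar> * (\<bar>b - l\<bar> * (exp b + exp l))"
    by (intro mult_left_mono exp_diff_le) auto
  also have "\<dots> = (b - l)\<^sup>2 * (exp l + exp b)" by (simp add: power2_eq_square flip: abs_mult mult.assoc)
  finally show ?thesis using tangent[of l b] by simp
qed

text \<open>Converts a bound on the log-ratio of two densities into a bound on their difference. The
  weight x + y allows the result to be integrated against each of the two densities
  separately.\<close>

lemma abs_diff_le_ln_diff:
  fixes x y :: real
  assumes "x > 0" "y > 0"
  shows "\<bar>x - y\<bar> \<le> \<bar>ln x - ln y\<bar> * (x + y)"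
  using exp_diff_le[of "ln x" "ln y"] assms by simp

lemma exp_add_le: "exp l + exp b \<le> 1 + exp (2 * l) + exp (2 * b :: real)"
proof -
  have "2 * exp x \<le> 1 + exp (2 * x)" for x :: real
    using zero_le_power2[of "1 - exp x"] unfolding exp_double power2_eq_square by (simp add: algebra_simps)
  from this[of l] this[of b] exp_gt_zero[of "2 * l"] exp_gt_zero[of "2 * b"] show ?thesis by linarith
qed

text \<open>
  \<open>jump_weight\<close> is symmetric in \<open>l\<close> and \<open>b\<close>, so that the symmetrised density can be
  bounded by the arithmetic mean of the two one-sided ones.
\<close>

definition jump_weight :: "real \<Rightarrow> real \<Rightarrow> real \<Rightarrow> real" where
  "jump_weight h l b = \<bar>b - l\<bar> * ((b - l)\<^sup>2 + h) * (1 + exp (2 * l) + exp (2 * b))"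

lemma jump_weight_commute: "jump_weight h l b = jump_weight h b l"
  by (simp add: jump_weight_def power2_commute abs_minus_commute)

lemma jump_weight_nonneg: "h \<ge> 0 \<Longrightarrow> jump_weight h l b \<ge> 0"
  by (simp add: jump_weight_def)

text \<open>The three factors of the weight are at most multiples of the powers 1, 2 and 2 of
  \<open>exp q * e\<close>, which explains the total exponent 5; \<open>exp q ^ 5\<close> gives the
  exponents 10, and 128 is 4 times the constant 32 in (1 + exp l)^5 \<le> 32 (1 + exp (5 l)). The
  second bound on \<open>b\<close> is free of \<open>exp l\<close>: from the first one alone,
  \<open>exp (2 * b)\<close> would be bounded only doubly exponentially in \<open>l\<close>.\<close>

lemma jump_weight_bound:
  assumes h: "0 < h" "h \<le> 1" and \<mu>: "\<mu> > 0"
    and b: "\<bar>b - l\<bar> \<le> sqrt h * (2 * \<mu> + exp l + 2 * \<bar>\<zeta>\<bar>)" "b \<le> l + 2 * \<mu> + 2 * \<bar>\<zeta>\<bar>"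
  shows "jump_weight h l b \<le> h * sqrt h * (128 * exp (10 * \<mu>) * exp (10 * \<bar>\<zeta>\<bar>) * (1 + exp (5 * l)))"
proof -
  define q where "q = 2 * \<mu> + 2 * \<bar>\<zeta>\<bar>"
  define e where "e = 1 + exp l"
  have q: "q \<ge> 0" and e: "e \<ge> 1" using \<mu> by (auto simp: q_def e_def)
  have eq1: "exp q \<ge> 1" using q by simp
  have s: "sqrt h > 0" using h by simp
  have "2 * \<mu> + exp l + 2 * \<bar>\<zeta>\<bar> = q + exp l" by (simp add: q_def)
  also have "\<dots> \<le> (1 + q) * e" using q by (simp add: e_def algebra_simps)
  also have "\<dots> \<le> exp q * e" using e exp_ge_add_one_self[of q] by (intro mult_right_mono) auto
  finally have "sqrt h * (2 * \<mu> + exp l + 2 * \<bar>\<zeta>\<bar>) \<le> sqrt h * (exp q * e)"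
    using s by (intro mult_left_mono) auto
  then have d: "\<bar>b - l\<bar> \<le> sqrt h * (exp q * e)" using b(1) by simp
  have qe: "1 \<le> exp q * e" using mult_mono[OF eq1 e] by simp
  have "(b - l)\<^sup>2 \<le> (sqrt h * (exp q * e))\<^sup>2"
    using power_mono[OF d, of 2] by simp
  also have "\<dots> = h * (exp q * e)\<^sup>2" using h by (simp add: power_mult_distrib)
  finally have "(b - l)\<^sup>2 + h \<le> h * (exp q * e)\<^sup>2 + h * 1" by simp
  also have "\<dots> \<le> h * (exp q * e)\<^sup>2 + h * (exp q * e)\<^sup>2"
    using qe h by (intro add_left_mono mult_left_mono) (auto simp: one_le_power)
  finally have d2: "(b - l)\<^sup>2 + h \<le> 2 * h * (exp q * e)\<^sup>2" by simp
  have el: "exp l \<le> e" "exp l > 0" by (auto simp: e_def)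
  have "exp (2 * b) \<le> exp (2 * l + 2 * q)" using b(2) by (simp add: q_def)
  also have "\<dots> = (exp q * exp l)\<^sup>2" by (simp add: exp_add exp_double power_mult_distrib)
  finally have 3: "exp (2 * b) \<le> (exp q * exp l)\<^sup>2" .
  have "1 + exp (2 * l) + exp (2 * b) \<le> 1 + (exp q * exp l)\<^sup>2 + (exp q * exp l)\<^sup>2"
  proof -
    have "1 * exp l \<le> exp q * exp l" using eq1 by (intro mult_right_mono) auto
    then have "(exp l)\<^sup>2 \<le> (exp q * exp l)\<^sup>2" by (intro power_mono) auto
    moreover have "exp (2 * l) = (exp l)\<^sup>2" by (simp add: exp_double)
    ultimately show ?thesis using 3 by linarith
  qed
  also have "\<dots> \<le> 2 * (exp q)\<^sup>2 * (1 + (exp l)\<^sup>2)"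
    using one_le_power[OF eq1, of 2] by (simp add: power_mult_distrib algebra_simps)
  also have "1 + (exp l)\<^sup>2 \<le> e\<^sup>2" by (simp add: e_def power2_eq_square algebra_simps)
  finally have d3: "1 + exp (2 * l) + exp (2 * b) \<le> 2 * (exp q * e)\<^sup>2"
    by (simp add: power_mult_distrib)
  have e5: "e ^ 5 \<le> 32 * (1 + exp (5 * l))"
  proof (cases "exp l \<le> 1")
    case True
    then have "e ^ 5 \<le> 2 ^ 5" using e by (intro power_mono) (auto simp: e_def)
    then have "e ^ 5 \<le> 32" by simp
    also have "32 \<le> 32 * (1 + exp (5 * l))" by simp
    finally show ?thesis .
  next
    case False
    then have "e ^ 5 \<le> (2 * exp l) ^ 5" using e by (intro power_mono) (auto simp: e_def)
    also have "\<dots> = 32 * exp (5 * l)" by (simp add: power_mult_distrib flip: exp_of_nat_mult)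
    finally show ?thesis by simp
  qed
  have "jump_weight h l b \<le> (sqrt h * (exp q * e)) * (2 * h * (exp q * e)\<^sup>2) * (2 * (exp q * e)\<^sup>2)"
    unfolding jump_weight_def using h e by (intro mult_mono d d2 d3) (auto intro!: mult_nonneg_nonneg add_nonneg_nonneg)
  also have "\<dots> = h * sqrt h * (4 * exp q ^ 5 * e ^ 5)"
    by (simp add: power_mult_distrib eval_nat_numeral)
  also have "\<dots> \<le> h * sqrt h * (4 * exp q ^ 5 * (32 * (1 + exp (5 * l))))"
    using h by (intro mult_left_mono e5) auto
  also have "exp q ^ 5 = exp (10 * \<mu>) * exp (10 * \<bar>\<zeta>\<bar>)"
    by (simp add: q_def flip: exp_of_nat_mult exp_add)
  finally show ?thesis by (simp add: algebra_simps)
qed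

section \<open>Expectation of the jump weight\<close>

text \<open>The Gaussian and the log-gamma moment that come out of \<open>jump_weight_bound\<close>.
  Both are finite, so \<open>enn2real\<close> does not collapse them to 0.\<close>

definition jump_constant :: "real \<Rightarrow> real" where
  "jump_constant \<mu> = 128 * exp (10 * \<mu>) * enn2real (\<integral>\<^sup>+\<zeta>. ennreal (exp (10 * \<bar>\<zeta>\<bar>)) \<partial>std_normal)
     * enn2real (\<integral>\<^sup>+l. ennreal (1 + exp (5 * l)) \<partial>log_gamma \<mu>)"

lemma jump_constant_nonneg: "jump_constant \<mu> \<ge> 0"
  by (simp add: jump_constant_def)

lemma measurable_jump_weight[measurable]:
  "(\<lambda>(l, b). jump_weight h l b) \<in> borel_measurable (borel \<Otimes>\<^sub>M borel)"
  unfolding jump_weight_def[abs_def] split_beta' by measurable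

text \<open>The centre \<open>c\<close> is kept general because two instances occur: the drifted
  centre of the actual step, and \<open>c l = l\<close> for the driftless Gaussian in the symmetric
  density.\<close>

lemma nn_integral_jump_weight_le:
  assumes h: "0 < h" "h \<le> 1" and \<mu>: "\<mu> > 0"
    and [measurable]: "c \<in> borel_measurable borel"
    and c: "\<And>l. \<bar>c l - l\<bar> \<le> sqrt h * (2 * \<mu> + exp l)" "\<And>l. c l \<le> l + 2 * \<mu>"
  shows "(\<integral>\<^sup>+l. \<integral>\<^sup>+\<zeta>. ennreal (jump_weight h l (c l + 2 * sqrt h * \<zeta>)) \<partial>std_normal \<partial>log_gamma \<mu>)
    \<le> ennreal (jump_constant \<mu> * (h * sqrt h))"
proof -
  define J1 where "J1 = enn2real (\<integral>\<^sup>+\<zeta>. ennreal (exp (10 * \<bar>\<zeta>\<bar>)) \<partial>std_normal)"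
  define J2 where "J2 = enn2real (\<integral>\<^sup>+l. ennreal (1 + exp (5 * l)) \<partial>log_gamma \<mu>)"
  interpret LG: prob_space "log_gamma \<mu>" by (rule prob_space_log_gamma) fact
  have J1: "(\<integral>\<^sup>+\<zeta>. ennreal (exp (10 * \<bar>\<zeta>\<bar>)) \<partial>std_normal) = ennreal J1"
    using nn_integral_exp_abs_std_normal[of 10] by (simp add: J1_def less_top)
  have "(\<integral>\<^sup>+l. ennreal (1 + exp (5 * l)) \<partial>log_gamma \<mu>) = 1 + (\<integral>\<^sup>+l. ennreal (exp (5 * l)) \<partial>log_gamma \<mu>)"
    using LG.emeasure_space_1 by (simp add: nn_integral_add)
  also have "\<dots> < \<infinity>" using nn_integral_exp_log_gamma[OF \<mu>, of 5] by (simp add: less_top)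
  finally have J2: "(\<integral>\<^sup>+l. ennreal (1 + exp (5 * l)) \<partial>log_gamma \<mu>) = ennreal J2"
    by (simp add: J2_def less_top)
  have nn: "J1 \<ge> 0" "J2 \<ge> 0" by (simp_all add: J1_def J2_def)
  define K where "K = h * sqrt h * 128 * exp (10 * \<mu>)"
  have K: "K \<ge> 0" using h by (simp add: K_def)
  have b: "jump_weight h l (c l + 2 * sqrt h * \<zeta>) \<le> K * exp (10 * \<bar>\<zeta>\<bar>) * (1 + exp (5 * l))" for l \<zeta>
  proof -
    have "\<bar>c l + 2 * sqrt h * \<zeta> - l\<bar> \<le> \<bar>c l - l\<bar> + \<bar>2 * sqrt h * \<zeta>\<bar>" by linarith
    also have "\<bar>2 * sqrt h * \<zeta>\<bar> = sqrt h * (2 * \<bar>\<zeta>\<bar>)" using h by (simp add: abs_mult)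
    finally have 1: "\<bar>c l + 2 * sqrt h * \<zeta> - l\<bar> \<le> sqrt h * (2 * \<mu> + exp l + 2 * \<bar>\<zeta>\<bar>)"
      using c(1)[of l] by (simp add: distrib_left)
    have "sqrt h * \<zeta> \<le> sqrt h * \<bar>\<zeta>\<bar>" using h by (intro mult_left_mono) auto
    also have "\<dots> \<le> 1 * \<bar>\<zeta>\<bar>" using h by (intro mult_right_mono) auto
    finally have "sqrt h * \<zeta> \<le> \<bar>\<zeta>\<bar>" by simp
    then have 2: "c l + 2 * sqrt h * \<zeta> \<le> l + 2 * \<mu> + 2 * \<bar>\<zeta>\<bar>" using c(2)[of l] by simp
    show ?thesis using jump_weight_bound[OF h \<mu> 1 2] by (simp add: K_def mult_ac)
  qed
  have "(\<integral>\<^sup>+l. \<integral>\<^sup>+\<zeta>. ennreal (jump_weight h l (c l + 2 * sqrt h * \<zeta>)) \<partial>std_normal \<partial>log_gamma \<mu>)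
    \<le> (\<integral>\<^sup>+l. \<integral>\<^sup>+\<zeta>. ennreal (K * (1 + exp (5 * l))) * ennreal (exp (10 * \<bar>\<zeta>\<bar>)) \<partial>std_normal \<partial>log_gamma \<mu>)"
    using b K by (intro nn_integral_mono) (auto simp: ennreal_mult'[symmetric] mult_ac intro!: ennreal_leI)
  also have "\<dots> = (\<integral>\<^sup>+l. ennreal (K * J1) * ennreal (1 + exp (5 * l)) \<partial>log_gamma \<mu>)"
  proof (intro nn_integral_cong)
    fix l :: real
    have "(\<integral>\<^sup>+\<zeta>. ennreal (K * (1 + exp (5 * l))) * ennreal (exp (10 * \<bar>\<zeta>\<bar>)) \<partial>std_normal) = ennreal (K * (1 + exp (5 * l))) * ennreal J1"
      by (subst nn_integral_cmult) (simp_all add: J1)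
    also have "\<dots> = ennreal (K * J1) * ennreal (1 + exp (5 * l))"
      using K nn by (simp add: ennreal_mult'[symmetric] mult_ac del: ennreal_plus)
    finally show "(\<integral>\<^sup>+\<zeta>. ennreal (K * (1 + exp (5 * l))) * ennreal (exp (10 * \<bar>\<zeta>\<bar>)) \<partial>std_normal) = ennreal (K * J1) * ennreal (1 + exp (5 * l))" .
  qed
  also have "\<dots> = ennreal (K * J1 * J2)"
    using K nn by (subst nn_integral_cmult) (auto simp: J2 ennreal_mult'[symmetric] simp del: ennreal_plus)
  also have "K * J1 * J2 = jump_constant \<mu> * (h * sqrt h)"
    by (simp add: K_def J1_def J2_def jump_constant_def)
  finally show ?thesis .
qed

text \<open>
  \<open>step_density\<close> is the joint density of \<open>l\<close> and of the new value \<open>b\<close>. It is compared with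
  the symmetric density \<open>sym_density\<close>, against which antisymmetric functions integrate to 0.
\<close>

definition step_centre :: "real \<Rightarrow> real \<Rightarrow> real \<Rightarrow> real" where
  "step_centre \<mu> h l = l + 2 * \<mu> * h - lnp h l"

definition step_density :: "real \<Rightarrow> real \<Rightarrow> real \<Rightarrow> real \<Rightarrow> real" where
  "step_density \<mu> h l b = log_gamma_density \<mu> l * normal_density (step_centre \<mu> h l) (2 * sqrt h) b"

definition sym_density :: "real \<Rightarrow> real \<Rightarrow> real \<Rightarrow> real \<Rightarrow> real" where
  "sym_density \<mu> h l b =
     sqrt (log_gamma_density \<mu> l) * sqrt (log_gamma_density \<mu> b) * normal_density l (2 * sqrt h) b"

lemma measurable_step_centre[measurable]: "step_centre \<mu> h \<in> borel_measurable borel"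
  unfolding step_centre_def[abs_def] by measurable

lemma measurable_step_density[measurable]:
  "(\<lambda>(l, b). step_density \<mu> h l b) \<in> borel_measurable (borel \<Otimes>\<^sub>M borel)"
  unfolding step_density_def normal_density_def split_beta' by measurable

lemma measurable_sym_density[measurable]:
  "(\<lambda>(l, b). sym_density \<mu> h l b) \<in> borel_measurable (borel \<Otimes>\<^sub>M borel)"
  unfolding sym_density_def normal_density_def split_beta' by measurable

lemma sym_density_commute: "sym_density \<mu> h l b = sym_density \<mu> h b l"
  by (simp add: sym_density_def normal_density_def power2_commute mult_ac)

lemma step_density_pos: "\<mu> > 0 \<Longrightarrow> h > 0 \<Longrightarrow> step_density \<mu> h l b > 0"
  by (simp add: step_density_def log_gamma_density_pos normal_density_pos)

lemma sym_density_pos: "\<mu> > 0 \<Longrightarrow> h > 0 \<Longrightarrow> sym_density \<mu> h l b > 0"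
  by (simp add: sym_density_def log_gamma_density_pos normal_density_pos)

section \<open>Comparison of the step density with the symmetric density\<close>

lemma ln_normal_density:
  "s > 0 \<Longrightarrow> ln (normal_density m s x) = - ln (sqrt (2 * pi * s\<^sup>2)) - (x - m)\<^sup>2 / (2 * s\<^sup>2)"
  by (simp add: normal_density_def ln_mult ln_div)

text \<open>Detailed balance to leading order. The terms \<mu> (b - l) / 2 from the log-gamma
  densities and from the drift of the Gaussian cancel exactly. What remains is a Taylor remainder of
  the exponential, because \<open>lnp h l / h\<close> is close to \<open>exp l\<close>, and the
  square of the drift.\<close>

lemma ln_step_density_diff:
  assumes \<mu>: "\<mu> > 0" and h: "h > 0"
  shows "ln (step_density \<mu> h l b) - ln (sym_density \<mu> h l b) =
    (exp b - exp l - (b - l) * (lnp h l / h)) / 4 - (lnp h l - 2 * \<mu> * h)\<^sup>2 / (8 * h)"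
proof -
  note pos = log_gamma_density_pos[OF \<mu>] normal_density_pos[of "2 * sqrt h"]
  have lg: "ln (log_gamma_density \<mu> l) = \<mu> * l - exp l / 2 - ln (Gamma \<mu> * 2 powr \<mu>)" for l
    unfolding log_gamma_density_def using Gamma_real_pos[OF \<mu>] by (subst ln_div) auto
  define C where "C = ln (sqrt (2 * pi * (2 * sqrt h)\<^sup>2))"
  have nd: "ln (normal_density m (2 * sqrt h) b) = - C - (b - m)\<^sup>2 / (8 * h)" for m
    using h by (subst ln_normal_density) (auto simp: C_def power_mult_distrib)
  have 1: "ln (step_density \<mu> h l b) = ln (log_gamma_density \<mu> l) - C - (b - step_centre \<mu> h l)\<^sup>2 / (8 * h)"
    unfolding step_density_def using pos h by (subst ln_mult) (auto simp: nd less_imp_neq[THEN not_sym])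
  have 2: "ln (sqrt (log_gamma_density \<mu> x)) = ln (log_gamma_density \<mu> x) / 2" for x
    using pos(1)[of x] by (simp add: ln_sqrt)
  have 3: "ln (sym_density \<mu> h l b) = ln (sqrt (log_gamma_density \<mu> l)) + ln (sqrt (log_gamma_density \<mu> b)) - C - (b - l)\<^sup>2 / (8 * h)"
    unfolding sym_density_def using pos h
    by (subst ln_mult, simp_all add: nd less_imp_neq[THEN not_sym], subst ln_mult, simp_all add: less_imp_neq[THEN not_sym])
  have 4: "(b - step_centre \<mu> h l)\<^sup>2 / (8 * h) = (b - l)\<^sup>2 / (8 * h) + (b - l) * (lnp h l / h) / 4 - \<mu> * (b - l) / 2
      + (lnp h l - 2 * \<mu> * h)\<^sup>2 / (8 * h)"
    using h by (simp add: step_centre_def field_simps power2_eq_square)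
  show ?thesis
    unfolding 1 3 2 4 lg by (simp add: algebra_simps add_divide_distrib diff_divide_distrib)
qed

text \<open>The log-ratio is of order (b - l)^2 + h with exponential weights. The extra factor
  \<open>\<bar>b - l\<bar>\<close> is the one that a Lipschitz antisymmetric function
  supplies.\<close>

lemma density_ratio_bound:
  assumes \<mu>: "\<mu> > 0" and h: "0 < h" "h \<le> 1"
  shows "\<bar>b - l\<bar> * \<bar>ln (step_density \<mu> h l b) - ln (sym_density \<mu> h l b)\<bar> \<le> 2 * (1 + \<mu>\<^sup>2) * jump_weight h l b"
proof -
  define D where "D = \<bar>b - l\<bar>"
  define E where "E = 1 + exp (2 * l) + exp (2 * b)"
  define g where "g = lnp h l"
  have D: "D \<ge> 0" and E: "E \<ge> 1" by (auto simp: D_def E_def)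
  have eE: "exp l + exp b \<le> E" unfolding E_def by (rule exp_add_le)
  have e2: "exp (2 * l) \<le> E" by (simp add: E_def)
  have g: "0 \<le> g" "g \<le> h * exp l" "h * exp l - h\<^sup>2 * exp (2 * l) \<le> g"
    using lnp_nonneg[of h l] lnp_le[of h l] lnp_ge[of h l] h by (auto simp: g_def)
  \<comment> \<open>Folds the mixed term, which comes from replacing \<open>lnp h l / h\<close> by
    \<open>exp l\<close>, into D^2 + h; this uses \<open>h \<le> 1\<close>.\<close>
  have Dh: "D * h \<le> D\<^sup>2 + h"
  proof -
    have "2 * (D * h) \<le> D\<^sup>2 + h\<^sup>2" using zero_le_power2[of "D - h"] by (simp add: power2_diff)
    moreover have "h\<^sup>2 \<le> h" using h by (simp add: power2_eq_square mult_le_one mult_left_le)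
    ultimately show ?thesis using zero_le_power2[of D] h by linarith
  qed
  have "exp b - exp l - (b - l) * (g / h) = (exp b - exp l - (b - l) * exp l) + (b - l) * (exp l - g / h)"
    by (simp add: algebra_simps)
  then have "\<bar>exp b - exp l - (b - l) * (g / h)\<bar> \<le> \<bar>exp b - exp l - (b - l) * exp l\<bar> + D * \<bar>exp l - g / h\<bar>"
    by (metis D_def abs_mult abs_triangle_ineq)
  also have "\<dots> \<le> D\<^sup>2 * E + D * (h * E)"
  proof (intro add_mono mult_left_mono D)
    have "\<bar>exp b - exp l - (b - l) * exp l\<bar> \<le> (b - l)\<^sup>2 * (exp l + exp b)" by (rule exp_taylor2)
    also have "\<dots> \<le> D\<^sup>2 * E" unfolding D_def power2_abs by (intro mult_left_mono eE) auto
    finally show "\<bar>exp b - exp l - (b - l) * exp l\<bar> \<le> D\<^sup>2 * E" .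
    have "exp l - g / h \<ge> 0" using g h by (simp add: field_simps)
    moreover have "exp l - g / h \<le> h * exp (2 * l)" using g h by (simp add: field_simps power2_eq_square)
    moreover have "h * exp (2 * l) \<le> h * E" using h by (intro mult_left_mono e2) auto
    ultimately show "\<bar>exp l - g / h\<bar> \<le> h * E" by simp
  qed
  also have "\<dots> = (D\<^sup>2 + D * h) * E" by (simp add: algebra_simps)
  also have "\<dots> \<le> (D\<^sup>2 + (D\<^sup>2 + h)) * E" using Dh E by (intro mult_right_mono) auto
  also have "\<dots> \<le> 2 * ((D\<^sup>2 + h) * E)" using E h by (simp add: algebra_simps)
  finally have 1: "\<bar>exp b - exp l - (b - l) * (g / h)\<bar> \<le> 2 * ((D\<^sup>2 + h) * E)" .
  \<comment> \<open>The cross term of the square has a favourable sign, as g, \<mu> and h are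
    nonnegative.\<close>
  have "(g - 2 * \<mu> * h)\<^sup>2 \<le> g\<^sup>2 + (2 * \<mu> * h)\<^sup>2" using g \<mu> h by (simp add: power2_diff)
  also have "g\<^sup>2 \<le> (h * exp l)\<^sup>2" using g by (intro power_mono) auto
  also have "(h * exp l)\<^sup>2 = h * (h * exp (2 * l))" by (simp add: power2_eq_square exp_double)
  also have "\<dots> \<le> h * (h * E)" using h by (intro mult_left_mono e2) auto
  also have "h * (h * E) + (2 * \<mu> * h)\<^sup>2 \<le> h * (h * E) + h * (h * (4 * \<mu>\<^sup>2 * E))"
  proof -
    have "h\<^sup>2 * \<mu>\<^sup>2 * 1 \<le> h\<^sup>2 * \<mu>\<^sup>2 * E" using E by (intro mult_left_mono) auto
    then show ?thesis by (simp add: power2_eq_square mult_ac)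
  qed
  also have "\<dots> = h * (h * E * (1 + 4 * \<mu>\<^sup>2))" by (simp add: algebra_simps)
  finally have "(g - 2 * \<mu> * h)\<^sup>2 / (8 * h) \<le> h * E * (1 + 4 * \<mu>\<^sup>2) / 8"
    using h by (simp add: field_simps)
  also have "\<dots> \<le> h * E * (1 + \<mu>\<^sup>2)" using h E by (simp add: field_simps add_nonneg_nonneg)
  also have "\<dots> \<le> ((D\<^sup>2 + h) * E) * (1 + \<mu>\<^sup>2)" using h E by (intro mult_right_mono) auto
  finally have 2: "\<bar>(g - 2 * \<mu> * h)\<^sup>2 / (8 * h)\<bar> \<le> ((D\<^sup>2 + h) * E) * (1 + \<mu>\<^sup>2)" using h by simp
  have X: "(D\<^sup>2 + h) * E \<ge> 0" using h E by simp
  have "\<bar>ln (step_density \<mu> h l b) - ln (sym_density \<mu> h l b)\<bar>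
      \<le> \<bar>exp b - exp l - (b - l) * (g / h)\<bar> / 4 + \<bar>(g - 2 * \<mu> * h)\<^sup>2 / (8 * h)\<bar>"
    unfolding ln_step_density_diff[OF \<mu> h(1)] g_def[symmetric]
    by (rule order_trans[OF abs_triangle_ineq4]) simp
  also have "\<dots> \<le> ((D\<^sup>2 + h) * E) / 2 + ((D\<^sup>2 + h) * E) * (1 + \<mu>\<^sup>2)"
    by (rule add_mono[OF _ 2]) (use 1 in simp)
  also have "\<dots> \<le> 2 * (1 + \<mu>\<^sup>2) * ((D\<^sup>2 + h) * E)"
  proof -
    have "((D\<^sup>2 + h) * E) * \<mu>\<^sup>2 \<ge> 0" using X by simp
    then show ?thesis using X by (simp add: algebra_simps)
  qed
  finally have "D * \<bar>ln (step_density \<mu> h l b) - ln (sym_density \<mu> h l b)\<bar> \<le> D * (2 * (1 + \<mu>\<^sup>2) * ((D\<^sup>2 + h) * E))"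
    using D by (intro mult_left_mono) auto
  then show ?thesis by (simp add: jump_weight_def D_def E_def mult_ac)
qed

text \<open>Passes from planar Lebesgue measure to sampling in two stages: \<open>l\<close> from the
  log-gamma law, then a Gaussian displacement around \<open>c l\<close>.\<close>

lemma nn_integral_step_density:
  assumes \<mu>: "\<mu> > 0" and h: "h > 0"
    and [measurable]: "c \<in> borel_measurable borel" "(\<lambda>(l, b). f l b) \<in> borel_measurable (borel \<Otimes>\<^sub>M borel)"
    and f: "\<And>l b. f l b \<ge> 0"
  shows "(\<integral>\<^sup>+z. ennreal (f (fst z) (snd z) *
        (log_gamma_density \<mu> (fst z) * normal_density (c (fst z)) (2 * sqrt h) (snd z))) \<partial>(lborel \<Otimes>\<^sub>M lborel)) =
     (\<integral>\<^sup>+l. \<integral>\<^sup>+\<zeta>. ennreal (f l (c l + 2 * sqrt h * \<zeta>)) \<partial>std_normal \<partial>log_gamma \<mu>)"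
proof -
  have [measurable]: "(\<lambda>z. f (fst z) (snd z)) \<in> borel_measurable (borel \<Otimes>\<^sub>M borel)"
    using assms(4) by (simp add: split_beta')
  have [measurable]: "f l \<in> borel_measurable borel" for l
    using measurable_compose_Pair1[of l borel "\<lambda>z. f (fst z) (snd z)" borel borel] by simp
  note pos = log_gamma_density_pos[OF \<mu>, THEN less_imp_le]
  have inner: "(\<integral>\<^sup>+\<zeta>. ennreal (f l (c l + 2 * sqrt h * \<zeta>)) \<partial>std_normal) =
      (\<integral>\<^sup>+b. ennreal (normal_density (c l) (2 * sqrt h) b) * ennreal (f l b) \<partial>lborel)" for l
    by (rule distributed_nn_integral[OF distributed_std_normal_affine, symmetric]) (use h in auto)
  have m: "(\<lambda>z. ennreal (f (fst z) (snd z) *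
        (log_gamma_density \<mu> (fst z) * normal_density (c (fst z)) (2 * sqrt h) (snd z)))) \<in> borel_measurable (lborel \<Otimes>\<^sub>M lborel)"
    unfolding normal_density_def by measurable
  have m2: "(\<lambda>l. \<integral>\<^sup>+\<zeta>. ennreal (f l (c l + 2 * sqrt h * \<zeta>)) \<partial>std_normal) \<in> borel_measurable borel"
    by (intro sigma_finite_measure.borel_measurable_nn_integral prob_space_imp_sigma_finite prob_space_std_normal) measurable
  have "(\<integral>\<^sup>+z. ennreal (f (fst z) (snd z) *
        (log_gamma_density \<mu> (fst z) * normal_density (c (fst z)) (2 * sqrt h) (snd z))) \<partial>(lborel \<Otimes>\<^sub>M lborel)) =
     (\<integral>\<^sup>+l. \<integral>\<^sup>+b. ennreal (f l b * (log_gamma_density \<mu> l * normal_density (c l) (2 * sqrt h) b)) \<partial>lborel \<partial>lborel)"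
    by (subst lborel.nn_integral_fst[OF m, symmetric]) simp
  also have "\<dots> = (\<integral>\<^sup>+l. ennreal (log_gamma_density \<mu> l) * (\<integral>\<^sup>+b. ennreal (normal_density (c l) (2 * sqrt h) b) * ennreal (f l b) \<partial>lborel) \<partial>lborel)"
    using pos f by (subst nn_integral_cmult[symmetric]) (auto intro!: nn_integral_cong simp: ennreal_mult'[symmetric] mult_ac)
  also have "\<dots> = (\<integral>\<^sup>+l. \<integral>\<^sup>+\<zeta>. ennreal (f l (c l + 2 * sqrt h * \<zeta>)) \<partial>std_normal \<partial>log_gamma \<mu>)"
    unfolding log_gamma_def using m2 by (subst nn_integral_density) (simp_all add: inner)
  finally show ?thesis .
qed

text \<open>The third bound is the sampled form of the first. For the second, the geometric mean of
  the log-gamma densities at \<open>l\<close> and \<open>b\<close> is at most their arithmetic mean,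
  and the two resulting integrals agree because exchanging the coordinates preserves Lebesgue
  measure.\<close>

lemma nn_integral_jump_weight_step_density:
  assumes \<mu>: "\<mu> > 0" and h: "0 < h" "h \<le> 1"
  shows "(\<integral>\<^sup>+z. ennreal (jump_weight h (fst z) (snd z) * step_density \<mu> h (fst z) (snd z)) \<partial>(lborel \<Otimes>\<^sub>M lborel))
      \<le> ennreal (jump_constant \<mu> * (h * sqrt h))" (is ?A)
    and "(\<integral>\<^sup>+z. ennreal (jump_weight h (fst z) (snd z) * sym_density \<mu> h (fst z) (snd z)) \<partial>(lborel \<Otimes>\<^sub>M lborel))
      \<le> ennreal (jump_constant \<mu> * (h * sqrt h))" (is ?B)
    and "(\<integral>\<^sup>+l. \<integral>\<^sup>+\<zeta>. ennreal (jump_weight h l (step_centre \<mu> h l + 2 * sqrt h * \<zeta>)) \<partial>std_normal \<partial>log_gamma \<mu>)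
      \<le> ennreal (jump_constant \<mu> * (h * sqrt h))" (is ?C)
proof -
  \<comment> \<open>The drift moves \<open>l\<close> by order \<open>h\<close> only; it is absorbed
    into the scale \<open>sqrt h\<close> of the noise.\<close>
  have hs: "h \<le> sqrt h" using h by (simp add: real_le_rsqrt power2_eq_square mult_le_one mult_left_le)
  show ?C
  proof (rule nn_integral_jump_weight_le[OF h \<mu>])
    fix l
    have g: "0 \<le> lnp h l" "lnp h l \<le> h * exp l" using h lnp_nonneg lnp_le by auto
    have "\<bar>step_centre \<mu> h l - l\<bar> \<le> h * (2 * \<mu> + exp l)"
      using g h \<mu> by (auto simp: step_centre_def algebra_simps abs_le_iff intro: add_nonneg_nonneg)
        (smt (verit) mult_nonneg_nonneg exp_gt_zero)+
    also have "\<dots> \<le> sqrt h * (2 * \<mu> + exp l)" using \<mu> hs by (intro mult_right_mono) (auto simp: add_nonneg_nonneg)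
    finally show "\<bar>step_centre \<mu> h l - l\<bar> \<le> sqrt h * (2 * \<mu> + exp l)" .
    show "step_centre \<mu> h l \<le> l + 2 * \<mu>" proof -
      have "2 * \<mu> * h \<le> 2 * \<mu> * 1" using h \<mu> by (intro mult_left_mono) auto
      then show ?thesis using g by (simp add: step_centre_def)
    qed
  qed measurable
  then show ?A
    unfolding step_density_def
    by (subst nn_integral_step_density) (use \<mu> h in \<open>auto simp: jump_weight_nonneg\<close>)
  define F where "F = (\<lambda>z. jump_weight h (fst z) (snd z) *
     (log_gamma_density \<mu> (fst z) * normal_density (fst z) (2 * sqrt h) (snd z)))"
  have [measurable]: "F \<in> borel_measurable (lborel \<Otimes>\<^sub>M lborel)"
    unfolding F_def normal_density_def jump_weight_def by measurable
  have F: "(\<integral>\<^sup>+z. ennreal (F z) \<partial>(lborel \<Otimes>\<^sub>M lborel)) \<le> ennreal (jump_constant \<mu> * (h * sqrt h))"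
    unfolding F_def
    by (subst nn_integral_step_density[where c="\<lambda>l. l"])
       (use \<mu> h in \<open>auto simp: jump_weight_nonneg intro!: nn_integral_jump_weight_le[where c="\<lambda>l. l"]\<close>)
  have swap: "(\<integral>\<^sup>+z. ennreal (F (snd z, fst z)) \<partial>(lborel \<Otimes>\<^sub>M lborel)) = (\<integral>\<^sup>+z. ennreal (F z) \<partial>(lborel \<Otimes>\<^sub>M lborel))"
  proof -
    have "(\<integral>\<^sup>+z. ennreal (F z) \<partial>(lborel \<Otimes>\<^sub>M lborel)) = (\<integral>\<^sup>+z. ennreal (F z) \<partial>(distr (lborel \<Otimes>\<^sub>M lborel) (lborel \<Otimes>\<^sub>M lborel) (\<lambda>(x, y). (y, x))))"
      by (subst lborel_pair.distr_pair_swap[symmetric]) simp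
    also have "\<dots> = (\<integral>\<^sup>+z. ennreal (F (snd z, fst z)) \<partial>(lborel \<Otimes>\<^sub>M lborel))"
      by (subst nn_integral_distr) (auto simp: split_beta')
    finally show ?thesis by simp
  qed
  define c :: real where "c = 1 / 2"
  have c: "c \<ge> 0" "c + c = 1" by (simp_all add: c_def)
  have le: "jump_weight h (fst z) (snd z) * sym_density \<mu> h (fst z) (snd z) \<le> c * F z + c * F (snd z, fst z)" for z
  proof -
    obtain l b where z: "z = (l, b)" by (cases z)
    define N where "N = jump_weight h l b * normal_density l (2 * sqrt h) b"
    have N: "N \<ge> 0" using h by (simp add: N_def jump_weight_nonneg)
    have nd: "normal_density b (2 * sqrt h) l = normal_density l (2 * sqrt h) b"
      by (simp add: normal_density_def power2_commute)
    have "sqrt (log_gamma_density \<mu> l) * sqrt (log_gamma_density \<mu> b) \<le> (log_gamma_density \<mu> l + log_gamma_density \<mu> b) / 2"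
      using arith_geo_mean_sqrt[of "log_gamma_density \<mu> l" "log_gamma_density \<mu> b"] log_gamma_density_pos[OF \<mu>]
      by (simp add: less_imp_le real_sqrt_mult)
    then have "N * (sqrt (log_gamma_density \<mu> l) * sqrt (log_gamma_density \<mu> b)) \<le> N * ((log_gamma_density \<mu> l + log_gamma_density \<mu> b) / 2)"
      using N by (rule mult_left_mono)
    moreover have "F z = log_gamma_density \<mu> l * N" "F (snd z, fst z) = log_gamma_density \<mu> b * N"
      by (simp_all add: z F_def N_def nd jump_weight_commute[of h b l])
    moreover have "jump_weight h (fst z) (snd z) * sym_density \<mu> h (fst z) (snd z) =
        N * (sqrt (log_gamma_density \<mu> l) * sqrt (log_gamma_density \<mu> b))"
      by (simp add: z N_def sym_density_def)
    ultimately show ?thesis by (simp add: algebra_simps c_def)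
  qed
  have F0: "F z \<ge> 0" for z
    using h by (simp add: F_def jump_weight_nonneg log_gamma_density_pos[OF \<mu>] less_imp_le)
  have "(\<integral>\<^sup>+z. ennreal (jump_weight h (fst z) (snd z) * sym_density \<mu> h (fst z) (snd z)) \<partial>(lborel \<Otimes>\<^sub>M lborel))
     \<le> (\<integral>\<^sup>+z. ennreal c * ennreal (F z) + ennreal c * ennreal (F (snd z, fst z)) \<partial>(lborel \<Otimes>\<^sub>M lborel))"
    using le F0 c by (intro nn_integral_mono) (simp add: ennreal_mult'[symmetric] ennreal_plus[symmetric] ennreal_leI del: ennreal_plus)
  also have "\<dots> = ennreal c * (\<integral>\<^sup>+z. ennreal (F z) \<partial>(lborel \<Otimes>\<^sub>M lborel)) + ennreal c * (\<integral>\<^sup>+z. ennreal (F z) \<partial>(lborel \<Otimes>\<^sub>M lborel))"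
    using swap by (simp add: nn_integral_add nn_integral_cmult)
  also have "\<dots> = (ennreal c + ennreal c) * (\<integral>\<^sup>+z. ennreal (F z) \<partial>(lborel \<Otimes>\<^sub>M lborel))"
    by (simp only: distrib_right)
  also have "ennreal c + ennreal c = 1" using c by (subst ennreal_plus[symmetric]) auto
  finally show ?B using F by simp
qed

section \<open>Cancellation for antisymmetric functions\<close>

text \<open>Exchanging the coordinates preserves planar Lebesgue measure, so the integral equals its
  own negative; this is consistent with the default value 0 of a divergent integral.\<close>

lemma integral_swap_antisymmetric:
  fixes F :: "real \<times> real \<Rightarrow> real"
  assumes [measurable]: "F \<in> borel_measurable (borel \<Otimes>\<^sub>M borel)" and anti: "\<And>l b. F (b, l) = - F (l, b)"
  shows "(\<integral>z. F z \<partial>(lborel \<Otimes>\<^sub>M lborel)) = 0"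
proof -
  have "(\<integral>z. F z \<partial>(lborel \<Otimes>\<^sub>M lborel)) = (\<integral>z. F z \<partial>(distr (lborel \<Otimes>\<^sub>M lborel) (lborel \<Otimes>\<^sub>M lborel) (\<lambda>(x, y). (y, x))))"
    by (subst lborel_pair.distr_pair_swap[symmetric]) simp
  also have "\<dots> = (\<integral>z. - F z \<partial>(lborel \<Otimes>\<^sub>M lborel))"
  proof (subst integral_distr)
    have "F (case z of (x, y) \<Rightarrow> (y, x)) = - F z" for z
      using anti[of "snd z" "fst z"] by (simp add: split_beta')
    then show "(\<integral>z. F (case z of (x, y) \<Rightarrow> (y, x)) \<partial>(lborel \<Otimes>\<^sub>M lborel)) = (\<integral>z. - F z \<partial>(lborel \<Otimes>\<^sub>M lborel))"
      by (rule Bochner_Integration.integral_cong[OF refl])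
  qed auto
  finally show ?thesis by simp
qed

text \<open>As \<open>X\<close> integrates to 0 against the symmetric density, only the difference
  of the two densities counts. It is at most the log-ratio times the sum of the densities; the two
  summands double the constant 2 (1 + \<mu>^2) of \<open>density_ratio_bound\<close>.\<close>

lemma lipschitz_antisymmetric_step_bound:
  fixes X :: "real \<Rightarrow> real \<Rightarrow> real"
  assumes \<mu>: "\<mu> > 0" and h: "0 < h" "h \<le> 1" and k: "k \<ge> 0"
    and [measurable]: "(\<lambda>(l, b). X l b) \<in> borel_measurable (borel \<Otimes>\<^sub>M borel)"
    and anti: "\<And>l b. X b l = - X l b"
    and bd: "\<And>l b. \<bar>X l b\<bar> \<le> k" and lip: "\<And>l b. \<bar>X l b\<bar> \<le> k * \<bar>b - l\<bar>"
  shows "\<bar>\<integral>l. \<integral>\<zeta>. X l (step_centre \<mu> h l + 2 * sqrt h * \<zeta>) \<partial>std_normal \<partial>log_gamma \<mu>\<bar>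
      \<le> 4 * (1 + \<mu>\<^sup>2) * jump_constant \<mu> * k * (h * sqrt h)"
proof -
  have [measurable]: "(\<lambda>z. X (fst z) (snd z)) \<in> borel_measurable (borel \<Otimes>\<^sub>M borel)"
    using assms(5) by (simp add: split_beta')
  have [measurable]: "X l \<in> borel_measurable borel" for l
    using measurable_compose_Pair1[of l borel "\<lambda>z. X (fst z) (snd z)" borel borel] by simp
  have [measurable]: "(\<lambda>z. step_density \<mu> h (fst z) (snd z)) \<in> borel_measurable (borel \<Otimes>\<^sub>M borel)"
      "(\<lambda>z. sym_density \<mu> h (fst z) (snd z)) \<in> borel_measurable (borel \<Otimes>\<^sub>M borel)"
      "(\<lambda>z. jump_weight h (fst z) (snd z)) \<in> borel_measurable (borel \<Otimes>\<^sub>M borel)"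
    using measurable_step_density[of \<mu> h] measurable_sym_density[of \<mu> h] measurable_jump_weight[of h]
    by (simp_all add: split_beta')
  let ?f = "\<lambda>z. step_density \<mu> h (fst z) (snd z)" and ?s = "\<lambda>z. sym_density \<mu> h (fst z) (snd z)"
    and ?X = "\<lambda>z. X (fst z) (snd z)" and ?w = "\<lambda>z. jump_weight h (fst z) (snd z)"
    and ?L = "lborel \<Otimes>\<^sub>M lborel :: (real \<times> real) measure"
  define C where "C = jump_constant \<mu> * (h * sqrt h)"
  have C: "C \<ge> 0" using h by (simp add: C_def jump_constant_nonneg)
  note fpos = step_density_pos[OF \<mu> h(1), THEN less_imp_le] and spos = sym_density_pos[OF \<mu> h(1), THEN less_imp_le]
  interpret LG: prob_space "log_gamma \<mu>" by (rule prob_space_log_gamma) fact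
  interpret SN: prob_space std_normal by (rule prob_space_std_normal)
  have if0: "integrable ?L ?f"
  proof (rule integrableI_bounded)
    have "(\<integral>\<^sup>+z. ennreal (norm (?f z)) \<partial>?L) = (\<integral>\<^sup>+z. ennreal (1 * ?f z) \<partial>?L)"
      using fpos by (intro nn_integral_cong) simp
    also have "\<dots> = (\<integral>\<^sup>+l. \<integral>\<^sup>+\<zeta>. ennreal 1 \<partial>std_normal \<partial>log_gamma \<mu>)"
      unfolding step_density_def
      by (rule nn_integral_step_density[where f="\<lambda>_ _. 1"]) (use \<mu> h in auto)
    also have "\<dots> < \<infinity>" by (simp add: SN.emeasure_space_1[simplified] LG.emeasure_space_1[simplified])
    finally show "(\<integral>\<^sup>+z. ennreal (norm (?f z)) \<partial>?L) < \<infinity>" .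
  qed measurable
  have iXf: "integrable ?L (\<lambda>z. ?X z * ?f z)"
  proof (rule Bochner_Integration.integrable_bound[of _ "\<lambda>z. k * ?f z"])
    show "AE z in ?L. norm (?X z * ?f z) \<le> norm (k * ?f z)"
      using bd k fpos by (intro AE_I2) (auto simp: abs_mult intro!: mult_right_mono)
  qed (use if0 in auto)
  have key: "\<bar>?X z * (?f z - ?s z)\<bar> \<le> 2 * (1 + \<mu>\<^sup>2) * k * (?w z * ?f z + ?w z * ?s z)" for z
  proof -
    obtain l b where z: "z = (l, b)" by (cases z)
    have "\<bar>?X z * (?f z - ?s z)\<bar> \<le> (k * \<bar>b - l\<bar>) * (\<bar>ln (?f z) - ln (?s z)\<bar> * (?f z + ?s z))"
      unfolding abs_mult z fst_conv snd_conv using k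
      by (intro mult_mono lip abs_diff_le_ln_diff step_density_pos sym_density_pos \<mu> h) auto
    also have "\<dots> = k * (\<bar>b - l\<bar> * \<bar>ln (?f z) - ln (?s z)\<bar>) * (?f z + ?s z)" by (simp add: mult_ac)
    also have "\<dots> \<le> k * (2 * (1 + \<mu>\<^sup>2) * ?w z) * (?f z + ?s z)"
      unfolding z fst_conv snd_conv using k fpos spos
      by (intro mult_right_mono mult_left_mono density_ratio_bound \<mu> h) (auto intro: add_nonneg_nonneg)
    finally show ?thesis by (simp add: algebra_simps)
  qed
  have "(\<integral>\<^sup>+z. ennreal \<bar>?X z * (?f z - ?s z)\<bar> \<partial>?L)
      \<le> (\<integral>\<^sup>+z. ennreal (2 * (1 + \<mu>\<^sup>2) * k) * (ennreal (?w z * ?f z) + ennreal (?w z * ?s z)) \<partial>?L)"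
    using key k h fpos spos
    by (intro nn_integral_mono)
       (simp add: ennreal_mult'[symmetric] ennreal_plus[symmetric] jump_weight_nonneg ennreal_leI del: ennreal_plus)
  also have "\<dots> = ennreal (2 * (1 + \<mu>\<^sup>2) * k) * ((\<integral>\<^sup>+z. ennreal (?w z * ?f z) \<partial>?L) + (\<integral>\<^sup>+z. ennreal (?w z * ?s z) \<partial>?L))"
    by (simp add: nn_integral_add nn_integral_cmult)
  also have "\<dots> \<le> ennreal (2 * (1 + \<mu>\<^sup>2) * k) * (ennreal C + ennreal C)"
    unfolding C_def by (intro mult_left_mono add_mono nn_integral_jump_weight_step_density \<mu> h) auto
  also have "\<dots> = ennreal (4 * (1 + \<mu>\<^sup>2) * k * C)"
    using C k by (simp add: ennreal_mult'[symmetric] ennreal_plus[symmetric] del: ennreal_plus)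
  finally have nn: "(\<integral>\<^sup>+z. ennreal \<bar>?X z * (?f z - ?s z)\<bar> \<partial>?L) \<le> ennreal (4 * (1 + \<mu>\<^sup>2) * k * C)" .
  have id: "integrable ?L (\<lambda>z. ?X z * (?f z - ?s z))"
    using nn by (intro integrableI_bounded) (auto intro: le_less_trans)
  \<comment> \<open>Integrability against the symmetric density is inferred from the other two
    integrals; the total mass of that density is never computed.\<close>
  have "integrable ?L (\<lambda>z. ?X z * ?f z - ?X z * (?f z - ?s z))" by (intro Bochner_Integration.integrable_diff iXf id)
  then have iXs: "integrable ?L (\<lambda>z. ?X z * ?s z)" by (simp add: algebra_simps)
  have "(\<integral>z. ?X z * ?s z \<partial>?L) = 0"
  proof (rule integral_swap_antisymmetric)
    show "?X (b, l) * ?s (b, l) = - (?X (l, b) * ?s (l, b))" for l b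
      using anti[of b l] sym_density_commute[of \<mu> h b l] by simp
  qed measurable
  then have "(\<integral>z. ?X z * ?f z \<partial>?L) = (\<integral>z. ?X z * (?f z - ?s z) \<partial>?L)"
    using iXf iXs by (simp add: right_diff_distrib)
  also have "\<bar>\<dots>\<bar> \<le> 4 * (1 + \<mu>\<^sup>2) * k * C"
  proof -
    have "ennreal (norm (\<integral>z. ?X z * (?f z - ?s z) \<partial>?L)) \<le> (\<integral>\<^sup>+z. ennreal (norm (?X z * (?f z - ?s z))) \<partial>?L)"
      using id by (rule integral_norm_bound_ennreal)
    also note nn[folded real_norm_def]
    finally show ?thesis using C k by (simp add: ennreal_le_iff)
  qed
  also have "(\<integral>z. ?X z * ?f z \<partial>?L) = (\<integral>l. \<integral>b. X l b * step_density \<mu> h l b \<partial>lborel \<partial>lborel)"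
    using lborel_pair.integral_fst'[OF iXf] by simp
  also have "\<dots> = (\<integral>l. log_gamma_density \<mu> l * (\<integral>\<zeta>. X l (step_centre \<mu> h l + 2 * sqrt h * \<zeta>) \<partial>std_normal) \<partial>lborel)"
  proof (intro Bochner_Integration.integral_cong refl)
    fix l :: real
    have "(\<integral>\<zeta>. X l (step_centre \<mu> h l + 2 * sqrt h * \<zeta>) \<partial>std_normal) =
        (\<integral>b. normal_density (step_centre \<mu> h l) (2 * sqrt h) b * X l b \<partial>lborel)"
      by (rule distributed_integral[OF distributed_std_normal_affine, symmetric]) (use h in auto)
    then show "(\<integral>b. X l b * step_density \<mu> h l b \<partial>lborel) =
       log_gamma_density \<mu> l * (\<integral>\<zeta>. X l (step_centre \<mu> h l + 2 * sqrt h * \<zeta>) \<partial>std_normal)"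
      by (simp add: step_density_def mult_ac flip: integral_mult_right_zero)
  qed
  also have "\<dots> = (\<integral>l. \<integral>\<zeta>. X l (step_centre \<mu> h l + 2 * sqrt h * \<zeta>) \<partial>std_normal \<partial>log_gamma \<mu>)"
    unfolding log_gamma_def
    by (subst integral_density)
       (auto simp: log_gamma_density_pos[OF \<mu>] less_imp_le intro!: SN.borel_measurable_lebesgue_integral)
  finally show ?thesis by (simp add: C_def mult_ac)
qed

text \<open>The summand 12 (1 + \<mu>^2) is the constant of the antisymmetric bound for a function
  with Lipschitz constant \<open>3 * k\<close>; the summand 1 / 2 pays for replacing
  \<open>lnp h l\<close> by \<open>lnp h b\<close>.\<close>

definition vertex_constant :: "real \<Rightarrow> real" where
  "vertex_constant \<mu> = (12 * (1 + \<mu>\<^sup>2) + 1 / 2) * jump_constant \<mu>"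

text \<open>
  One step of one level. With \<open>b\<close> the new value of \<open>l\<close>, the driver increment and the outgoing one are
  \<open>(l - b - lnp h l) / 2\<close> and \<open>(b - l - lnp h l) / 2\<close>; replacing \<open>lnp h l\<close> by \<open>lnp h b\<close> in the latter
  makes exchanging the two an antisymmetric operation.
\<close>

lemma vertex_almost_invariant:
  fixes \<Theta> :: "real \<Rightarrow> real \<Rightarrow> real"
  assumes \<mu>: "\<mu> > 0" and h: "0 < h" "h \<le> 1" and k: "k \<ge> 0"
    and m: "(\<lambda>(a, y). \<Theta> a y) \<in> borel_measurable (borel \<Otimes>\<^sub>M borel)"
    and bd: "\<And>a y. \<bar>\<Theta> a y\<bar> \<le> k"
    and lip: "\<And>a y a' y'. \<bar>\<Theta> a y - \<Theta> a' y'\<bar> \<le> k * (\<bar>a - a'\<bar> + \<bar>y - y'\<bar>)"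
  shows "\<bar>\<integral>l. \<integral>\<zeta>. \<Theta> (l - 2 * noise \<mu> h \<zeta> - lnp h l) (- noise \<mu> h \<zeta> - lnp h l) - \<Theta> l (noise \<mu> h \<zeta>)
       \<partial>std_normal \<partial>log_gamma \<mu>\<bar> \<le> vertex_constant \<mu> * k * (h * sqrt h)"
proof -
  let ?Q = "log_gamma \<mu> \<Otimes>\<^sub>M std_normal"
  interpret LG: prob_space "log_gamma \<mu>" by (rule prob_space_log_gamma) fact
  interpret SN: prob_space std_normal by (rule prob_space_std_normal)
  interpret Q: pair_prob_space "log_gamma \<mu>" std_normal ..
  have [measurable]: "(\<lambda>z. \<Theta> (f z) (g z)) \<in> borel_measurable M"
    if "f \<in> borel_measurable M" "g \<in> borel_measurable M" for f g and M :: "'c measure"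
    using measurable_compose[OF measurable_Pair[OF that] m] by (simp add: split_beta')
  define X where "X = (\<lambda>l b. \<Theta> b ((b - l - lnp h b) / 2) - \<Theta> l ((l - b - lnp h l) / 2))"
  define A where "A = (\<lambda>l \<zeta>. \<Theta> (l - 2 * noise \<mu> h \<zeta> - lnp h l) (- noise \<mu> h \<zeta> - lnp h l) - \<Theta> l (noise \<mu> h \<zeta>))"
  define b where "b = (\<lambda>l \<zeta>. step_centre \<mu> h l + 2 * sqrt h * \<zeta>)"
  have [measurable]: "(\<lambda>z. X (fst z) (snd z)) \<in> borel_measurable (borel \<Otimes>\<^sub>M borel)"
    "(\<lambda>z. A (fst z) (snd z)) \<in> borel_measurable ?Q" "(\<lambda>z. b (fst z) (snd z)) \<in> borel_measurable ?Q"
    "(\<lambda>z. X (fst z) (b (fst z) (snd z))) \<in> borel_measurable ?Q"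
    unfolding X_def A_def b_def by measurable
  \<comment> \<open>The value \<open>3 * k\<close> is dictated by the Lipschitz estimate that
    follows; one constant has to serve for both bounds.\<close>
  have Xb: "\<bar>X l b'\<bar> \<le> 3 * k" for l b'
    unfolding X_def using bd[of b' "(b' - l - lnp h b') / 2"] bd[of l "(l - b' - lnp h l) / 2"] by linarith
  have Xl: "\<bar>X l b'\<bar> \<le> 3 * k * \<bar>b' - l\<bar>" for l b'
  proof -
    have "(b' - l - lnp h b') / 2 - (l - b' - lnp h l) / 2 = (b' - l) + (lnp h l - lnp h b') / 2"
      by (simp add: field_simps)
    then have "\<bar>(b' - l - lnp h b') / 2 - (l - b' - lnp h l) / 2\<bar> = \<bar>(b' - l) + (lnp h l - lnp h b') / 2\<bar>"
      by simp
    also have "\<dots> \<le> \<bar>b' - l\<bar> + \<bar>lnp h l - lnp h b'\<bar> / 2"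
      by (rule order_trans[OF abs_triangle_ineq]) simp
    also have "\<dots> \<le> 2 * \<bar>b' - l\<bar>"
    proof -
      have "x + y / 2 \<le> 2 * x" if "y \<le> x" "0 \<le> y" for x y :: real using that by simp
      moreover have "\<bar>lnp h l - lnp h b'\<bar> \<le> \<bar>b' - l\<bar>"
        using lnp_lipschitz[OF less_imp_le[OF h(1)], of l b'] by (simp only: abs_minus_commute[of l b'])
      ultimately show ?thesis by (meson abs_ge_zero)
    qed
    finally have "\<bar>b' - l\<bar> + \<bar>(b' - l - lnp h b') / 2 - (l - b' - lnp h l) / 2\<bar> \<le> 3 * \<bar>b' - l\<bar>" by simp
    from mult_left_mono[OF this k] show ?thesis
      unfolding X_def using lip[of b' "(b' - l - lnp h b') / 2" l "(l - b' - lnp h l) / 2"] by simp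
  qed
  have bound1: "\<bar>\<integral>l. \<integral>\<zeta>. X l (b l \<zeta>) \<partial>std_normal \<partial>log_gamma \<mu>\<bar> \<le> 4 * (1 + \<mu>\<^sup>2) * jump_constant \<mu> * (3 * k) * (h * sqrt h)"
    unfolding b_def
  proof (rule lipschitz_antisymmetric_step_bound[OF \<mu> h])
    show "X b l = - X l b" for l b by (simp add: X_def)
  qed (use k Xb Xl in \<open>auto simp: split_beta'\<close>)
  \<comment> \<open>The replacement changes only the second argument, by at most h \<bar>exp c - exp
    l\<bar> / 2. Being \<open>h\<close> times a displacement, this is again of order
    \<open>h * sqrt h\<close>.\<close>
  have diff: "\<bar>A l \<zeta> - X l (b l \<zeta>)\<bar> \<le> k / 2 * jump_weight h l (b l \<zeta>)" for l \<zeta>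
  proof -
    define c where "c = b l \<zeta>"
    have eqs: "l - 2 * noise \<mu> h \<zeta> - lnp h l = c" "- noise \<mu> h \<zeta> - lnp h l = (c - l - lnp h l) / 2"
        "noise \<mu> h \<zeta> = (l - c - lnp h l) / 2"
      by (simp_all add: c_def b_def step_centre_def noise_def field_simps)
    have "A l \<zeta> - X l c = \<Theta> c ((c - l - lnp h l) / 2) - \<Theta> c ((c - l - lnp h c) / 2)"
      unfolding A_def X_def eqs(1,2) by (subst eqs(3)) simp
    then have "\<bar>A l \<zeta> - X l c\<bar> \<le> k * (\<bar>c - c\<bar> + \<bar>(c - l - lnp h l) / 2 - (c - l - lnp h c) / 2\<bar>)"
      using lip[of c "(c - l - lnp h l) / 2" c "(c - l - lnp h c) / 2"] by (simp only:)
    also have "\<bar>c - c\<bar> + \<bar>(c - l - lnp h l) / 2 - (c - l - lnp h c) / 2\<bar> = \<bar>lnp h c - lnp h l\<bar> / 2"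
    proof -
      have "(c - l - lnp h l) / 2 - (c - l - lnp h c) / 2 = (lnp h c - lnp h l) / 2" by (simp add: field_simps)
      then show ?thesis by (simp only:) simp
    qed
    also have "\<bar>lnp h c - lnp h l\<bar> / 2 \<le> jump_weight h l c / 2"
    proof -
      have p: "1 \<le> 1 + h * exp x" for x using h by simp
      have "\<bar>lnp h c - lnp h l\<bar> \<le> h * \<bar>exp c - exp l\<bar>"
      proof -
        have *: "lnp h y - lnp h x \<le> h * (exp y - exp x)" if "x \<le> y" for x y
        proof -
          have q: "1 + h * exp x > 0" "1 + h * exp y > 0" using p[of x] p[of y] by linarith+
          then have "lnp h y - lnp h x = ln ((1 + h * exp y) / (1 + h * exp x))" by (simp add: lnp_def ln_div)
          also have "\<dots> \<le> (1 + h * exp y) / (1 + h * exp x) - 1" using q by (intro ln_le_minus_one) simp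
          also have "\<dots> = h * (exp y - exp x) / (1 + h * exp x)" using q by (simp add: field_simps)
          also have "\<dots> \<le> h * (exp y - exp x) / 1" using h that p by (intro divide_left_mono) (auto simp: add_pos_nonneg)
          finally show ?thesis by simp
        qed
        show ?thesis
        proof (cases "l \<le> c")
          case True then show ?thesis using *[OF True] lnp_diff(1)[of h l c] h by simp
        next
          case False then show ?thesis using *[of c l] lnp_diff(1)[of h c l] h by simp
        qed
      qed
      also have "\<dots> \<le> h * (\<bar>c - l\<bar> * (exp c + exp l))" using h by (intro mult_left_mono exp_diff_le) auto
      also have "\<dots> \<le> h * (\<bar>c - l\<bar> * (1 + exp (2 * l) + exp (2 * c)))"
      proof (intro mult_left_mono)
        show "exp c + exp l \<le> 1 + exp (2 * l) + exp (2 * c)"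
          using exp_add_le[of l c] by simp
      qed (use h in auto)
      also have "\<dots> \<le> jump_weight h l c"
      proof -
        have "\<bar>c - l\<bar> * h * (1 + exp (2 * l) + exp (2 * c)) \<le> jump_weight h l c"
          unfolding jump_weight_def by (intro mult_right_mono mult_left_mono) (auto simp: add_nonneg_nonneg)
        then show ?thesis by (simp add: mult_ac)
      qed
      finally show ?thesis by simp
    qed
    finally show ?thesis using k by (simp add: c_def mult_left_mono)
  qed
  have Ab: "\<bar>A l \<zeta>\<bar> \<le> 2 * k" for l \<zeta>
    unfolding A_def using bd[of "l - 2 * noise \<mu> h \<zeta> - lnp h l" "- noise \<mu> h \<zeta> - lnp h l"] bd[of l "noise \<mu> h \<zeta>"] by linarith
  have iA: "integrable ?Q (\<lambda>z. A (fst z) (snd z))"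
    by (rule Q.P.integrable_const_bound[where B="2 * k"]) (use Ab in auto)
  have iX: "integrable ?Q (\<lambda>z. X (fst z) (b (fst z) (snd z)))"
    by (rule Q.P.integrable_const_bound[where B="3 * k"]) (use Xb in auto)
  have "\<bar>(\<integral>z. A (fst z) (snd z) \<partial>?Q) - (\<integral>z. X (fst z) (b (fst z) (snd z)) \<partial>?Q)\<bar> = \<bar>\<integral>z. A (fst z) (snd z) - X (fst z) (b (fst z) (snd z)) \<partial>?Q\<bar>"
    using iA iX by simp
  also have "\<dots> \<le> k / 2 * (jump_constant \<mu> * (h * sqrt h))"
  proof -
    have [measurable]: "(\<lambda>z. jump_weight h (fst z) (b (fst z) (snd z))) \<in> borel_measurable ?Q"
      unfolding jump_weight_def by measurable
    have "ennreal (norm (\<integral>z. A (fst z) (snd z) - X (fst z) (b (fst z) (snd z)) \<partial>?Q)) \<le>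
        (\<integral>\<^sup>+z. ennreal (norm (A (fst z) (snd z) - X (fst z) (b (fst z) (snd z)))) \<partial>?Q)"
      using iA iX by (intro integral_norm_bound_ennreal) auto
    also have "\<dots> \<le> (\<integral>\<^sup>+z. ennreal (k / 2) * ennreal (jump_weight h (fst z) (b (fst z) (snd z))) \<partial>?Q)"
      using diff k h by (intro nn_integral_mono) (simp add: ennreal_mult'[symmetric] jump_weight_nonneg ennreal_leI)
    also have "\<dots> = ennreal (k / 2) * (\<integral>\<^sup>+z. ennreal (jump_weight h (fst z) (b (fst z) (snd z))) \<partial>?Q)"
      by (rule nn_integral_cmult) measurable
    also have "(\<integral>\<^sup>+z. ennreal (jump_weight h (fst z) (b (fst z) (snd z))) \<partial>?Q) =
        (\<integral>\<^sup>+l. \<integral>\<^sup>+\<zeta>. ennreal (jump_weight h l (b l \<zeta>)) \<partial>std_normal \<partial>log_gamma \<mu>)"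
      by (subst SN.nn_integral_fst[symmetric]) auto
    also have "ennreal (k / 2) * \<dots> \<le> ennreal (k / 2) * ennreal (jump_constant \<mu> * (h * sqrt h))"
      unfolding b_def by (intro mult_left_mono nn_integral_jump_weight_step_density \<mu> h) auto
    also have "\<dots> = ennreal (k / 2 * (jump_constant \<mu> * (h * sqrt h)))"
      using k h by (simp add: ennreal_mult'[symmetric] jump_constant_nonneg)
    finally show ?thesis using k h by (simp add: ennreal_le_iff jump_constant_nonneg)
  qed
  finally have "\<bar>\<integral>z. A (fst z) (snd z) \<partial>?Q\<bar> \<le> \<bar>\<integral>z. X (fst z) (b (fst z) (snd z)) \<partial>?Q\<bar> + k / 2 * (jump_constant \<mu> * (h * sqrt h))"
    by linarith
  moreover have "(\<integral>z. A (fst z) (snd z) \<partial>?Q) = (\<integral>l. \<integral>\<zeta>. A l \<zeta> \<partial>std_normal \<partial>log_gamma \<mu>)"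
    using Q.integral_fst'[OF iA] by simp
  moreover have "(\<integral>z. X (fst z) (b (fst z) (snd z)) \<partial>?Q) = (\<integral>l. \<integral>\<zeta>. X l (b l \<zeta>) \<partial>std_normal \<partial>log_gamma \<mu>)"
    using Q.integral_fst'[OF iX] by simp
  ultimately have "\<bar>\<integral>l. \<integral>\<zeta>. A l \<zeta> \<partial>std_normal \<partial>log_gamma \<mu>\<bar> \<le>
      4 * (1 + \<mu>\<^sup>2) * jump_constant \<mu> * (3 * k) * (h * sqrt h) + k / 2 * (jump_constant \<mu> * (h * sqrt h))"
    using bound1 by linarith
  then show ?thesis by (simp add: A_def vertex_constant_def algebra_simps)
qed

section \<open>The discrete system\<close>

text \<open>
  \<open>drv h j l y i\<close> is the increment that drives level \<open>i\<close> when the increment \<open>y\<close> is fed into level \<open>j\<close>;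
  below level \<open>j\<close> nothing moves.
\<close>

primrec drv :: "real \<Rightarrow> nat \<Rightarrow> (nat \<Rightarrow> real) \<Rightarrow> real \<Rightarrow> nat \<Rightarrow> real" where
  "drv h j l y 0 = y"
| "drv h j l y (Suc i) = (if i < j then y else - drv h j l y i - lnp h (l i))"

definition time_step :: "real \<Rightarrow> nat \<Rightarrow> (nat \<Rightarrow> real) \<Rightarrow> real \<Rightarrow> nat \<Rightarrow> real" where
  "time_step h j l y i = (if i < j then l i else l i - 2 * drv h j l y i - lnp h (l i))"

text \<open>
  Level \<open>i\<close> acts on every later level with a factor of at most 2, which the weights absorb because
  \<open>3\<^sup>-\<^sup>i = 2 (3\<^sup>-\<^sup>i\<^sup>-\<^sup>1 + 3\<^sup>-\<^sup>i\<^sup>-\<^sup>2 + \<dots>)\<close>.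
\<close>

definition level_dist :: "nat \<Rightarrow> (nat \<Rightarrow> real) \<Rightarrow> (nat \<Rightarrow> real) \<Rightarrow> real" where
  "level_dist n l l' = (\<Sum>i<n. (1/3) ^ i * \<bar>l i - l' i\<bar>)"

text \<open>The case \<open>i = j\<close> is included: the first level that moves is driven by the
  input itself.\<close>

lemma drv_below: "i \<le> j \<Longrightarrow> drv h j l y i = y"
  by (cases i) auto

lemma measurable_drv[measurable]:
  assumes [measurable]: "l \<in> measurable M (PiM UNIV (\<lambda>_. borel))" "y \<in> borel_measurable M"
  shows "(\<lambda>x. drv h j (l x) (y x) i) \<in> borel_measurable M"
  by (induction i) (auto intro!: borel_measurable_diff borel_measurable_uminus measurable_compose[OF _ measurable_lnp])

lemma measurable_time_step[measurable]:
  assumes [measurable]: "l \<in> measurable M (PiM UNIV (\<lambda>_. borel))" "y \<in> borel_measurable M"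
  shows "(\<lambda>x. time_step h j (l x) (y x)) \<in> measurable M (PiM UNIV (\<lambda>_. borel))"
  unfolding time_step_def by (rule measurable_PiM_single') (auto simp: space_PiM)

text \<open>The induction carries along the discrepancy of the increment that leaves the levels
  treated so far. At one level, \<open>lnp_contraction\<close> gives: new discrepancy plus outgoing
  one \<le> old discrepancy plus 3 times the incoming one. The factor 3 is exactly the ratio of
  consecutive weights. The exponent \<open>max n j\<close> reflects that the input is not consumed
  before level \<open>j\<close>.\<close>

lemma time_step_nonexpansive_aux:
  assumes h: "h \<ge> 0"
  shows "level_dist n (time_step h j l y) (time_step h j l' y') + 3 * (1/3) ^ max n j * \<bar>drv h j l y n - drv h j l' y' n\<bar>
    \<le> level_dist n l l' + 3 * (1/3) ^ j * \<bar>y - y'\<bar>"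
proof (induction n)
  case 0 then show ?case by (simp add: level_dist_def)
next
  case (Suc n)
  show ?case
  proof (cases "n < j")
    case True
    then show ?thesis using Suc
      by (simp add: level_dist_def time_step_def drv_below max_def split: if_splits)
  next
    case False
    define d d' where "d = drv h j l y n" and "d' = drv h j l' y' n"
    define g g' where "g = lnp h (l n)" and "g' = lnp h (l' n)"
    have c: "\<bar>(l n - g) - (l' n - g')\<bar> + \<bar>g - g'\<bar> = \<bar>l n - l' n\<bar>"
      unfolding g_def g'_def by (rule lnp_contraction[OF h])
    have ts: "time_step h j l y n = l n - 2 * d - g" "time_step h j l' y' n = l' n - 2 * d' - g'"
      "drv h j l y (Suc n) = - d - g" "drv h j l' y' (Suc n) = - d' - g'"
      using False by (auto simp: time_step_def d_def d'_def g_def g'_def)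
    have "\<bar>time_step h j l y n - time_step h j l' y' n\<bar> + \<bar>drv h j l y (Suc n) - drv h j l' y' (Suc n)\<bar>
       \<le> 3 * \<bar>d - d'\<bar> + \<bar>l n - l' n\<bar>"
    proof -
      define A B G where "A = d - d'" and "B = (l n - g) - (l' n - g')" and "G = g - g'"
      have "\<bar>B - 2 * A\<bar> + \<bar>- A - G\<bar> \<le> (\<bar>B\<bar> + \<bar>2 * A\<bar>) + (\<bar>- A\<bar> + \<bar>G\<bar>)"
        by (intro add_mono abs_triangle_ineq4)
      also have "\<dots> = 3 * \<bar>A\<bar> + (\<bar>B\<bar> + \<bar>G\<bar>)" by simp
      also have "B - 2 * A = l n - 2 * d - g - (l' n - 2 * d' - g')" by (simp add: A_def B_def)
      also have "- A - G = - d - g - (- d' - g')" by (simp add: A_def G_def)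
      finally show ?thesis unfolding ts c[symmetric] A_def B_def G_def .
    qed
    then have "(1/3) ^ n * (\<bar>time_step h j l y n - time_step h j l' y' n\<bar> + \<bar>drv h j l y (Suc n) - drv h j l' y' (Suc n)\<bar>)
       \<le> (1/3) ^ n * (3 * \<bar>d - d'\<bar> + \<bar>l n - l' n\<bar>)" by (rule mult_left_mono) simp
    with Suc False show ?thesis
      by (simp add: level_dist_def max_def d_def d'_def algebra_simps split: if_splits)
  qed
qed

lemma time_step_nonexpansive:
  assumes "h \<ge> 0"
  shows "level_dist n (time_step h j l y) (time_step h j l' y') \<le> level_dist n l l' + 3 * (1/3) ^ j * \<bar>y - y'\<bar>"
  using time_step_nonexpansive_aux[OF assms, of n j l y l' y']
    mult_nonneg_nonneg[of "3 * (1/3) ^ max n j" "\<bar>drv h j l y n - drv h j l' y' n\<bar>"]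
  by (smt (verit) abs_ge_zero zero_le_mult_iff zero_le_power divide_nonneg_nonneg)

text \<open>Isolates a single level: once level \<open>j\<close> is updated, the rest of the step is
  a step that starts at \<open>Suc j\<close> with the outgoing increment as input.\<close>

lemma time_step_split:
  "time_step h j l y = time_step h (Suc j) (l(j := l j - 2 * y - lnp h (l j))) (- y - lnp h (l j))"
proof -
  have d: "drv h (Suc j) (l(j := a)) (- y - lnp h (l j)) i = drv h j l y i" if "i > j" for i a
    using that
  proof (induction i)
    case (Suc i)
    then show ?case by (cases "i = j") (auto simp: drv_below)
  qed simp
  show ?thesis
  proof
    fix i show "time_step h j l y i = time_step h (Suc j) (l(j := l j - 2 * y - lnp h (l j))) (- y - lnp h (l j)) i"
      using d[of i] by (cases i j rule: linorder_cases) (auto simp: time_step_def drv_below)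
  qed
qed

section \<open>Lipschitz test functions and the transition operator\<close>

lemma measurable_time_step_noise:
  assumes "\<psi> \<in> borel_measurable (PiM UNIV (\<lambda>_. borel))"
  shows "(\<lambda>\<zeta>. \<psi> (time_step h j l (noise \<mu> h \<zeta>))) \<in> borel_measurable std_normal"
proof -
  have "(\<lambda>\<zeta>. time_step h j l (noise \<mu> h \<zeta>)) \<in> measurable std_normal (PiM UNIV (\<lambda>_. borel))"
    by (rule measurable_time_step) (simp_all add: space_PiM)
  then show ?thesis using assms by (rule measurable_compose)
qed

text \<open>As \<open>level_dist n\<close> sees only the first \<open>n\<close> levels, such a
  function depends on these alone. One constant serves as bound and as Lipschitz constant.\<close>

definition level_lipschitz :: "nat \<Rightarrow> real \<Rightarrow> ((nat \<Rightarrow> real) \<Rightarrow> real) \<Rightarrow> bool" where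
  "level_lipschitz n k \<psi> \<longleftrightarrow> \<psi> \<in> borel_measurable (PiM UNIV (\<lambda>_. borel)) \<and>
     (\<forall>l. \<bar>\<psi> l\<bar> \<le> k) \<and> (\<forall>l l'. \<bar>\<psi> l - \<psi> l'\<bar> \<le> k * level_dist n l l')"

lemma level_lipschitz_nonneg: "level_lipschitz n k \<psi> \<Longrightarrow> k \<ge> 0"
  unfolding level_lipschitz_def by (meson abs_ge_zero order_trans)

definition levels :: "real \<Rightarrow> (nat \<Rightarrow> real) measure" where
  "levels \<mu> = PiM UNIV (\<lambda>_. log_gamma \<mu>)"

lemma sets_levels[measurable_cong]: "sets (levels \<mu>) = sets (PiM UNIV (\<lambda>_. borel))"
  unfolding levels_def by (rule sets_PiM_cong) auto

lemma space_levels[simp]: "space (levels \<mu>) = UNIV"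
  by (simp add: levels_def space_PiM)

lemma prob_space_levels: "\<mu> > 0 \<Longrightarrow> prob_space (levels \<mu>)"
  unfolding levels_def by (intro prob_space_PiM prob_space_log_gamma)

definition transition :: "real \<Rightarrow> real \<Rightarrow> ((nat \<Rightarrow> real) \<Rightarrow> real) \<Rightarrow> (nat \<Rightarrow> real) \<Rightarrow> real" where
  "transition \<mu> h \<psi> l = (\<integral>\<zeta>. \<psi> (time_step h 0 l (noise \<mu> h \<zeta>)) \<partial>std_normal)"

lemma (in prob_space) abs_expectation_le:
  fixes f :: "'a \<Rightarrow> real"
  assumes "\<And>x. \<bar>f x\<bar> \<le> c" "f \<in> borel_measurable M"
  shows "\<bar>expectation f\<bar> \<le> c"
proof -
  have i: "integrable M f" using assms by (intro integrable_const_bound[where B=c]) auto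
  have "\<bar>expectation f\<bar> \<le> expectation (\<lambda>x. \<bar>f x\<bar>)" using integral_norm_bound[of _ f] by simp
  also have "\<dots> \<le> expectation (\<lambda>_. c)" using assms i by (intro integral_mono) auto
  finally show ?thesis using prob_space by simp
qed

text \<open>Two copies of the chain are coupled by the same noise. The constant \<open>k\<close>
  does not grow, so it survives any number of steps.\<close>

lemma level_lipschitz_transition:
  assumes \<psi>: "level_lipschitz n k \<psi>" and h: "h \<ge> 0"
  shows "level_lipschitz n k (transition \<mu> h \<psi>)"
proof -
  interpret SN: prob_space std_normal by (rule prob_space_std_normal)
  have [measurable]: "\<psi> \<in> borel_measurable (PiM UNIV (\<lambda>_. borel))"
    and bd: "\<And>l. \<bar>\<psi> l\<bar> \<le> k" and lip: "\<And>l l'. \<bar>\<psi> l - \<psi> l'\<bar> \<le> k * level_dist n l l'"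
    using \<psi> by (auto simp: level_lipschitz_def)
  have [measurable]: "(\<lambda>\<zeta>. \<psi> (time_step h 0 l (noise \<mu> h \<zeta>))) \<in> borel_measurable std_normal" for l
    by (rule measurable_time_step_noise) measurable
  have i: "integrable std_normal (\<lambda>\<zeta>. \<psi> (time_step h 0 l (noise \<mu> h \<zeta>)))" for l
    by (rule SN.integrable_const_bound[where B=k]) (auto simp: bd)
  have k: "k \<ge> 0" using level_lipschitz_nonneg[OF \<psi>] .
  have "(\<lambda>l. transition \<mu> h \<psi> l) \<in> borel_measurable (PiM UNIV (\<lambda>_. borel))"
    unfolding transition_def by (intro SN.borel_measurable_lebesgue_integral) measurable
  moreover have "\<bar>transition \<mu> h \<psi> l\<bar> \<le> k" for l
    unfolding transition_def by (intro SN.abs_expectation_le bd) measurable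
  moreover have "\<bar>transition \<mu> h \<psi> l - transition \<mu> h \<psi> l'\<bar> \<le> k * level_dist n l l'" for l l'
  proof -
    have "transition \<mu> h \<psi> l - transition \<mu> h \<psi> l' =
       (\<integral>\<zeta>. \<psi> (time_step h 0 l (noise \<mu> h \<zeta>)) - \<psi> (time_step h 0 l' (noise \<mu> h \<zeta>)) \<partial>std_normal)"
      unfolding transition_def using i by simp
    also have "\<bar>\<dots>\<bar> \<le> k * level_dist n l l'"
    proof (intro SN.abs_expectation_le)
      fix \<zeta>
      have "\<bar>\<psi> (time_step h 0 l (noise \<mu> h \<zeta>)) - \<psi> (time_step h 0 l' (noise \<mu> h \<zeta>))\<bar>
        \<le> k * level_dist n (time_step h 0 l (noise \<mu> h \<zeta>)) (time_step h 0 l' (noise \<mu> h \<zeta>))" by (rule lip)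
      also have "\<dots> \<le> k * level_dist n l l'"
        using time_step_nonexpansive[OF h, of n 0 l "noise \<mu> h \<zeta>" l' "noise \<mu> h \<zeta>"] k by (intro mult_left_mono) auto
      finally show "\<bar>\<psi> (time_step h 0 l (noise \<mu> h \<zeta>)) - \<psi> (time_step h 0 l' (noise \<mu> h \<zeta>))\<bar> \<le> k * level_dist n l l'" .
    qed (use i in auto)
    finally show ?thesis .
  qed
  ultimately show ?thesis by (simp add: level_lipschitz_def)
qed

lemma level_lipschitz_funpow_transition:
  "level_lipschitz n k \<psi> \<Longrightarrow> h \<ge> 0 \<Longrightarrow> level_lipschitz n k ((transition \<mu> h ^^ m) \<psi>)"
  by (induction m) (auto intro: level_lipschitz_transition)

text \<open>A product law is unchanged when one coordinate is resampled. This exposes the integral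
  over level \<open>j\<close> that the one-level estimate requires.\<close>

lemma integral_levels_update:
  fixes F :: "(nat \<Rightarrow> real) \<Rightarrow> real"
  assumes \<mu>: "\<mu> > 0" and [measurable]: "F \<in> borel_measurable (levels \<mu>)" and bd: "\<And>l. \<bar>F l\<bar> \<le> c"
  shows "(\<integral>l. F l \<partial>levels \<mu>) = (\<integral>l. \<integral>a. F (l(j := a)) \<partial>log_gamma \<mu> \<partial>levels \<mu>)"
proof -
  interpret LG: prob_space "log_gamma \<mu>" by (rule prob_space_log_gamma) fact
  interpret N: prob_space "levels \<mu>" by (rule prob_space_levels) fact
  interpret Q: pair_prob_space "log_gamma \<mu>" "levels \<mu>" ..
  have m: "(\<lambda>(x, X). X(j := x)) \<in> measurable (log_gamma \<mu> \<Otimes>\<^sub>M levels \<mu>) (levels \<mu>)"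
    unfolding levels_def split_beta' by (rule measurable_fun_upd[where J=UNIV]) auto
  have "levels \<mu> = distr (log_gamma \<mu> \<Otimes>\<^sub>M levels \<mu>) (levels \<mu>) (\<lambda>(x, X). X(j := x))"
    unfolding levels_def
    using distr_pair_PiM_eq_PiM[of UNIV "\<lambda>_. log_gamma \<mu>" j] prob_space_log_gamma[OF \<mu>] by simp
  then have "(\<integral>l. F l \<partial>levels \<mu>) = (\<integral>l. F l \<partial>(distr (log_gamma \<mu> \<Otimes>\<^sub>M levels \<mu>) (levels \<mu>) (\<lambda>(x, X). X(j := x))))"
    by simp
  also have "\<dots> = (\<integral>z. F (case z of (x, X) \<Rightarrow> X(j := x)) \<partial>(log_gamma \<mu> \<Otimes>\<^sub>M levels \<mu>))"
    by (rule integral_distr[OF m]) measurable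
  also have "\<dots> = (\<integral>l. \<integral>a. F (l(j := a)) \<partial>log_gamma \<mu> \<partial>levels \<mu>)"
  proof -
    have "integrable (log_gamma \<mu> \<Otimes>\<^sub>M levels \<mu>) (\<lambda>z. F (case z of (x, X) \<Rightarrow> X(j := x)))"
      using measurable_compose[OF m assms(2)] by (intro Q.P.integrable_const_bound[where B=c]) (auto simp: bd)
    from Q.integral_snd[of "\<lambda>a l. F (l(j := a))"] this show ?thesis by (simp add: split_beta')
  qed
  finally show ?thesis .
qed

text \<open>Interpolate by feeding fresh noise into level \<open>j\<close>, for \<open>j\<close>
  from 0 to \<open>n\<close>. Passing from \<open>j\<close> to \<open>Suc j\<close> amounts to
  replacing the updated level \<open>j\<close> together with its outgoing increment by an unchanged
  level \<open>j\<close> and fresh noise, which is what \<open>vertex_almost_invariant\<close>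
  compares.\<close>

lemma one_step_stationary:
  assumes \<mu>: "\<mu> > 0" and h: "0 < h" "h \<le> 1" and \<psi>: "level_lipschitz n k \<psi>"
  shows "\<bar>(\<integral>l. transition \<mu> h \<psi> l \<partial>levels \<mu>) - (\<integral>l. \<psi> l \<partial>levels \<mu>)\<bar> \<le> real n * (vertex_constant \<mu> * k * (h * sqrt h))"
proof -
  interpret SN: prob_space std_normal by (rule prob_space_std_normal)
  interpret LG: prob_space "log_gamma \<mu>" by (rule prob_space_log_gamma) fact
  interpret N: prob_space "levels \<mu>" by (rule prob_space_levels) fact
  have [measurable]: "\<psi> \<in> borel_measurable (PiM UNIV (\<lambda>_. borel))"
    and bd: "\<And>l. \<bar>\<psi> l\<bar> \<le> k" and lip: "\<And>l l'. \<bar>\<psi> l - \<psi> l'\<bar> \<le> k * level_dist n l l'"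
    using \<psi> by (auto simp: level_lipschitz_def)
  have k: "k \<ge> 0" using level_lipschitz_nonneg[OF \<psi>] .
  define H where "H = (\<lambda>j l. \<integral>\<zeta>. \<psi> (time_step h j l (noise \<mu> h \<zeta>)) \<partial>std_normal)"
  have Hm: "H j \<in> borel_measurable (levels \<mu>)" for j
    unfolding H_def by (intro SN.borel_measurable_lebesgue_integral) measurable
  have Hb: "\<bar>H j l\<bar> \<le> k" for j l
    unfolding H_def by (intro SN.abs_expectation_le bd measurable_time_step_noise) measurable
  have iH: "integrable (levels \<mu>) (H j)" for j
    by (rule N.integrable_const_bound[where B=k]) (use Hm Hb in auto)
  have step: "\<bar>(\<integral>l. H j l \<partial>levels \<mu>) - (\<integral>l. H (Suc j) l \<partial>levels \<mu>)\<bar> \<le> vertex_constant \<mu> * k * (h * sqrt h)" for j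
  proof -
    define \<Theta> where "\<Theta> = (\<lambda>l a y. \<psi> (time_step h (Suc j) (l(j := a)) y))"
    have upd: "(\<lambda>z. l(j := fst z)) \<in> measurable (borel \<Otimes>\<^sub>M borel) (PiM UNIV (\<lambda>_. borel))" for l :: "nat \<Rightarrow> real"
      by (rule measurable_PiM_single') (auto simp: space_PiM fun_upd_def)
    have \<Theta>m: "(\<lambda>(a, y). \<Theta> l a y) \<in> borel_measurable (borel \<Otimes>\<^sub>M borel)" for l
      unfolding \<Theta>_def split_beta'
      by (rule measurable_compose[OF measurable_time_step[OF upd]]) measurable
    have \<Theta>lip: "\<bar>\<Theta> l a y - \<Theta> l a' y'\<bar> \<le> k * (\<bar>a - a'\<bar> + \<bar>y - y'\<bar>)" for l a y a' y'
    proof -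
      have "\<bar>\<Theta> l a y - \<Theta> l a' y'\<bar> \<le> k * level_dist n (time_step h (Suc j) (l(j := a)) y) (time_step h (Suc j) (l(j := a')) y')"
        unfolding \<Theta>_def by (rule lip)
      also have "\<dots> \<le> k * (level_dist n (l(j := a)) (l(j := a')) + 3 * (1/3) ^ Suc j * \<bar>y - y'\<bar>)"
        using h k by (intro mult_left_mono time_step_nonexpansive) auto
      also have "\<dots> \<le> k * (\<bar>a - a'\<bar> + \<bar>y - y'\<bar>)"
      \<comment> \<open>The weights are normalised so that level \<open>j\<close> contributes with
        factor at most 1, and the input at \<open>Suc j\<close> with factor 3 (1/3)^(j+1) \<le>
        1.\<close>
      proof (intro mult_left_mono add_mono k)
        have "level_dist n (l(j := a)) (l(j := a')) = (\<Sum>i<n. if i = j then (1/3) ^ j * \<bar>a - a'\<bar> else 0)"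
          unfolding level_dist_def by (intro sum.cong) auto
        also have "\<dots> \<le> 1 * \<bar>a - a'\<bar>"
        proof -
          have "(1/3) ^ j * \<bar>a - a'\<bar> \<le> 1 * \<bar>a - a'\<bar>" by (intro mult_right_mono power_le_one) auto
          then show ?thesis by (auto simp: sum.delta)
        qed
        finally show "level_dist n (l(j := a)) (l(j := a')) \<le> \<bar>a - a'\<bar>" by simp
        have "(1/3) ^ j * \<bar>y - y'\<bar> \<le> 1 * \<bar>y - y'\<bar>" by (intro mult_right_mono power_le_one) auto
        then show "3 * (1/3) ^ Suc j * \<bar>y - y'\<bar> \<le> \<bar>y - y'\<bar>" by simp
      qed
      finally show ?thesis .
    qed
    have H1: "H j (l(j := a)) = (\<integral>\<zeta>. \<Theta> l (a - 2 * noise \<mu> h \<zeta> - lnp h a) (- noise \<mu> h \<zeta> - lnp h a) \<partial>std_normal)" for l a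
      unfolding H_def \<Theta>_def by (subst time_step_split) simp
    have H2: "H (Suc j) (l(j := a)) = (\<integral>\<zeta>. \<Theta> l a (noise \<mu> h \<zeta>) \<partial>std_normal)" for l a
      unfolding H_def \<Theta>_def by simp
    define V where "V = (\<lambda>l. \<integral>a. H j (l(j := a)) - H (Suc j) (l(j := a)) \<partial>log_gamma \<mu>)"
    have i\<Theta>: "integrable std_normal (\<lambda>\<zeta>. \<Theta> l (f \<zeta>) (g \<zeta>))" if "f \<in> borel_measurable borel" "g \<in> borel_measurable borel" for l f g
    proof (rule SN.integrable_const_bound[where B=k])
      show "(\<lambda>\<zeta>. \<Theta> l (f \<zeta>) (g \<zeta>)) \<in> borel_measurable std_normal"
        using measurable_compose[OF measurable_Pair[OF that] \<Theta>m[of l]] by simp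
    qed (auto simp: \<Theta>_def bd)
    have V: "\<bar>V l\<bar> \<le> vertex_constant \<mu> * k * (h * sqrt h)" for l
    proof -
      have "V l = (\<integral>a. \<integral>\<zeta>. \<Theta> l (a - 2 * noise \<mu> h \<zeta> - lnp h a) (- noise \<mu> h \<zeta> - lnp h a) - \<Theta> l a (noise \<mu> h \<zeta>)
       \<partial>std_normal \<partial>log_gamma \<mu>)"
        unfolding V_def H1 H2
        by (intro Bochner_Integration.integral_cong refl Bochner_Integration.integral_diff[symmetric] i\<Theta>) measurable
      then show ?thesis
        using vertex_almost_invariant[OF \<mu> h k \<Theta>m _ \<Theta>lip, of l] by (simp add: \<Theta>_def bd)
    qed
    have "(\<integral>l. H j l \<partial>levels \<mu>) - (\<integral>l. H (Suc j) l \<partial>levels \<mu>) = (\<integral>l. H j l - H (Suc j) l \<partial>levels \<mu>)"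
      using iH by simp
    also have "\<dots> = (\<integral>l. V l \<partial>levels \<mu>)"
      unfolding V_def
    proof (rule integral_levels_update[OF \<mu>])
      show "\<bar>H j l - H (Suc j) l\<bar> \<le> 2 * k" for l using Hb[of j l] Hb[of "Suc j" l] by linarith
    qed (use Hm in measurable)
    finally have "\<bar>(\<integral>l. H j l \<partial>levels \<mu>) - (\<integral>l. H (Suc j) l \<partial>levels \<mu>)\<bar> = \<bar>\<integral>l. V l \<partial>levels \<mu>\<bar>" by simp
    also have "\<dots> \<le> vertex_constant \<mu> * k * (h * sqrt h)"
    proof (rule N.abs_expectation_le[OF V])
      have "(\<lambda>z. (fst z)(j := snd z)) \<in> measurable (levels \<mu> \<Otimes>\<^sub>M log_gamma \<mu>) (levels \<mu>)"
        unfolding levels_def by (rule measurable_fun_upd[where J=UNIV]) auto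
      from measurable_compose[OF this Hm]
      show "V \<in> borel_measurable (levels \<mu>)"
        unfolding V_def by (intro LG.borel_measurable_lebesgue_integral) (simp add: split_beta' borel_measurable_diff)
    qed
    finally show ?thesis .
  qed
  have "\<bar>(\<integral>l. H 0 l \<partial>levels \<mu>) - (\<integral>l. H m l \<partial>levels \<mu>)\<bar> \<le> real m * (vertex_constant \<mu> * k * (h * sqrt h))" for m
  proof (induction m)
    case (Suc m)
    have "\<bar>(\<integral>l. H 0 l \<partial>levels \<mu>) - (\<integral>l. H (Suc m) l \<partial>levels \<mu>)\<bar> \<le>
       \<bar>(\<integral>l. H 0 l \<partial>levels \<mu>) - (\<integral>l. H m l \<partial>levels \<mu>)\<bar> + \<bar>(\<integral>l. H m l \<partial>levels \<mu>) - (\<integral>l. H (Suc m) l \<partial>levels \<mu>)\<bar>" by linarith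
    also have "\<dots> \<le> real m * (vertex_constant \<mu> * k * (h * sqrt h)) + vertex_constant \<mu> * k * (h * sqrt h)"
      by (intro add_mono Suc step)
    finally show ?case by (simp add: algebra_simps)
  qed simp
  moreover have "H 0 = transition \<mu> h \<psi>" by (simp add: H_def transition_def fun_eq_iff)
  \<comment> \<open>Noise fed into level \<open>n\<close> moves only levels that \<psi> does not
    see.\<close>
  moreover have "H n = \<psi>"
  proof
    fix l
    have "\<psi> (time_step h n l y) = \<psi> l" for y
    proof -
      have "level_dist n (time_step h n l y) l = 0" by (simp add: level_dist_def time_step_def)
      then show ?thesis using lip[of "time_step h n l y" l] by simp
    qed
    then show "H n l = \<psi> l" using SN.prob_space by (simp add: H_def)
  qed
  ultimately show ?thesis by metis
qed

text \<open>Each summand of the telescope is a one-step error under the exact law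
  \<open>levels \<mu>\<close>, with an iterate of \<psi> as test function. The law of the chain
  after several steps never has to be controlled.\<close>

lemma transition_almost_stationary:
  assumes \<mu>: "\<mu> > 0" and h: "0 < h" "h \<le> 1" and \<psi>: "level_lipschitz n k \<psi>"
  shows "\<bar>(\<integral>l. (transition \<mu> h ^^ m) \<psi> l \<partial>levels \<mu>) - (\<integral>l. \<psi> l \<partial>levels \<mu>)\<bar> \<le> real m * (real n * (vertex_constant \<mu> * k * (h * sqrt h)))"
proof (induction m)
  case (Suc m)
  have "\<bar>(\<integral>l. (transition \<mu> h ^^ Suc m) \<psi> l \<partial>levels \<mu>) - (\<integral>l. \<psi> l \<partial>levels \<mu>)\<bar>
    \<le> \<bar>(\<integral>l. transition \<mu> h ((transition \<mu> h ^^ m) \<psi>) l \<partial>levels \<mu>) - (\<integral>l. (transition \<mu> h ^^ m) \<psi> l \<partial>levels \<mu>)\<bar>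
      + \<bar>(\<integral>l. (transition \<mu> h ^^ m) \<psi> l \<partial>levels \<mu>) - (\<integral>l. \<psi> l \<partial>levels \<mu>)\<bar>" by simp
  also have "\<dots> \<le> real n * (vertex_constant \<mu> * k * (h * sqrt h)) + real m * (real n * (vertex_constant \<mu> * k * (h * sqrt h)))"
    using h by (intro add_mono Suc one_step_stationary level_lipschitz_funpow_transition \<mu> \<psi>) auto
  finally show ?case by (simp add: algebra_simps)
qed simp

section \<open>The chain driven by Brownian increments\<close>

primrec chain :: "real \<Rightarrow> (nat \<Rightarrow> real) \<Rightarrow> (nat \<Rightarrow> real) \<Rightarrow> nat \<Rightarrow> nat \<Rightarrow> real" where
  "chain h l y 0 = l"
| "chain h l y (Suc k) = time_step h 0 (chain h l y k) (y k)"

lemma measurable_chain: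
  assumes [measurable]: "l \<in> measurable M (PiM UNIV (\<lambda>_. borel))"
    and "\<And>i. i < k \<Longrightarrow> (\<lambda>x. y x i) \<in> borel_measurable M"
  shows "(\<lambda>x. chain h (l x) (y x) k) \<in> measurable M (PiM UNIV (\<lambda>_. borel))"
  using assms(2) by (induction k) (auto intro!: measurable_time_step)

text \<open>The last increment is independent of the earlier ones and is integrated out first, which
  turns \<psi> into \<open>transition \<mu> h \<psi>\<close>. The induction therefore has to be
  general in \<psi>.\<close>

lemma (in prob_space) expectation_chain:
  assumes ind: "indep_vars (\<lambda>_. borel) X {..<K}"
    and X: "\<And>i. i < K \<Longrightarrow> distr M borel (X i) = std_normal"
    and h: "h \<ge> 0" and \<psi>: "level_lipschitz n c \<psi>"
  shows "expectation (\<lambda>\<omega>. \<psi> (chain h l (\<lambda>i. noise \<mu> h (X i \<omega>)) K)) = (transition \<mu> h ^^ K) \<psi> l"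
  using assms
proof (induction K arbitrary: \<psi>)
  case 0 then show ?case by (simp add: prob_space)
next
  case (Suc K)
  define Y where "Y = (\<lambda>\<omega>. restrict (\<lambda>i. X i \<omega>) {..<K})"
  have [measurable]: "\<psi> \<in> borel_measurable (PiM UNIV (\<lambda>_. borel))" and bd: "\<And>l. \<bar>\<psi> l\<bar> \<le> c"
    using Suc.prems by (auto simp: level_lipschitz_def)
  have rv: "X i \<in> borel_measurable M" if "i < Suc K" for i
    using Suc.prems(1) that by (auto simp: indep_vars_def)
  define Z where "Z = (\<lambda>\<omega>. restrict (\<lambda>i. X i \<omega>) {K})"
  have iv: "indep_var (PiM {..<K} (\<lambda>_. borel)) Y (PiM {K} (\<lambda>_. borel)) Z"
    unfolding Y_def Z_def by (rule indep_var_restrict[OF Suc.prems(1)]) auto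
  have [measurable]: "Y \<in> measurable M (PiM {..<K} (\<lambda>_. borel))" "Z \<in> measurable M (PiM {K} (\<lambda>_. borel))" "X K \<in> borel_measurable M"
    using iv indep_var_rv1 indep_var_rv2 rv[of K] by blast+
  let ?P = "PiM {..<K} (\<lambda>_. borel) :: (nat \<Rightarrow> real) measure" and ?Q = "PiM {K} (\<lambda>_. borel) :: (nat \<Rightarrow> real) measure"
  define F where "F = (\<lambda>z. \<psi> (time_step h 0 (chain h l (\<lambda>i. noise \<mu> h (fst z i)) K) (noise \<mu> h (snd z K))))"
  have mc: "(\<lambda>z. chain h l (\<lambda>i. noise \<mu> h (fst z i)) K) \<in> measurable (?P \<Otimes>\<^sub>M ?Q) (PiM UNIV (\<lambda>_. borel))"
    by (rule measurable_chain)
      (auto simp: space_PiM intro!: measurable_compose[OF _ measurable_noise] measurable_compose[OF measurable_fst measurable_component_singleton])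
  have mK: "(\<lambda>z. noise \<mu> h (snd z K)) \<in> borel_measurable (?P \<Otimes>\<^sub>M ?Q)"
    by (intro measurable_compose[OF _ measurable_noise] measurable_compose[OF measurable_snd measurable_component_singleton]) simp
  have mF[measurable]: "F \<in> borel_measurable (?P \<Otimes>\<^sub>M ?Q)"
    unfolding F_def by (rule measurable_compose[OF measurable_time_step[OF mc mK]]) measurable
  interpret D1: prob_space "distr M ?P Y" by (rule prob_space_distr) measurable
  interpret D2: prob_space "distr M ?Q Z" by (rule prob_space_distr) measurable
  interpret D: pair_prob_space "distr M ?P Y" "distr M ?Q Z" ..
  have ch: "chain h l (\<lambda>i. noise \<mu> h (Y \<omega> i)) k = chain h l (\<lambda>i. noise \<mu> h (X i \<omega>)) k" if "k \<le> K" for k \<omega>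
    using that by (induction k) (auto simp: Y_def)
  have "expectation (\<lambda>\<omega>. \<psi> (chain h l (\<lambda>i. noise \<mu> h (X i \<omega>)) (Suc K))) = expectation (\<lambda>\<omega>. F (Y \<omega>, Z \<omega>))"
    by (simp add: F_def ch Z_def)
  also have "\<dots> = (\<integral>z. F z \<partial>(distr M (?P \<Otimes>\<^sub>M ?Q) (\<lambda>\<omega>. (Y \<omega>, Z \<omega>))))"
    by (rule integral_distr[symmetric]) measurable
  also have "\<dots> = (\<integral>z. F z \<partial>(distr M ?P Y \<Otimes>\<^sub>M distr M ?Q Z))"
    using iv by (simp add: indep_var_distribution_eq)
  also have "\<dots> = (\<integral>y. \<integral>\<zeta>. F (y, \<zeta>) \<partial>distr M ?Q Z \<partial>distr M ?P Y)"
  proof (rule D.integral_fst'[symmetric])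
    show "integrable (distr M ?P Y \<Otimes>\<^sub>M distr M ?Q Z) F"
      by (rule D.P.integrable_const_bound[where B=c]) (auto simp: F_def[THEN fun_cong] bd)
  qed
  also have "\<dots> = (\<integral>y. transition \<mu> h \<psi> (chain h l (\<lambda>i. noise \<mu> h (y i)) K) \<partial>distr M ?P Y)"
  proof (rule Bochner_Integration.integral_cong[OF refl])
    fix y assume "y \<in> space (distr M ?P Y)"
    then have y: "y \<in> space ?P" by simp
    let ?f = "\<lambda>\<zeta>. \<psi> (time_step h 0 (chain h l (\<lambda>i. noise \<mu> h (y i)) K) (noise \<mu> h \<zeta>))"
    have f: "?f \<in> borel_measurable borel"
      using measurable_time_step_noise[of \<psi>] by simp
    have "(\<integral>\<zeta>. F (y, \<zeta>) \<partial>distr M ?Q Z) = (\<integral>\<omega>. F (y, Z \<omega>) \<partial>M)"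
      by (rule integral_distr) (use y in measurable)
    also have "\<dots> = (\<integral>\<omega>. ?f (X K \<omega>) \<partial>M)" by (simp add: F_def Z_def)
    also have "\<dots> = (\<integral>\<zeta>. ?f \<zeta> \<partial>distr M borel (X K))" by (rule integral_distr[OF _ f, symmetric]) measurable
    also have "\<dots> = transition \<mu> h \<psi> (chain h l (\<lambda>i. noise \<mu> h (y i)) K)"
      using Suc.prems(2)[of K] by (simp add: transition_def)
    finally show "(\<integral>\<zeta>. F (y, \<zeta>) \<partial>distr M ?Q Z) = transition \<mu> h \<psi> (chain h l (\<lambda>i. noise \<mu> h (y i)) K)" .
  qed
  also have "\<dots> = expectation (\<lambda>\<omega>. transition \<mu> h \<psi> (chain h l (\<lambda>i. noise \<mu> h (Y \<omega> i)) K))"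
  proof (rule integral_distr)
    have "(\<lambda>z. chain h l (\<lambda>i. noise \<mu> h (z i)) K) \<in> measurable (PiM {..<K} (\<lambda>_. borel)) (PiM UNIV (\<lambda>_. borel))"
      by (rule measurable_chain)
        (auto simp: space_PiM intro!: measurable_compose[OF _ measurable_noise] measurable_component_singleton)
    moreover have "transition \<mu> h \<psi> \<in> borel_measurable (PiM UNIV (\<lambda>_. borel))"
      using level_lipschitz_transition[OF Suc.prems(4,3)] by (simp add: level_lipschitz_def)
    ultimately show "(\<lambda>y. transition \<mu> h \<psi> (chain h l (\<lambda>i. noise \<mu> h (y i)) K)) \<in> borel_measurable (PiM {..<K} (\<lambda>_. borel))"
      by (rule measurable_compose)
  qed measurable
  also have "\<dots> = (transition \<mu> h ^^ K) (transition \<mu> h \<psi>) l"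
    unfolding ch[OF order_refl] using Suc.prems
    by (intro Suc.IH indep_vars_subset[OF Suc.prems(1)] level_lipschitz_transition) auto
  also have "\<dots> = (transition \<mu> h ^^ Suc K) \<psi> l" by (simp add: funpow_swap1)
  finally show ?case .
qed

lemma brownian_increment_distributed:
  "standard_brownian_motion M B \<Longrightarrow> 0 \<le> s \<Longrightarrow> s < t \<Longrightarrow>
     distributed M lborel (\<lambda>\<omega>. B t \<omega> - B s \<omega>) (normal_density 0 (sqrt (t - s)))"
  unfolding standard_brownian_motion_def by blast

lemma brownian_increments_indep:
  "standard_brownian_motion M B \<Longrightarrow> 0 \<le> t 0 \<Longrightarrow> (\<And>i. i < k \<Longrightarrow> t i \<le> t (Suc i)) \<Longrightarrow>
     prob_space.indep_vars M (\<lambda>_. borel) (\<lambda>i \<omega>. B (t (Suc i)) \<omega> - B (t i) \<omega>) {..<k}"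
  unfolding standard_brownian_motion_def by blast

lemma brownian_measurable: "standard_brownian_motion M B \<Longrightarrow> 0 \<le> t \<Longrightarrow> B t \<in> borel_measurable M"
  unfolding standard_brownian_motion_def by blast

text \<open>\<open>B 0\<close> is only almost surely 0, hence the normalisation of the driver \<open>- W\<close> at 0.\<close>

definition driver :: "real \<Rightarrow> (real \<Rightarrow> 'a \<Rightarrow> real) \<Rightarrow> 'a \<Rightarrow> real \<Rightarrow> real" where
  "driver \<mu> B \<omega> t = - (\<mu> * t + B t \<omega> - B 0 \<omega>)"

text \<open>For K steps of length h = T / K the accumulated error K h sqrt h equals T sqrt h. The
  condition K \<ge> T is \<open>h \<le> 1\<close>.\<close>

lemma brownian_chain_almost_stationary:
  assumes B: "standard_brownian_motion M B" and \<mu>: "\<mu> > 0" and T: "T > 0" and K: "real K \<ge> T" and \<psi>: "level_lipschitz n c \<psi>"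
  shows "\<bar>(\<integral>l. \<integral>\<omega>. \<psi> (chain (T / K) l (\<lambda>i. driver \<mu> B \<omega> (real (Suc i) * (T / K)) - driver \<mu> B \<omega> (real i * (T / K))) K) \<partial>M \<partial>levels \<mu>)
      - (\<integral>l. \<psi> l \<partial>levels \<mu>)\<bar> \<le> real n * vertex_constant \<mu> * c * T * sqrt (T / K)"
proof -
  interpret prob_space M using B by (simp add: standard_brownian_motion_def)
  define h where "h = T / K"
  have K0: "real K > 0" using K T by linarith
  have h: "0 < h" "h \<le> 1" using K T K0 by (auto simp: h_def)
  define X where "X = (\<lambda>i \<omega>. (B (real (Suc i) * h) \<omega> - B (real i * h) \<omega>) / sqrt h)"
  have dist: "distributed M lborel (\<lambda>\<omega>. B (real (Suc i) * h) \<omega> - B (real i * h) \<omega>) (normal_density 0 (sqrt h))" for i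
  proof -
    have "0 \<le> real i * h" "real i * h < real (Suc i) * h" "real (Suc i) * h - real i * h = h"
      using h by (auto simp: algebra_simps)
    then show ?thesis using brownian_increment_distributed[OF B, of "real i * h" "real (Suc i) * h"] by simp
  qed
  have "distr M borel (X i) = std_normal" for i
  proof -
    have "distributed M lborel (\<lambda>\<omega>. (B (real (Suc i) * h) \<omega> - B (real i * h) \<omega> - 0) / sqrt h) std_normal_density"
      using dist[of i] h by (subst normal_standard_normal_convert[symmetric]) auto
    then have "distr M lborel (X i) = std_normal"
      by (simp add: distributed_def X_def std_normal_def)
    moreover have "distr M borel (X i) = distr M lborel (X i)" by (rule distr_cong) auto
    ultimately show ?thesis by simp
  qed
  moreover have "indep_vars (\<lambda>_. borel) X {..<K}"
  proof -
    have "indep_vars (\<lambda>_. borel) (\<lambda>i \<omega>. B (real (Suc i) * h) \<omega> - B (real i * h) \<omega>) {..<K}"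
      using h by (intro brownian_increments_indep[OF B, of "\<lambda>i. real i * h"]) (auto simp: algebra_simps)
    then show ?thesis unfolding X_def by (rule indep_vars_compose2[where Y="\<lambda>_ x. x / sqrt h"]) auto
  qed
  moreover have "driver \<mu> B \<omega> (real (Suc i) * h) - driver \<mu> B \<omega> (real i * h) = noise \<mu> h (X i \<omega>)" for i \<omega>
  proof -
    have "sqrt h * X i \<omega> = B (real (Suc i) * h) \<omega> - B (real i * h) \<omega>" using h by (simp add: X_def)
    then show ?thesis by (simp add: driver_def noise_def algebra_simps)
  qed
  ultimately have "expectation (\<lambda>\<omega>. \<psi> (chain h l (\<lambda>i. driver \<mu> B \<omega> (real (Suc i) * h) - driver \<mu> B \<omega> (real i * h)) K)) = (transition \<mu> h ^^ K) \<psi> l" for l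
    using expectation_chain[of X K h n c \<psi> l \<mu>] h \<psi> by simp
  then have "\<bar>(\<integral>l. \<integral>\<omega>. \<psi> (chain h l (\<lambda>i. driver \<mu> B \<omega> (real (Suc i) * h) - driver \<mu> B \<omega> (real i * h)) K) \<partial>M \<partial>levels \<mu>)
      - (\<integral>l. \<psi> l \<partial>levels \<mu>)\<bar> \<le> real K * (real n * (vertex_constant \<mu> * c * (h * sqrt h)))"
    using transition_almost_stationary[OF \<mu> h \<psi>, of K] by simp
  also have "\<dots> = real n * vertex_constant \<mu> * c * (real K * h) * sqrt h" by simp
  also have "real K * h = T" using K0 by (simp add: h_def)
  finally show ?thesis by (simp add: h_def)
qed

section \<open>Explicit solution and its discretisation\<close>

text \<open>
  The explicit solution: \<open>tower l z j\<close> is \<open>W\<^bsub>j+1\<^esub>\<close> normalised at 0 and \<open>tower_log l z j\<close> is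
  \<open>ln u\<^bsub>j+1\<^esub>\<close>, for the driver \<open>z = - W\<close> and the initial values \<open>exp (l j)\<close>.
\<close>

primrec tower :: "(nat \<Rightarrow> real) \<Rightarrow> (real \<Rightarrow> real) \<Rightarrow> nat \<Rightarrow> real \<Rightarrow> real" where
  "tower l z 0 = z"
| "tower l z (Suc j) = (\<lambda>t. - tower l z j t - ln (1 + exp (l j) * integral {0..t} (\<lambda>s. exp (- 2 * tower l z j s))))"

definition tower_log :: "(nat \<Rightarrow> real) \<Rightarrow> (real \<Rightarrow> real) \<Rightarrow> nat \<Rightarrow> real \<Rightarrow> real" where
  "tower_log l z j t = l j - 2 * tower l z j t - ln (1 + exp (l j) * integral {0..t} (\<lambda>s. exp (- 2 * tower l z j s)))"

lemma integral_has_derivative_atLeast: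
  fixes g :: "real \<Rightarrow> real"
  assumes g: "continuous_on {0..} g" and t: "t \<ge> 0"
  shows "((\<lambda>t. integral {0..t} g) has_real_derivative g t) (at t within {0..})"
proof -
  \<comment> \<open>The upper end \<open>t + 1\<close> keeps \<open>t\<close> away from the right
    endpoint, so that the derivatives within the interval and within the half-line agree.\<close>
  have "((\<lambda>t. integral {0..t} g) has_real_derivative g t) (at t within {0..t + 1})"
    using t by (intro integral_has_real_derivative continuous_on_subset[OF g]) auto
  moreover have "at t within {0..t + 1} = at t within {0..}"
    using t by (intro at_within_nhd[where S="{..<t + 1}"]) auto
  ultimately show ?thesis by simp
qed

lemma continuous_on_integral_atLeast:
  fixes g :: "real \<Rightarrow> real"
  assumes "continuous_on {0..} g"
  shows "continuous_on {0..} (\<lambda>t. integral {0..t} g)"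
  unfolding continuous_on_eq_continuous_within
  using integral_has_derivative_atLeast[OF assms] by (auto intro: DERIV_continuous)

text \<open>A non-integrable function has integral 0 by convention, so the logarithms in
  \<open>tower\<close> have positive arguments for every path.\<close>

lemma integral_exp_nonneg: "integral {0..t} (\<lambda>s. exp (f s)) \<ge> (0::real)"
  by (cases "(\<lambda>s. exp (f s)) integrable_on {0..t}") (auto intro: integral_nonneg simp: not_integrable_integral)

lemma one_plus_exp_integral_pos: "1 + exp c * integral {0..t} (\<lambda>s. exp (f s)) > (0::real)"
  using integral_exp_nonneg[of t f] by (simp add: add_pos_nonneg)

lemma continuous_on_tower:
  assumes "continuous_on {0..} z"
  shows "continuous_on {0..} (tower l z j)"
proof (induction j)
  case (Suc j)
  have "continuous_on {0..} (\<lambda>t. integral {0..t} (\<lambda>s. exp (- 2 * tower l z j s)))"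
    by (intro continuous_on_integral_atLeast continuous_intros Suc)
  then show ?case
    using one_plus_exp_integral_pos[of "l j" _ "\<lambda>s. - 2 * tower l z j s"]
    by (auto intro!: continuous_intros Suc simp: less_imp_neq[THEN not_sym])
qed (use assms in simp)

lemma continuous_on_tower_log:
  assumes "continuous_on {0..} z"
  shows "continuous_on {0..} (tower_log l z j)"
proof -
  have "continuous_on {0..} (\<lambda>t. integral {0..t} (\<lambda>s. exp (- 2 * tower l z j s)))"
    by (intro continuous_on_integral_atLeast continuous_intros continuous_on_tower assms)
  then show ?thesis unfolding tower_log_def
    using one_plus_exp_integral_pos[of "l j" _ "\<lambda>s. - 2 * tower l z j s"]
    by (auto intro!: continuous_intros continuous_on_tower assms simp: less_imp_neq[THEN not_sym])
qed

lemma tower_0: "z 0 = 0 \<Longrightarrow> tower l z j 0 = 0"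
  by (induction j) auto

lemma tower_log_0: "z 0 = 0 \<Longrightarrow> tower_log l z j 0 = l j"
  by (simp add: tower_log_def tower_0)

text \<open>The integrand is the derivative of the logarithm on the right, which vanishes at 0. Thus
  the logarithm in \<open>tower\<close> is \<integral> u dx, and the recursion for
  \<open>tower\<close> is the integrated form of the relation between successive drivers.\<close>

lemma integral_exp_tower_log:
  assumes z: "continuous_on {0..} z" and t: "t \<ge> 0"
  shows "integral {0..t} (\<lambda>s. exp (tower_log l z j s)) = ln (1 + exp (l j) * integral {0..t} (\<lambda>s. exp (- 2 * tower l z j s)))"
proof -
  define I where "I = (\<lambda>t. integral {0..t} (\<lambda>s. exp (- 2 * tower l z j s)))"
  define f where "f = (\<lambda>t. ln (1 + exp (l j) * I t))"
  have pos: "1 + exp (l j) * I s > 0" for s unfolding I_def by (rule one_plus_exp_integral_pos)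
  have "((\<lambda>s. exp (tower_log l z j s)) has_integral f t - f 0) {0..t}"
  proof (rule fundamental_theorem_of_calculus)
    fix s assume s: "s \<in> {0..t}"
    have "(I has_real_derivative exp (- 2 * tower l z j s)) (at s within {0..})"
      unfolding I_def using s by (intro integral_has_derivative_atLeast continuous_intros continuous_on_tower z) auto
    then have "(I has_real_derivative exp (- 2 * tower l z j s)) (at s within {0..t})"
      by (rule DERIV_subset) auto
    then have "(f has_real_derivative (exp (l j) * exp (- 2 * tower l z j s)) / (1 + exp (l j) * I s)) (at s within {0..t})"
      unfolding f_def using pos[of s] by (auto intro!: derivative_eq_intros)
    also have "(exp (l j) * exp (- 2 * tower l z j s)) / (1 + exp (l j) * I s) = exp (tower_log l z j s)"
      using pos[of s] by (simp add: tower_log_def I_def exp_diff exp_minus exp_add field_simps)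
    finally show "(f has_vector_derivative exp (tower_log l z j s)) (at s within {0..t})"
      by (simp add: has_real_derivative_iff_has_vector_derivative)
  qed (rule t)
  then show ?thesis by (simp add: f_def I_def integral_unique)
qed

section \<open>Uniform convergence on grids of mesh T / K\<close>

definition grid_conv :: "real \<Rightarrow> (nat \<Rightarrow> nat \<Rightarrow> real) \<Rightarrow> (real \<Rightarrow> real) \<Rightarrow> bool" where
  "grid_conv T f F \<longleftrightarrow> (\<forall>\<epsilon>>0. \<forall>\<^sub>F K in sequentially. \<forall>k\<le>K. \<bar>f K k - F (real k * (T / real K))\<bar> < \<epsilon>)"

lemma grid_point:
  assumes "T \<ge> 0" "k \<le> K" shows "real k * (T / real K) \<in> {0..T}"
proof (cases "K = 0")
  case False
  have "real k * T \<le> real K * T" using assms by (intro mult_right_mono) auto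
  then show ?thesis using assms False by (simp add: field_simps)
qed (use assms in auto)

lemma grid_conv_add:
  assumes "grid_conv T f F" "grid_conv T g G"
  shows "grid_conv T (\<lambda>K k. f K k + g K k) (\<lambda>t. F t + G t)"
  unfolding grid_conv_def
proof (intro allI impI)
  fix \<epsilon> :: real assume "\<epsilon> > 0"
  then have "\<forall>\<^sub>F K in sequentially. \<forall>k\<le>K. \<bar>f K k - F (real k * (T / real K))\<bar> < \<epsilon> / 2"
    "\<forall>\<^sub>F K in sequentially. \<forall>k\<le>K. \<bar>g K k - G (real k * (T / real K))\<bar> < \<epsilon> / 2"
    using assms unfolding grid_conv_def by (meson half_gt_zero)+
  then show "\<forall>\<^sub>F K in sequentially. \<forall>k\<le>K. \<bar>f K k + g K k - (F (real k * (T / real K)) + G (real k * (T / real K)))\<bar> < \<epsilon>"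
  proof eventually_elim
    case (elim K)
    show ?case
    proof (intro allI impI)
      fix k assume "k \<le> K"
      with elim have "\<bar>f K k - F (real k * (T / real K))\<bar> < \<epsilon> / 2" "\<bar>g K k - G (real k * (T / real K))\<bar> < \<epsilon> / 2" by auto
      then show "\<bar>f K k + g K k - (F (real k * (T / real K)) + G (real k * (T / real K)))\<bar> < \<epsilon>" by linarith
    qed
  qed
qed

text \<open>The range of \<open>F\<close> on the compact interval is enlarged by 1 so that it
  eventually contains the approximations as well; there \<phi> is uniformly continuous.\<close>

lemma grid_conv_compose:
  fixes \<phi> :: "real \<Rightarrow> real"
  assumes f: "grid_conv T f F" and T: "T \<ge> 0" and F: "continuous_on {0..T} F" and \<phi>: "continuous_on UNIV \<phi>"
  shows "grid_conv T (\<lambda>K k. \<phi> (f K k)) (\<lambda>t. \<phi> (F t))"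
  unfolding grid_conv_def
proof (intro allI impI)
  fix \<epsilon> :: real assume \<epsilon>: "\<epsilon> > 0"
  have "bounded (F ` {0..T})" using compact_imp_bounded[OF compact_continuous_image[OF F]] by simp
  then obtain R where "\<forall>x\<in>F ` {0..T}. norm x \<le> R" unfolding bounded_iff by blast
  then have R: "\<And>t. t \<in> {0..T} \<Longrightarrow> \<bar>F t\<bar> \<le> R" by simp
  have "uniformly_continuous_on {- (R + 1)..R + 1} \<phi>"
    by (intro compact_uniformly_continuous continuous_on_subset[OF \<phi>]) auto
  then obtain \<delta> where \<delta>: "\<delta> > 0" "\<And>x y. x \<in> {- (R + 1)..R + 1} \<Longrightarrow> y \<in> {- (R + 1)..R + 1} \<Longrightarrow> \<bar>y - x\<bar> < \<delta> \<Longrightarrow> \<bar>\<phi> y - \<phi> x\<bar> < \<epsilon>"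
    using \<epsilon> unfolding uniformly_continuous_on_def dist_real_def by metis
  have "\<forall>\<^sub>F K in sequentially. \<forall>k\<le>K. \<bar>f K k - F (real k * (T / real K))\<bar> < min 1 \<delta>"
    using f \<delta>(1) unfolding grid_conv_def by (meson min_less_iff_conj zero_less_one)
  then show "\<forall>\<^sub>F K in sequentially. \<forall>k\<le>K. \<bar>\<phi> (f K k) - \<phi> (F (real k * (T / real K)))\<bar> < \<epsilon>"
  proof eventually_elim
    case (elim K)
    show ?case
    proof (intro allI impI)
      fix k assume k: "k \<le> K"
      with elim have 1: "\<bar>f K k - F (real k * (T / real K))\<bar> < 1" "\<bar>f K k - F (real k * (T / real K))\<bar> < \<delta>" by auto
      moreover have "\<bar>F (real k * (T / real K))\<bar> \<le> R" using R[OF grid_point[OF T k]] .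
      ultimately show "\<bar>\<phi> (f K k) - \<phi> (F (real k * (T / real K)))\<bar> < \<epsilon>"
        by (intro \<delta>(2)) (auto simp: abs_less_iff abs_le_iff)
    qed
  qed
qed

lemma grid_conv_integral:
  assumes g: "grid_conv T g G" and T: "T > 0" and G: "continuous_on {0..T} G"
  shows "grid_conv T (\<lambda>K k. T / real K * (\<Sum>i<k. g K i)) (\<lambda>t. integral {0..t} G)"
  unfolding grid_conv_def
proof (intro allI impI)
  fix \<epsilon> :: real assume \<epsilon>: "\<epsilon> > 0"
  \<comment> \<open>A cell of length h contributes at most \<open>2 * e * h\<close>, one
    \<open>e\<close> from the approximation of \<open>G\<close> and one from its oscillation. The
    cells add up to at most \<open>2 * e * T\<close>, half of \<epsilon>.\<close>
  define e where "e = \<epsilon> / (4 * T)"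
  have e: "e > 0" using \<epsilon> T by (simp add: e_def)
  have "uniformly_continuous_on {0..T} G" by (intro compact_uniformly_continuous G) auto
  then obtain \<delta> where \<delta>: "\<delta> > 0" "\<And>x y. x \<in> {0..T} \<Longrightarrow> y \<in> {0..T} \<Longrightarrow> \<bar>y - x\<bar> < \<delta> \<Longrightarrow> \<bar>G y - G x\<bar> < e"
    using e unfolding uniformly_continuous_on_def dist_real_def by metis
  have "\<forall>\<^sub>F K in sequentially. \<forall>k\<le>K. \<bar>g K k - G (real k * (T / real K))\<bar> < e"
    using g e by (auto simp: grid_conv_def)
  moreover have "\<forall>\<^sub>F K in sequentially. T / \<delta> < real K" by (rule filterlim_at_top_dense[THEN iffD1, rule_format]) (rule filterlim_real_sequentially)
  moreover have "\<forall>\<^sub>F K in sequentially. K > (0::nat)" by (rule eventually_gt_at_top)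
  ultimately show "\<forall>\<^sub>F K in sequentially. \<forall>k\<le>K. \<bar>T / real K * (\<Sum>i<k. g K i) - integral {0..real k * (T / real K)} G\<bar> < \<epsilon>"
  proof eventually_elim
    case (elim K)
    define h where "h = T / real K"
    have h: "h > 0" "h < \<delta>" using elim T \<delta>(1) by (auto simp: h_def field_simps)
    have "\<bar>h * (\<Sum>i<k. g K i) - integral {0..real k * h} G\<bar> \<le> real k * (h * (2 * e))" if "k \<le> K" for k
      using that
    proof (induction k)
      case (Suc k)
      have mem: "real i * h \<in> {0..T}" if "i \<le> K" for i using grid_point[of T i K] T that by (simp add: h_def)
      have le: "real k * h \<le> real (Suc k) * h" using h by (simp add: algebra_simps)
      have int: "G integrable_on {0..real (Suc k) * h}"
        using mem[of "Suc k"] Suc.prems by (intro integrable_continuous_real continuous_on_subset[OF G]) auto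
      have int2: "G integrable_on {real k * h..real (Suc k) * h}"
        using mem[of k] Suc.prems by (intro integrable_subinterval_real[OF int]) auto
      have split: "integral {0..real (Suc k) * h} G = integral {0..real k * h} G + integral {real k * h..real (Suc k) * h} G"
        using mem[of k] Suc.prems le by (intro Henstock_Kurzweil_Integration.integral_combine[symmetric] int) auto
      have c: "integral {real k * h..real (Suc k) * h} (\<lambda>_. g K k) = h * g K k"
        using h by (simp add: algebra_simps)
      have "\<bar>h * g K k - integral {real k * h..real (Suc k) * h} G\<bar> = \<bar>integral {real k * h..real (Suc k) * h} (\<lambda>s. g K k - G s)\<bar>"
        unfolding c[symmetric] by (subst Henstock_Kurzweil_Integration.integral_diff[OF _ int2]) auto
      also have "\<dots> \<le> 2 * e * (real (Suc k) * h - real k * h)"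
      proof (rule integral_bound[of _ _ "\<lambda>s. g K k - G s" "2 * e", unfolded real_norm_def])
        show "real k * h \<le> real (Suc k) * h" by (rule le)
        show "continuous_on {real k * h..real (Suc k) * h} (\<lambda>s. g K k - G s)"
          using mem[of "Suc k"] mem[of k] Suc.prems by (intro continuous_intros continuous_on_subset[OF G]) auto
        fix s assume s: "s \<in> {real k * h..real (Suc k) * h}"
        then have s': "0 \<le> s" "s \<le> T" "\<bar>s - real k * h\<bar> < \<delta>"
        proof -
          define a where "a = real k * h"
          have a: "0 \<le> a" using h by (simp add: a_def)
          have sk: "real (Suc k) * h = a + h" by (simp add: a_def algebra_simps)
          have "a + h \<le> T" using mem[of "Suc k"] Suc.prems unfolding sk by simp
          moreover have "a \<le> s" "s \<le> a + h" using s unfolding sk a_def[symmetric] by auto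
          ultimately show "0 \<le> s" "s \<le> T" "\<bar>s - real k * h\<bar> < \<delta>"
            using a h unfolding a_def[symmetric] by auto
        qed
        have "\<bar>G s - G (real k * h)\<bar> < e"
          using mem[of k] Suc.prems s' by (intro \<delta>(2)) auto
        moreover have "\<bar>g K k - G (real k * h)\<bar> < e" using elim(1) Suc.prems by (simp add: h_def)
        ultimately show "\<bar>g K k - G s\<bar> \<le> 2 * e" by linarith
      qed
      also have "\<dots> = h * (2 * e)" by (simp add: algebra_simps)
      finally have 1: "\<bar>h * g K k - integral {real k * h..real (Suc k) * h} G\<bar> \<le> h * (2 * e)" .
      have 2: "\<bar>h * (\<Sum>i<k. g K i) - integral {0..real k * h} G\<bar> \<le> real k * (h * (2 * e))" using Suc by simp
      have "h * (\<Sum>i<Suc k. g K i) - integral {0..real (Suc k) * h} G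
         = (h * (\<Sum>i<k. g K i) - integral {0..real k * h} G) + (h * g K k - integral {real k * h..real (Suc k) * h} G)"
        unfolding split by (simp add: algebra_simps)
      also have "\<bar>\<dots>\<bar> \<le> real k * (h * (2 * e)) + h * (2 * e)" using 1 2 abs_triangle_ineq by (meson add_mono order_trans)
      finally show ?case by (simp add: algebra_simps)
    qed simp
    moreover have "real k * (h * (2 * e)) < \<epsilon>" if "k \<le> K" for k
    proof -
      have "real k * (h * (2 * e)) \<le> real K * (h * (2 * e))" using that h e by (intro mult_right_mono) auto
      also have "\<dots> = T * (2 * e)" using elim(3) by (simp add: h_def)
      also have "\<dots> < \<epsilon>" using T \<epsilon> by (simp add: e_def)
      finally show ?thesis .
    qed
    ultimately show ?case unfolding h_def[symmetric] by (meson le_less_trans)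
  qed
qed

text \<open>The discrete counterpart of \<open>tower l z j\<close> at the \<open>k\<close>-th grid
  point.\<close>

definition chain_driver :: "real \<Rightarrow> (nat \<Rightarrow> real) \<Rightarrow> (nat \<Rightarrow> real) \<Rightarrow> nat \<Rightarrow> nat \<Rightarrow> real" where
  "chain_driver h l y j k = (\<Sum>i<k. drv h 0 (chain h l y i) (y i) j)"

text \<open>Replacing the integrals in the explicit solution by left Riemann sums gives exactly the Markov chain.\<close>

lemma chain_explicit:
  assumes h: "h \<ge> 0"
  shows "chain h l y k j = l j - 2 * chain_driver h l y j k - ln (1 + exp (l j) * (h * (\<Sum>i<k. exp (- 2 * chain_driver h l y j i))))"
    and "chain_driver h l y (Suc j) k = - chain_driver h l y j k - ln (1 + exp (l j) * (h * (\<Sum>i<k. exp (- 2 * chain_driver h l y j i))))"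
proof (induction k)
  case 0
  { case 1 show ?case by (simp add: chain_driver_def) }
  { case 2 show ?case by (simp add: chain_driver_def) }
next
  case (Suc k)
  define S where "S k = exp (l j) * (h * (\<Sum>i<k. exp (- 2 * chain_driver h l y j i)))" for k
  have S: "1 + S k > 0" for k using h by (simp add: S_def add_pos_nonneg sum_nonneg)
  have "exp (chain h l y k j) = exp (l j) * exp (- 2 * chain_driver h l y j k) / (1 + S k)"
  proof -
    have "exp (x - 2 * d - ln c) = exp x * exp (- 2 * d) / c" if "c > 0" for x d c :: real
      using that by (simp add: exp_diff[of "x - 2 * d" "ln c"] flip: exp_add)
    then show ?thesis unfolding Suc(1) S_def[symmetric] using S[of k] by blast
  qed
  moreover have "S (Suc k) = S k + h * (exp (l j) * exp (- 2 * chain_driver h l y j k))"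
    by (simp add: S_def algebra_simps)
  \<comment> \<open>The discrete form of the logarithmic derivative: the quotients telescope, so the
    values of \<open>lnp\<close> accumulated over the steps are exactly one logarithm.\<close>
  ultimately have "1 + h * exp (chain h l y k j) = (1 + S (Suc k)) / (1 + S k)"
    using S[of k] by (simp only:) (simp add: field_simps)
  then have lnp: "lnp h (chain h l y k j) = ln (1 + S (Suc k)) - ln (1 + S k)"
    using S[of k] S[of "Suc k"] by (simp add: lnp_def ln_div)
  have cd: "chain_driver h l y j (Suc k) = chain_driver h l y j k + drv h 0 (chain h l y k) (y k) j" for j
    by (simp add: chain_driver_def)
  have c1: "chain h l y k j = l j - 2 * chain_driver h l y j k - ln (1 + S k)"
    and c2: "chain_driver h l y (Suc j) k = - chain_driver h l y j k - ln (1 + S k)"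
    unfolding S_def by (rule Suc)+
  { case 1
    have "chain h l y (Suc k) j = chain h l y k j - 2 * drv h 0 (chain h l y k) (y k) j - lnp h (chain h l y k j)"
      by (simp add: time_step_def)
    also have "\<dots> = l j - 2 * chain_driver h l y j (Suc k) - ln (1 + S (Suc k))"
      unfolding lnp cd[of j] by (simp add: c1)
    finally show ?case unfolding S_def . }
  { case 2
    have "chain_driver h l y (Suc j) (Suc k) = chain_driver h l y (Suc j) k - drv h 0 (chain h l y k) (y k) j - lnp h (chain h l y k j)"
      by (simp add: cd[of "Suc j"])
    also have "\<dots> = - chain_driver h l y j (Suc k) - ln (1 + S (Suc k))"
      unfolding lnp cd[of j] by (simp add: c2)
    finally show ?case unfolding S_def . }
qed

text \<open>Chain and explicit solution obey the same recursion over the levels, with Riemann sums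
  in place of integrals. Induction over the levels needs convergence that is uniform on the grid,
  because each level sums over the whole past of the level before it.\<close>

lemma chain_converges:
  assumes z: "continuous_on {0..} z" and z0: "z 0 = 0" and T: "T > 0"
  shows "(\<lambda>K. chain (T / real K) l (\<lambda>i. z (real (Suc i) * (T / real K)) - z (real i * (T / real K))) K j) \<longlonglongrightarrow> tower_log l z j T"
proof -
  define y where "y = (\<lambda>K i. z (real (Suc i) * (T / real K)) - z (real i * (T / real K)))"
  let ?d = "\<lambda>j K. chain_driver (T / real K) l (y K) j"
  let ?S = "\<lambda>j K k. T / real K * (\<Sum>i<k. exp (- 2 * ?d j K i))"
  let ?I = "\<lambda>j t. integral {0..t} (\<lambda>s. exp (- 2 * tower l z j s))"
  have cont: "continuous_on {0..T} (tower l z j)" for j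
    by (rule continuous_on_subset[OF continuous_on_tower[OF z]]) auto
  have contI: "continuous_on {0..T} (?I j)" for j
    by (rule continuous_on_subset[OF continuous_on_integral_atLeast]) (auto intro!: continuous_intros continuous_on_tower z)
  have "1 + exp (l j) * ?I j t \<noteq> 0" for j t
    using one_plus_exp_integral_pos[of "l j" t "\<lambda>s. - 2 * tower l z j s"] by linarith
  then have contL: "continuous_on {0..T} (\<lambda>t. ln (1 + exp (l j) * ?I j t))" for j
    by (intro continuous_intros contI ballI)
  have LN: "grid_conv T (\<lambda>K k. ln (1 + exp (l j) * ?S j K k)) (\<lambda>t. ln (1 + exp (l j) * ?I j t))"
    if "grid_conv T (?d j) (tower l z j)" for j
  proof -
    have "grid_conv T (\<lambda>K k. exp (- 2 * ?d j K k)) (\<lambda>t. exp (- 2 * tower l z j t))"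
      by (rule grid_conv_compose[OF that _ cont, where \<phi>="\<lambda>x. exp (- 2 * x)"]) (use T in \<open>auto intro!: continuous_intros\<close>)
    then have "grid_conv T (?S j) (?I j)"
      by (rule grid_conv_integral[OF _ T]) (intro continuous_intros cont)
    \<comment> \<open>The absolute value makes the outer function continuous on the whole line, as
      \<open>grid_conv_compose\<close> requires. Sums and integrals are nonnegative, so it
      disappears again.\<close>
    then have "grid_conv T (\<lambda>K k. ln (1 + exp (l j) * \<bar>?S j K k\<bar>)) (\<lambda>t. ln (1 + exp (l j) * \<bar>?I j t\<bar>))"
      by (rule grid_conv_compose[OF _ _ contI, where \<phi>="\<lambda>x. ln (1 + exp (l j) * \<bar>x\<bar>)"])
         (use T in \<open>auto intro!: continuous_intros simp: add_pos_nonneg less_imp_neq[THEN not_sym]\<close>)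
    moreover have "\<bar>?S j K k\<bar> = ?S j K k" for K k using T by (intro abs_of_nonneg mult_nonneg_nonneg sum_nonneg) auto
    moreover have "\<bar>?I j t\<bar> = ?I j t" for t by (intro abs_of_nonneg integral_exp_nonneg)
    ultimately show ?thesis by (simp only:)
  qed
  have neg: "grid_conv T (\<lambda>K k. c * f K k) (\<lambda>t. c * F t)" if "grid_conv T f F" "continuous_on {0..T} F" for c f F
    using grid_conv_compose[OF that(1) _ that(2), where \<phi>="\<lambda>x. c * x"] T by (auto intro!: continuous_intros)
  have D: "grid_conv T (?d j) (tower l z j)" for j
  proof (induction j)
    case 0
    have "chain_driver h l y' 0 k = (\<Sum>i<k. y' i)" for h y' k by (simp add: chain_driver_def)
    then have "?d 0 K k = z (real k * (T / real K))" for K k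
      using sum_lessThan_telescope[of "\<lambda>i. z (real i * (T / real K))" k] by (simp add: y_def z0)
    then show ?case by (simp add: grid_conv_def)
  next
    case (Suc j)
    from grid_conv_add[OF neg[OF Suc cont, of "-1"] neg[OF LN[OF Suc] contL, of "-1"]]
    have "grid_conv T (\<lambda>K k. - ?d j K k - ln (1 + exp (l j) * ?S j K k)) (tower l z (Suc j))" by simp
    then show ?case using T by (subst chain_explicit(2)) auto
  qed
  have G: "grid_conv T (\<lambda>K k. - 2 * ?d j K k + - 1 * ln (1 + exp (l j) * ?S j K k)) (\<lambda>t. - 2 * tower l z j t + - 1 * ln (1 + exp (l j) * ?I j t))"
    by (rule grid_conv_add[OF neg[OF D cont, of "-2"] neg[OF LN[OF D] contL, of "-1"]])
  have "(\<lambda>K. - 2 * ?d j K K + - 1 * ln (1 + exp (l j) * ?S j K K)) \<longlonglongrightarrow> - 2 * tower l z j T + - 1 * ln (1 + exp (l j) * ?I j T)"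
  proof (rule tendstoI)
    fix e :: real assume "e > 0"
    with G have "\<forall>\<^sub>F K in sequentially. \<forall>k\<le>K. \<bar>- 2 * ?d j K k + - 1 * ln (1 + exp (l j) * ?S j K k) - (- 2 * tower l z j (real k * (T / real K)) + - 1 * ln (1 + exp (l j) * ?I j (real k * (T / real K))))\<bar> < e"
      unfolding grid_conv_def by blast
    moreover have "\<forall>\<^sub>F K in sequentially. K > (0::nat)" by (rule eventually_gt_at_top)
    ultimately show "\<forall>\<^sub>F K in sequentially. dist (- 2 * ?d j K K + - 1 * ln (1 + exp (l j) * ?S j K K)) (- 2 * tower l z j T + - 1 * ln (1 + exp (l j) * ?I j T)) < e"
    proof eventually_elim
      case (elim K)
      have "real K * (T / real K) = T" using elim(2) by simp
      with elim(1)[rule_format, of K] show ?case by (simp add: dist_real_def)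
    qed
  qed
  then have "(\<lambda>K. l j + (- 2 * ?d j K K + - 1 * ln (1 + exp (l j) * ?S j K K))) \<longlonglongrightarrow> l j + (- 2 * tower l z j T + - 1 * ln (1 + exp (l j) * ?I j T))"
    by (rule tendsto_add[OF tendsto_const])
  moreover have "chain (T / real K) l (y K) K j = l j + (- 2 * ?d j K K + - 1 * ln (1 + exp (l j) * ?S j K K))" for K
    using T by (subst chain_explicit(1)) auto
  ultimately have "(\<lambda>K. chain (T / real K) l (y K) K j) \<longlonglongrightarrow> l j + (- 2 * tower l z j T + - 1 * ln (1 + exp (l j) * ?I j T))"
    by (simp only:)
  moreover have "l j + (- 2 * tower l z j T + - 1 * ln (1 + exp (l j) * ?I j T)) = tower_log l z j T"
    by (simp add: tower_log_def)
  ultimately show ?thesis by (simp only: y_def)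
qed

section \<open>Stationarity\<close>

text \<open>Pointwise limit of Riemann sums. Only times up to \<open>t\<close> enter, so
  \<open>G\<close> may be the \<sigma>-algebra of the past.\<close>

lemma measurable_integral_continuous:
  fixes X :: "real \<Rightarrow> 'b \<Rightarrow> real"
  assumes t: "t \<ge> 0" and X: "\<And>s. 0 \<le> s \<Longrightarrow> s \<le> t \<Longrightarrow> X s \<in> borel_measurable G"
    and cont: "\<And>\<omega>. \<omega> \<in> space G \<Longrightarrow> continuous_on {0..t} (\<lambda>s. X s \<omega>)"
  shows "(\<lambda>\<omega>. integral {0..t} (\<lambda>s. X s \<omega>)) \<in> borel_measurable G"
proof (cases "t = 0")
  case False
  with t have t: "t > 0" by simp
  define R where "R = (\<lambda>K \<omega>. t / real K * (\<Sum>i<K. X (real i * (t / real K)) \<omega>))"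
  have 1: "R K \<in> borel_measurable G" for K
    unfolding R_def using grid_point[of t _ K] t by (intro borel_measurable_times borel_measurable_sum X) (auto simp del: times_divide_eq_right)
  have 2: "(\<lambda>K. R K \<omega>) \<longlonglongrightarrow> integral {0..t} (\<lambda>s. X s \<omega>)" if \<omega>: "\<omega> \<in> space G" for \<omega>
  proof (rule tendstoI)
    fix e :: real assume e: "e > 0"
    have "grid_conv t (\<lambda>K k. X (real k * (t / real K)) \<omega>) (\<lambda>s. X s \<omega>)" by (simp add: grid_conv_def)
    from grid_conv_integral[OF this t cont[OF \<omega>]] e
    have "\<forall>\<^sub>F K in sequentially. \<forall>k\<le>K. \<bar>t / real K * (\<Sum>i<k. X (real i * (t / real K)) \<omega>) - integral {0..real k * (t / real K)} (\<lambda>s. X s \<omega>)\<bar> < e"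
      unfolding grid_conv_def by blast
    moreover have "\<forall>\<^sub>F K in sequentially. K > (0::nat)" by (rule eventually_gt_at_top)
    ultimately show "\<forall>\<^sub>F K in sequentially. dist (R K \<omega>) (integral {0..t} (\<lambda>s. X s \<omega>)) < e"
    proof eventually_elim
      case (elim K)
      have "real K * (t / real K) = t" using elim(2) by simp
      with elim(1)[rule_format, of K] show ?case by (simp only: dist_real_def R_def)
    qed
  qed
  from 2 1 show ?thesis by (rule borel_measurable_LIMSEQ_real)
qed simp

text \<open>Stated for an arbitrary \<open>G\<close> and with the driver observed up to time
  \<open>t\<close> only: it yields measurability on the product space as well as
  adaptedness.\<close>

lemma measurable_tower:
  assumes l: "\<And>i. (\<lambda>\<omega>. l \<omega> i) \<in> borel_measurable G"
    and z: "\<And>s. 0 \<le> s \<Longrightarrow> s \<le> t \<Longrightarrow> (\<lambda>\<omega>. z \<omega> s) \<in> borel_measurable G"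
    and cont: "\<And>\<omega>. \<omega> \<in> space G \<Longrightarrow> continuous_on {0..} (z \<omega>)" and t: "t \<ge> 0"
  shows "(\<lambda>\<omega>. tower (l \<omega>) (z \<omega>) j t) \<in> borel_measurable G"
    and "(\<lambda>\<omega>. tower_log (l \<omega>) (z \<omega>) j t) \<in> borel_measurable G"
proof -
  have I: "(\<lambda>\<omega>. integral {0..s} (\<lambda>r. exp (- 2 * tower (l \<omega>) (z \<omega>) j r))) \<in> borel_measurable G"
    if s: "0 \<le> s" and tw: "\<And>r. 0 \<le> r \<Longrightarrow> r \<le> s \<Longrightarrow> (\<lambda>\<omega>. tower (l \<omega>) (z \<omega>) j r) \<in> borel_measurable G" for j s
  proof (rule measurable_integral_continuous[OF s])
    fix r assume "0 \<le> r" "r \<le> s"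
    note [measurable] = tw[OF this]
    show "(\<lambda>\<omega>. exp (- 2 * tower (l \<omega>) (z \<omega>) j r)) \<in> borel_measurable G" by measurable
  next
    fix \<omega> assume "\<omega> \<in> space G"
    then show "continuous_on {0..s} (\<lambda>r. exp (- 2 * tower (l \<omega>) (z \<omega>) j r))"
      by (intro continuous_intros continuous_on_subset[OF continuous_on_tower[OF cont]]) auto
  qed
  have tw: "(\<lambda>\<omega>. tower (l \<omega>) (z \<omega>) j s) \<in> borel_measurable G" if "0 \<le> s" "s \<le> t" for j s
    using that
  proof (induction j arbitrary: s)
    case 0 then show ?case using z by simp
  next
    case (Suc j)
    have "(\<lambda>\<omega>. integral {0..s} (\<lambda>r. exp (- 2 * tower (l \<omega>) (z \<omega>) j r))) \<in> borel_measurable G"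
      by (rule I) (use Suc in auto)
    then show ?case using Suc l by (simp add: borel_measurable_diff borel_measurable_uminus)
  qed
  then show "(\<lambda>\<omega>. tower (l \<omega>) (z \<omega>) j t) \<in> borel_measurable G" using t by simp
  have "(\<lambda>\<omega>. integral {0..t} (\<lambda>r. exp (- 2 * tower (l \<omega>) (z \<omega>) j r))) \<in> borel_measurable G"
    by (rule I) (use t tw in auto)
  then show "(\<lambda>\<omega>. tower_log (l \<omega>) (z \<omega>) j t) \<in> borel_measurable G"
    unfolding tower_log_def using l tw[of t j] t by simp
qed

section \<open>Invariance of Lipschitz expectations under the exact flow\<close>

definition level_state :: "real \<Rightarrow> (real \<Rightarrow> 'a \<Rightarrow> real) \<Rightarrow> real \<Rightarrow> 'a \<times> (nat \<Rightarrow> real) \<Rightarrow> nat \<Rightarrow> real" where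
  "level_state \<mu> B t \<omega> j = tower_log (snd \<omega>) (driver \<mu> B (fst \<omega>)) j t"

lemma continuous_on_driver:
  assumes "standard_brownian_motion M B" "\<omega> \<in> space M"
  shows "continuous_on {0..} (driver \<mu> B \<omega>)"
  using assms unfolding standard_brownian_motion_def continuous_paths_def driver_def[abs_def]
  by (auto intro!: continuous_intros)

lemma driver_0: "driver \<mu> B \<omega> 0 = 0"
  by (simp add: driver_def)

lemma level_state_0: "level_state \<mu> B 0 \<omega> = snd \<omega>"
  by (simp add: level_state_def fun_eq_iff tower_log_0 driver_0)

lemma measurable_snd_component: "(\<lambda>\<omega>. snd \<omega> i) \<in> borel_measurable (M \<Otimes>\<^sub>M levels \<mu>)"
proof -
  have "(\<lambda>l. l i) \<in> measurable (levels \<mu>) (log_gamma \<mu>)"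
    unfolding levels_def by (rule measurable_component_singleton) simp
  then have "(\<lambda>l. l i) \<in> borel_measurable (levels \<mu>)" by (simp cong: measurable_cong_sets)
  then show ?thesis by (rule measurable_compose[OF measurable_snd])
qed

lemma measurable_level_state:
  assumes B: "standard_brownian_motion M B" and t: "t \<ge> 0"
  shows "level_state \<mu> B t \<in> measurable (M \<Otimes>\<^sub>M levels \<nu>) (PiM UNIV (\<lambda>_. borel))"
proof (rule measurable_PiM_single')
  fix j :: nat
  show "(\<lambda>\<omega>. level_state \<mu> B t \<omega> j) \<in> borel_measurable (M \<Otimes>\<^sub>M levels \<nu>)"
    unfolding level_state_def
  proof (rule measurable_tower(2)[OF measurable_snd_component _ _ t])
    fix s :: real assume "0 \<le> s"
    have [measurable]: "B s \<in> borel_measurable M" "B 0 \<in> borel_measurable M"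
      using brownian_measurable[OF B] \<open>0 \<le> s\<close> by auto
    show "(\<lambda>\<omega>. driver \<mu> B (fst \<omega>) s) \<in> borel_measurable (M \<Otimes>\<^sub>M levels \<nu>)"
      unfolding driver_def by measurable
  qed (auto simp: space_pair_measure intro: continuous_on_driver[OF B])
qed (auto simp: space_PiM)

text \<open>The expectations along the discretisations have two limits that must coincide: the left
  side by pathwise convergence and boundedness of \<psi>, the right side because the accumulated
  error is a multiple of \<open>sqrt (T / K)\<close>.\<close>

lemma expectation_level_state:
  assumes B: "standard_brownian_motion M B" and \<mu>: "\<mu> > 0" and T: "T > 0" and \<psi>: "level_lipschitz n c \<psi>"
  shows "(\<integral>\<omega>. \<psi> (level_state \<mu> B T \<omega>) \<partial>(M \<Otimes>\<^sub>M levels \<mu>)) = (\<integral>l. \<psi> l \<partial>levels \<mu>)"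
proof -
  interpret M: prob_space M using B by (simp add: standard_brownian_motion_def)
  interpret N: prob_space "levels \<mu>" by (rule prob_space_levels) fact
  interpret P: pair_prob_space M "levels \<mu>" ..
  let ?P = "M \<Otimes>\<^sub>M levels \<mu>"
  have [measurable]: "\<psi> \<in> borel_measurable (PiM UNIV (\<lambda>_. borel))"
    and bd: "\<And>l. \<bar>\<psi> l\<bar> \<le> c" and lip: "\<And>l l'. \<bar>\<psi> l - \<psi> l'\<bar> \<le> c * level_dist n l l'"
    using \<psi> by (auto simp: level_lipschitz_def)
  define C where "C = (\<lambda>K \<omega>. chain (T / real K) (snd \<omega>)
      (\<lambda>i. driver \<mu> B (fst \<omega>) (real (Suc i) * (T / real K)) - driver \<mu> B (fst \<omega>) (real i * (T / real K))) K)"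
  have Cm[measurable]: "C K \<in> measurable ?P (PiM UNIV (\<lambda>_. borel))" for K
    unfolding C_def
  proof (rule measurable_chain)
    fix i
    have [measurable]: "B (real (Suc i) * (T / real K)) \<in> borel_measurable M" "B (real i * (T / real K)) \<in> borel_measurable M"
      "B 0 \<in> borel_measurable M"
      using T by (auto intro!: brownian_measurable[OF B])
    show "(\<lambda>\<omega>. driver \<mu> B (fst \<omega>) (real (Suc i) * (T / real K)) - driver \<mu> B (fst \<omega>) (real i * (T / real K))) \<in> borel_measurable ?P"
      unfolding driver_def by measurable
  qed (simp add: measurable_cong_sets[OF refl sets_levels, symmetric])
  have lim: "(\<lambda>K. \<psi> (C K \<omega>)) \<longlonglongrightarrow> \<psi> (level_state \<mu> B T \<omega>)" if "\<omega> \<in> space ?P" for \<omega>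
  proof -
    have "(\<lambda>K. C K \<omega> j) \<longlonglongrightarrow> level_state \<mu> B T \<omega> j" for j
      unfolding C_def level_state_def
      by (rule chain_converges[OF continuous_on_driver[OF B] driver_0 T]) (use that in \<open>auto simp: space_pair_measure\<close>)
    then have "(\<lambda>K. \<bar>C K \<omega> j - level_state \<mu> B T \<omega> j\<bar>) \<longlonglongrightarrow> 0" for j
      by (rule tendsto_rabs_zero[OF LIM_zero])
    then have "(\<lambda>K. c * level_dist n (C K \<omega>) (level_state \<mu> B T \<omega>)) \<longlonglongrightarrow> c * (\<Sum>i<n. (1/3) ^ i * 0)"
      unfolding level_dist_def by (intro tendsto_intros)
    then have "(\<lambda>K. c * level_dist n (C K \<omega>) (level_state \<mu> B T \<omega>)) \<longlonglongrightarrow> 0" by simp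
    then have "(\<lambda>K. \<psi> (C K \<omega>) - \<psi> (level_state \<mu> B T \<omega>)) \<longlonglongrightarrow> 0"
      by (rule Lim_null_comparison[rotated]) (use lip in auto)
    then show ?thesis by (rule LIM_zero_cancel)
  qed
  have 1: "(\<lambda>K. \<integral>\<omega>. \<psi> (C K \<omega>) \<partial>?P) \<longlonglongrightarrow> (\<integral>\<omega>. \<psi> (level_state \<mu> B T \<omega>) \<partial>?P)"
  proof (rule integral_dominated_convergence[where w="\<lambda>_. c"])
    show "(\<lambda>\<omega>. \<psi> (level_state \<mu> B T \<omega>)) \<in> borel_measurable ?P"
      by (rule measurable_compose[OF measurable_level_state[OF B]]) (use T in auto)
  qed (use lim bd in auto)
  have eq: "(\<integral>\<omega>. \<psi> (C K \<omega>) \<partial>?P) = (\<integral>l. \<integral>\<omega>. \<psi> (C K (\<omega>, l)) \<partial>M \<partial>levels \<mu>)" for K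
  proof -
    have "integrable ?P (\<lambda>(\<omega>, l). \<psi> (C K (\<omega>, l)))"
      by (rule P.P.integrable_const_bound[where B=c]) (auto simp: bd split_beta')
    from P.integral_snd[OF this] show ?thesis by (simp add: split_beta')
  qed
  have "(\<lambda>K. (\<integral>\<omega>. \<psi> (C K \<omega>) \<partial>?P) - (\<integral>l. \<psi> l \<partial>levels \<mu>)) \<longlonglongrightarrow> 0"
  proof (rule Lim_null_comparison)
    show "\<forall>\<^sub>F K in sequentially. norm ((\<integral>\<omega>. \<psi> (C K \<omega>) \<partial>?P) - (\<integral>l. \<psi> l \<partial>levels \<mu>)) \<le> real n * vertex_constant \<mu> * c * T * sqrt (T / K)"
      using eventually_ge_at_top[of "nat \<lceil>T\<rceil>"]
    proof eventually_elim
      case (elim K)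
      then have "T \<le> real K" by linarith
      from brownian_chain_almost_stationary[OF B \<mu> T this \<psi>] show ?case unfolding eq by (simp add: C_def)
    qed
    have "(\<lambda>K. T / real K) \<longlonglongrightarrow> 0" by (rule lim_const_over_n)
    then have "(\<lambda>K. sqrt (T / real K)) \<longlonglongrightarrow> 0" using tendsto_real_sqrt by fastforce
    then show "(\<lambda>K. real n * vertex_constant \<mu> * c * T * sqrt (T / real K)) \<longlonglongrightarrow> 0" by (rule tendsto_mult_right_zero)
  qed
  then have "(\<lambda>K. \<integral>\<omega>. \<psi> (C K \<omega>) \<partial>?P) \<longlonglongrightarrow> (\<integral>l. \<psi> l \<partial>levels \<mu>)" by (rule LIM_zero_cancel)
  with 1 show ?thesis by (rule LIMSEQ_unique)
qed

section \<open>From Lipschitz functions to the joint law\<close>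

definition ramp :: "real \<Rightarrow> real \<Rightarrow> real" where
  "ramp m x = max 0 (min 1 (1 - m * x))"

lemma ramp_bounds: "0 \<le> ramp m x" "ramp m x \<le> 1"
  by (auto simp: ramp_def)

lemma ramp_lipschitz: "m \<ge> 0 \<Longrightarrow> \<bar>ramp m x - ramp m y\<bar> \<le> m * \<bar>x - y\<bar>"
proof -
  assume "m \<ge> 0"
  have "\<bar>ramp m x - ramp m y\<bar> \<le> \<bar>m * x - m * y\<bar>" unfolding ramp_def by (auto simp: max_def min_def abs_if)
  also have "\<dots> = m * \<bar>x - y\<bar>" using \<open>m \<ge> 0\<close> by (simp add: abs_mult flip: right_diff_distrib)
  finally show ?thesis .
qed

lemma ramp_tendsto: "(\<lambda>m. ramp (real m) x) \<longlonglongrightarrow> (if x \<le> 0 then 1 else 0)"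
proof (cases "x \<le> 0")
  case True
  then have "ramp (real m) x = 1" for m by (simp add: ramp_def mult_nonneg_nonpos)
  then show ?thesis using True by simp
next
  case False
  have "\<forall>\<^sub>F m in sequentially. 1 / x < real m"
    by (rule filterlim_at_top_dense[THEN iffD1, rule_format]) (rule filterlim_real_sequentially)
  then have "\<forall>\<^sub>F m in sequentially. ramp (real m) x = 0"
    by eventually_elim (use False in \<open>auto simp: ramp_def field_simps max_def min_def\<close>)
  then show ?thesis using False by (simp add: tendsto_eventually)
qed

text \<open>The factors lie between 0 and 1, so the difference of the products is at most the sum of
  the differences of the factors. The power of 3 compensates the smallest weight in
  \<open>level_dist n\<close>, and the maximum with 1 covers the bound on the function
  itself.\<close>

lemma level_lipschitz_prod_ramp:
  "level_lipschitz n (max 1 (real m * 3 ^ n)) (\<lambda>l. \<Prod>j<n. ramp (real m) (l j - a j))"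
  unfolding level_lipschitz_def
proof (intro conjI allI)
  show "(\<lambda>l. \<Prod>j<n. ramp (real m) (l j - a j)) \<in> borel_measurable (PiM UNIV (\<lambda>_. borel))"
    unfolding ramp_def by measurable
  fix l l' :: "nat \<Rightarrow> real"
  have "(\<Prod>j<n. ramp (real m) (l j - a j)) \<le> 1" "0 \<le> (\<Prod>j<n. ramp (real m) (l j - a j))"
    by (intro prod_le_1 prod_nonneg; simp add: ramp_bounds)+
  then show "\<bar>\<Prod>j<n. ramp (real m) (l j - a j)\<bar> \<le> max 1 (real m * 3 ^ n)" by simp
  have "\<bar>(\<Prod>j<n. ramp (real m) (l j - a j)) - (\<Prod>j<n. ramp (real m) (l' j - a j))\<bar>
     \<le> (\<Sum>j<n. \<bar>ramp (real m) (l j - a j) - ramp (real m) (l' j - a j)\<bar>)"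
    using norm_prod_diff[of "{..<n}" "\<lambda>j. ramp (real m) (l j - a j)" "\<lambda>j. ramp (real m) (l' j - a j)"]
    by (simp add: ramp_bounds)
  also have "\<dots> \<le> (\<Sum>j<n. real m * 3 ^ n * ((1/3) ^ j * \<bar>l j - l' j\<bar>))"
  proof (intro sum_mono)
    fix j assume j: "j \<in> {..<n}"
    have "\<bar>ramp (real m) (l j - a j) - ramp (real m) (l' j - a j)\<bar> \<le> real m * \<bar>l j - l' j\<bar>"
      using ramp_lipschitz[of "real m" "l j - a j" "l' j - a j"] by simp
    also have "\<dots> \<le> real m * ((3 ^ n * (1/3) ^ j) * \<bar>l j - l' j\<bar>)"
    proof -
      have "(1::real) \<le> 3 ^ (n - j)" by simp
      also have "(3::real) ^ (n - j) = 3 ^ n * (1/3) ^ j" using j by (simp add: power_diff power_one_over field_simps)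
      finally have "1 * \<bar>l j - l' j\<bar> \<le> (3 ^ n * (1/3) ^ j) * \<bar>l j - l' j\<bar>" by (rule mult_right_mono) simp
      then show ?thesis by (intro mult_left_mono) auto
    qed
    finally show "\<bar>ramp (real m) (l j - a j) - ramp (real m) (l' j - a j)\<bar> \<le> real m * 3 ^ n * ((1/3) ^ j * \<bar>l j - l' j\<bar>)"
      by (simp add: mult_ac)
  qed
  also have "\<dots> = (real m * 3 ^ n) * level_dist n l l'" by (simp add: level_dist_def sum_distrib_left)
  also have "\<dots> \<le> max 1 (real m * 3 ^ n) * level_dist n l l'"
    by (intro mult_right_mono) (auto simp: level_dist_def sum_nonneg)
  finally show "\<bar>(\<Prod>j<n. ramp (real m) (l j - a j)) - (\<Prod>j<n. ramp (real m) (l' j - a j))\<bar> \<le> max 1 (real m * 3 ^ n) * level_dist n l l'" .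
qed

definition orthant :: "nat \<Rightarrow> (nat \<Rightarrow> real) \<Rightarrow> (nat \<Rightarrow> real) set" where
  "orthant n a = {l. \<forall>j<n. l j \<le> a j}"

lemma sets_orthant[measurable]: "orthant n a \<in> sets (PiM UNIV (\<lambda>_. borel))"
proof -
  have "{l \<in> space (PiM UNIV (\<lambda>_::nat. borel)). \<forall>j\<in>{..<n}. l j \<le> a j} \<in> sets (PiM UNIV (\<lambda>_. borel :: real measure))"
    by measurable
  then show ?thesis by (simp add: orthant_def space_PiM Ball_def)
qed

text \<open>Orthants are stable under intersection, where a coordinate that one of them leaves free
  takes its bound from the other, and they generate the product \<sigma>-algebra.\<close>

lemma measure_eqI_orthant:
  assumes P: "prob_space P" and Q: "prob_space Q"
    and sP: "sets P = sets (PiM UNIV (\<lambda>_::nat. borel :: real measure))" and sQ: "sets Q = sets (PiM UNIV (\<lambda>_::nat. borel :: real measure))"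
    and eq: "\<And>n a. measure P (orthant n a) = measure Q (orthant n a)"
  shows "P = Q"
proof (rule measure_eqI_generator_eq[where E="{orthant n a | n a. True}" and \<Omega>=UNIV and A="\<lambda>_::nat. UNIV"])
  let ?E = "{orthant n a | n a. True}"
  interpret P: prob_space P by fact
  interpret Q: prob_space Q by fact
  have "orthant n a \<inter> orthant n' a' = orthant (max n n')
     (\<lambda>j. if j < n then if j < n' then min (a j) (a' j) else a j else a' j)" for n a n' a'
  proof -
    have "l j \<le> (if j < n then if j < n' then min (a j) (a' j) else a j else a' j) \<longleftrightarrow> (j < n \<longrightarrow> l j \<le> a j) \<and> (j < n' \<longrightarrow> l j \<le> a' j)"
      if "j < max n n'" for j l using that by auto
    moreover have "j < max n n' \<longleftrightarrow> j < n \<or> j < n'" for j by auto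
    ultimately show ?thesis unfolding orthant_def by blast
  qed
  then show "Int_stable ?E" unfolding Int_stable_def by blast
  show "?E \<subseteq> Pow UNIV" by simp
  show "emeasure P X = emeasure Q X" if "X \<in> ?E" for X
    using that eq by (auto simp: P.emeasure_eq_measure Q.emeasure_eq_measure)
  have "sets (PiM UNIV (\<lambda>_::nat. borel :: real measure)) = sigma_sets UNIV ?E"
  proof (rule antisym)
    show "sigma_sets UNIV ?E \<subseteq> sets (PiM UNIV (\<lambda>_::nat. borel :: real measure))"
    proof -
      have "?E \<subseteq> sets (PiM UNIV (\<lambda>_::nat. borel :: real measure))" using sets_orthant by blast
      from sets.sigma_sets_subset[OF this] show ?thesis by (simp add: space_PiM)
    qed
    let ?S = "sigma UNIV ?E :: (nat \<Rightarrow> real) measure"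
    have "(\<lambda>l. l) \<in> measurable ?S (PiM UNIV (\<lambda>_::nat. borel :: real measure))"
    proof (rule measurable_PiM_single')
      fix j :: nat
      show "(\<lambda>l. l j) \<in> borel_measurable ?S"
        unfolding borel_measurable_iff_le
      proof
        fix x :: real
        \<comment> \<open>The earlier coordinates are also constrained in an orthant; letting their
          common bound \<open>N\<close> grow removes the constraint.\<close>
        have "{l. l j \<le> x} = (\<Union>N::nat. orthant (Suc j) ((\<lambda>_. real N)(j := x)))"
        proof (intro equalityI subsetI)
          fix l assume l: "l \<in> {l. l j \<le> x}"
          obtain N :: nat where "Max (l ` {..j}) \<le> real N" using real_arch_simple by blast
          then have "l i \<le> real N" if "i \<le> j" for i using that by (auto simp: Max_le_iff)
          then have "l \<in> orthant (Suc j) ((\<lambda>_. real N)(j := x))" using l by (auto simp: orthant_def)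
          then show "l \<in> (\<Union>N::nat. orthant (Suc j) ((\<lambda>_. real N)(j := x)))" by blast
        qed (auto simp: orthant_def)
        also have "\<dots> \<in> sets ?S" by (intro sets.countable_UN) auto
        finally show "{l \<in> space ?S. l j \<le> x} \<in> sets ?S" by simp
      qed
    qed auto
    from measurable_sets[OF this] show "sets (PiM UNIV (\<lambda>_::nat. borel :: real measure)) \<subseteq> sigma_sets UNIV ?E" by auto
  qed
  then show "sets P = sigma_sets UNIV ?E" "sets Q = sigma_sets UNIV ?E" using sP sQ by simp_all
  \<comment> \<open>With no coordinate constrained, the whole space belongs to the generator and
    serves as the exhausting sequence.\<close>
  have "orthant 0 a = UNIV" for a by (simp add: orthant_def)
  then show "range (\<lambda>_::nat. UNIV) \<subseteq> ?E" by blast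
  show "emeasure P ((\<lambda>_::nat. UNIV) i) \<noteq> \<infinity>" for i :: nat by simp
qed auto

text \<open>Products of ramps converge to the indicator of an orthant, and their expectations agree
  by \<open>expectation_level_state\<close>. Time 0 is separate because the discretisation
  presupposes a positive horizon; there the state is the initial value.\<close>

lemma distr_level_state:
  assumes B: "standard_brownian_motion M B" and \<mu>: "\<mu> > 0" and t: "t \<ge> 0"
  shows "distr (M \<Otimes>\<^sub>M levels \<mu>) (PiM UNIV (\<lambda>_. borel)) (level_state \<mu> B t) = levels \<mu>"
proof -
  interpret M: prob_space M using B by (simp add: standard_brownian_motion_def)
  interpret N: prob_space "levels \<mu>" by (rule prob_space_levels) fact
  interpret P: pair_prob_space M "levels \<mu>" ..
  let ?P = "M \<Otimes>\<^sub>M levels \<mu>"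
  have Lm[measurable]: "level_state \<mu> B t \<in> measurable ?P (PiM UNIV (\<lambda>_. borel))"
    by (rule measurable_level_state[OF B t])
  show ?thesis
  proof (rule measure_eqI_orthant)
    show "prob_space (distr ?P (PiM UNIV (\<lambda>_. borel)) (level_state \<mu> B t))" by (rule P.P.prob_space_distr[OF Lm])
    fix n a
    have vi: "measure (distr ?P (PiM UNIV (\<lambda>_. borel)) (level_state \<mu> B t)) (orthant n a)
       = measure ?P (level_state \<mu> B t -` orthant n a \<inter> space ?P)"
      by (rule measure_distr) auto
    show "measure (distr ?P (PiM UNIV (\<lambda>_. borel)) (level_state \<mu> B t)) (orthant n a) = measure (levels \<mu>) (orthant n a)"
    proof (cases "t = 0")
      case True
      have "level_state \<mu> B t -` orthant n a \<inter> space ?P = space M \<times> orthant n a"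
        by (auto simp: True level_state_0 space_pair_measure)
      then show ?thesis unfolding vi
        using sets_orthant[of n a] by (simp add: measure_def N.emeasure_pair_measure_Times sets_levels M.emeasure_space_1)
    next
      case False
      with t have t: "t > 0" by simp
      let ?r = "\<lambda>m l. \<Prod>j<n. ramp (real m) (l j - a j)"
      have rm: "(\<lambda>l. ?r m l) \<in> borel_measurable (PiM UNIV (\<lambda>_. borel))" for m
        using level_lipschitz_prod_ramp[of n m a] by (simp add: level_lipschitz_def)
      have rb: "\<bar>?r m l\<bar> \<le> 1" for m l
        using prod_le_1[of "{..<n}" "\<lambda>j. ramp (real m) (l j - a j)"] prod_nonneg[of "{..<n}" "\<lambda>j. ramp (real m) (l j - a j)"]
        by (simp add: ramp_bounds)
      have lim: "(\<lambda>m. ?r m l) \<longlonglongrightarrow> indicator (orthant n a) l" for l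
      proof -
        have "(\<lambda>m. ?r m l) \<longlonglongrightarrow> (\<Prod>j<n. if l j - a j \<le> 0 then 1 else 0)"
          by (intro tendsto_prod ramp_tendsto)
        also have "(\<Prod>j<n. if l j - a j \<le> 0 then 1 else 0) = (indicator (orthant n a) l :: real)"
          by (auto simp: orthant_def indicator_def prod_zero_iff)
        finally show ?thesis .
      qed
      have 1: "(\<lambda>m. \<integral>\<omega>. ?r m (level_state \<mu> B t \<omega>) \<partial>?P) \<longlonglongrightarrow> (\<integral>\<omega>. indicator (orthant n a) (level_state \<mu> B t \<omega>) \<partial>?P)"
        using measurable_compose[OF Lm rm] lim rb
        by (intro integral_dominated_convergence[where w="\<lambda>_. 1"]) (auto intro!: measurable_compose[OF Lm])
      have 2: "(\<lambda>m. \<integral>l. ?r m l \<partial>levels \<mu>) \<longlonglongrightarrow> (\<integral>l. indicator (orthant n a) l \<partial>levels \<mu>)"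
        using rm lim rb
        by (intro integral_dominated_convergence[where w="\<lambda>_. 1"]) (auto simp: measurable_cong_sets[OF sets_levels refl])
      have "(\<integral>\<omega>. indicator (orthant n a) (level_state \<mu> B t \<omega>) \<partial>?P) = (\<integral>l. indicator (orthant n a) l \<partial>levels \<mu> :: real)"
        using 1 2 unfolding expectation_level_state[OF B \<mu> t level_lipschitz_prod_ramp] by (rule LIMSEQ_unique)
      moreover have "(\<integral>l. indicator (orthant n a) l \<partial>levels \<mu> :: real) = measure (levels \<mu>) (orthant n a)" by simp
      moreover have "(\<integral>\<omega>. indicator (orthant n a) (level_state \<mu> B t \<omega>) \<partial>?P :: real) = measure ?P (level_state \<mu> B t -` orthant n a \<inter> space ?P)"
      proof -
        have "(\<integral>\<omega>. indicator (orthant n a) (level_state \<mu> B t \<omega>) \<partial>?P :: real) = (\<integral>\<omega>. indicator (level_state \<mu> B t -` orthant n a \<inter> space ?P) \<omega> \<partial>?P)"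
          by (intro Bochner_Integration.integral_cong refl) (auto simp: indicator_def)
        then show ?thesis by simp
      qed
      ultimately show ?thesis unfolding vi by simp
    qed
  qed (auto simp: sets_levels prob_space_levels \<mu>)
qed

section \<open>Stationarity, marginals and independence of the solution\<close>

definition sol :: "real \<Rightarrow> (real \<Rightarrow> 'a \<Rightarrow> real) \<Rightarrow> nat \<Rightarrow> real \<Rightarrow> 'a \<times> (nat \<Rightarrow> real) \<Rightarrow> real" where
  "sol \<mu> B n x \<omega> = (if n = 0 then 0 else exp (level_state \<mu> B x \<omega> (n - 1)))"

text \<open>At every time the sequence is the same measurable image \<open>G\<close> of the level
  state, whose law is always \<open>levels \<mu>\<close>.\<close>

lemma stationary_sol:
  assumes B: "standard_brownian_motion M B" and \<mu>: "\<mu> > 0"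
  shows "stationary_sequence (M \<Otimes>\<^sub>M levels \<mu>) (sol \<mu> B)"
proof -
  define G where "G = (\<lambda>l n. if n = 0 then 0 else exp (l (n - 1 :: nat)) :: real)"
  have [measurable]: "G \<in> measurable (PiM UNIV (\<lambda>_. borel)) (PiM UNIV (\<lambda>_. borel))"
    unfolding G_def by (rule measurable_PiM_single') (auto simp: space_PiM)
  have "distr (M \<Otimes>\<^sub>M levels \<mu>) (PiM UNIV (\<lambda>_. borel)) (\<lambda>\<omega> n. sol \<mu> B n x \<omega>) = distr (levels \<mu>) (PiM UNIV (\<lambda>_. borel)) G"
    if x: "x \<ge> 0" for x
  proof -
    have "distr (distr (M \<Otimes>\<^sub>M levels \<mu>) (PiM UNIV (\<lambda>_. borel)) (level_state \<mu> B x)) (PiM UNIV (\<lambda>_. borel)) G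
      = distr (M \<Otimes>\<^sub>M levels \<mu>) (PiM UNIV (\<lambda>_. borel)) (G \<circ> level_state \<mu> B x)"
      by (rule distr_distr) (use measurable_level_state[OF B x] in measurable)
    moreover have "G \<circ> level_state \<mu> B x = (\<lambda>\<omega> n. sol \<mu> B n x \<omega>)" by (auto simp: G_def sol_def fun_eq_iff)
    ultimately show ?thesis by (simp add: distr_level_state[OF B \<mu> x])
  qed
  then show ?thesis by (simp add: stationary_sequence_def)
qed

lemma distr_level_state_component:
  assumes B: "standard_brownian_motion M B" and \<mu>: "\<mu> > 0" and x: "x \<ge> 0"
  shows "distr (M \<Otimes>\<^sub>M levels \<mu>) borel (\<lambda>\<omega>. level_state \<mu> B x \<omega> j) = log_gamma \<mu>"
proof -
  have "distr (M \<Otimes>\<^sub>M levels \<mu>) borel (\<lambda>\<omega>. level_state \<mu> B x \<omega> j) =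
      distr (distr (M \<Otimes>\<^sub>M levels \<mu>) (PiM UNIV (\<lambda>_. borel)) (level_state \<mu> B x)) borel (\<lambda>l. l j)"
    by (subst distr_distr) (use measurable_level_state[OF B x] in \<open>auto simp: o_def\<close>)
  also have "\<dots> = distr (levels \<mu>) (log_gamma \<mu>) (\<lambda>l. l j)"
    unfolding distr_level_state[OF B \<mu> x] by (rule distr_cong) auto
  also have "\<dots> = log_gamma \<mu>"
    unfolding levels_def by (rule distr_PiM_component) (auto simp: prob_space_log_gamma \<mu>)
  finally show ?thesis .
qed

lemma sol_distributed:
  assumes B: "standard_brownian_motion M B" and \<mu>: "\<mu> > 0" and x: "x \<ge> 0" and n: "n \<ge> 1"
  shows "distributed (M \<Otimes>\<^sub>M levels \<mu>) lborel (sol \<mu> B n x) (gamma_density \<mu> 2)"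
proof -
  have m[measurable]: "(\<lambda>\<omega>. level_state \<mu> B x \<omega> j) \<in> borel_measurable (M \<Otimes>\<^sub>M levels \<mu>)" for j
    using measurable_level_state[OF B x] by measurable
  have s: "sol \<mu> B n x = (\<lambda>\<omega>. exp (level_state \<mu> B x \<omega> (n - 1)))" using n by (auto simp: sol_def fun_eq_iff)
  have "distr (M \<Otimes>\<^sub>M levels \<mu>) lborel (sol \<mu> B n x) = distr (distr (M \<Otimes>\<^sub>M levels \<mu>) borel (\<lambda>\<omega>. level_state \<mu> B x \<omega> (n - 1))) lborel exp"
    unfolding s by (subst distr_distr) (auto simp: o_def)
  also have "\<dots> = density lborel (\<lambda>v. ennreal (gamma_density \<mu> 2 v))"
    unfolding distr_level_state_component[OF B \<mu> x] by (rule distr_log_gamma_exp[OF \<mu>])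
  finally show ?thesis unfolding distributed_def by (auto simp: s)
qed

lemma sol_indep:
  assumes B: "standard_brownian_motion M B" and \<mu>: "\<mu> > 0" and x: "x \<ge> 0"
  shows "prob_space.indep_vars (M \<Otimes>\<^sub>M levels \<mu>) (\<lambda>_. borel) (\<lambda>n. sol \<mu> B n x) {1..}"
proof -
  interpret M: prob_space M using B by (simp add: standard_brownian_motion_def)
  interpret N: prob_space "levels \<mu>" by (rule prob_space_levels) fact
  interpret P: pair_prob_space M "levels \<mu>" ..
  have m[measurable]: "(\<lambda>\<omega>. level_state \<mu> B x \<omega> j) \<in> borel_measurable (M \<Otimes>\<^sub>M levels \<mu>)" for j
    using measurable_level_state[OF B x] by measurable
  let ?X = "\<lambda>j \<omega>. level_state \<mu> B x \<omega> j"
  have "P.indep_vars (\<lambda>_. borel) ?X UNIV"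
    by (subst P.P.indep_vars_iff_distr_eq_PiM)
       (simp_all add: distr_level_state_component[OF B \<mu> x] distr_level_state[OF B \<mu> x] restrict_UNIV levels_def[symmetric])
  \<comment> \<open>Re-indexing by singleton blocks: \<open>n - 1\<close> is injective for
    \<open>n \<ge> 1\<close>, so the blocks are disjoint.\<close>
  then have "P.indep_vars (\<lambda>n. PiM {n - 1} (\<lambda>_. borel)) (\<lambda>n \<omega>. restrict (\<lambda>i. ?X i \<omega>) {n - 1}) {1..}"
    by (rule P.P.indep_vars_restrict) (auto simp: disjoint_family_on_def)
  then have "P.indep_vars (\<lambda>_. borel) (\<lambda>n \<omega>. (\<lambda>f. exp (f (n - 1))) (restrict (\<lambda>i. ?X i \<omega>) {n - 1})) {1..}"
    by (rule P.P.indep_vars_compose2) measurable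
  then show ?thesis
    by (rule P.P.indep_vars_cong[THEN iffD1, rotated -1]) (auto simp: sol_def)
qed

section \<open>Filtration\<close>

text \<open>The natural filtration of \<open>B\<close>. At negative times the generator is empty and
  the \<sigma>-algebra trivial.\<close>

definition past :: "'a measure \<Rightarrow> (real \<Rightarrow> 'a \<Rightarrow> real) \<Rightarrow> real \<Rightarrow> 'a measure" where
  "past M B s = sigma (space M) {B r -` A \<inter> space M | r A. 0 \<le> r \<and> r \<le> s \<and> A \<in> sets borel}"

lemma space_past[simp]: "space (past M B s) = space M"
  unfolding past_def by (rule space_measure_of) auto

lemma sets_past: "sets (past M B s) = sigma_sets (space M) {B r -` A \<inter> space M | r A. 0 \<le> r \<and> r \<le> s \<and> A \<in> sets borel}"
  unfolding past_def by (rule sets_measure_of) auto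

lemma measurable_past: "0 \<le> r \<Longrightarrow> r \<le> s \<Longrightarrow> B r \<in> borel_measurable (past M B s)"
  by (rule measurableI) (auto simp: sets_past intro!: sigma_sets.Basic)

lemma sets_past_mono: "s \<le> s' \<Longrightarrow> sets (past M B s) \<subseteq> sets (past M B s')"
  unfolding sets_past by (rule sigma_sets_mono') (blast intro: order_trans)

lemma sets_past_subset:
  assumes "standard_brownian_motion M B"
  shows "sets (past M B s) \<subseteq> sets M"
  unfolding sets_past
  by (rule sets.sigma_sets_subset) (auto intro: measurable_sets[OF brownian_measurable[OF assms]])

section \<open>Independence of Brownian increments from the past\<close>

definition cylinder :: "'a measure \<Rightarrow> (real \<Rightarrow> 'a \<Rightarrow> real) \<Rightarrow> real set \<Rightarrow> (real \<Rightarrow> real set) \<Rightarrow> 'a set" where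
  "cylinder M B R A = {\<omega> \<in> space M. \<forall>r\<in>R. B r \<omega> \<in> A r}"

lemma (in prob_space) indep_set_sigma_sets:
  assumes "indep_set A B" "Int_stable A" "Int_stable B"
  shows "indep_set (sigma_sets (space M) A) (sigma_sets (space M) B)"
proof -
  have "indep_sets (\<lambda>b. sigma_sets (space M) (case_bool A B b)) UNIV"
    using assms unfolding indep_set_def by (intro indep_sets_sigma) (auto split: bool.split)
  then show ?thesis unfolding indep_set_def by (rule indep_sets_mono_sets) (auto split: bool.split)
qed

lemma sets_cylinder:
  assumes B: "standard_brownian_motion M B" and R: "finite R" "R \<subseteq> {0..s}" and A: "\<And>r. A r \<in> sets borel"
  shows "cylinder M B R A \<in> sets M"
proof -
  have "{\<omega> \<in> space M. B r \<omega> \<in> A r} \<in> sets M" if "r \<in> R" for r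
  proof -
    have "B r -` A r \<inter> space M \<in> sets M"
      using that R A by (intro measurable_sets[OF brownian_measurable[OF B]]) auto
    also have "B r -` A r \<inter> space M = {\<omega> \<in> space M. B r \<omega> \<in> A r}" by auto
    finally show ?thesis .
  qed
  then show ?thesis unfolding cylinder_def using R(1) by (intro sets.sets_Collect_finite_All) auto
qed

lemma Int_stable_vimage: "Int_stable {f -` D \<inter> \<Omega> | D. D \<in> sets borel}"
  unfolding Int_stable_def
proof (intro ballI)
  fix a b assume "a \<in> {f -` D \<inter> \<Omega> | D. D \<in> sets borel}" "b \<in> {f -` D \<inter> \<Omega> | D. D \<in> sets borel}"
  then obtain D E where D: "D \<in> sets borel" "a = f -` D \<inter> \<Omega>" and E: "E \<in> sets borel" "b = f -` E \<inter> \<Omega>" by auto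
  have "a \<inter> b = f -` (D \<inter> E) \<inter> \<Omega>" unfolding D E by auto
  then show "a \<inter> b \<in> {f -` D \<inter> \<Omega> | D. D \<in> sets borel}" using D E by blast
qed

lemma (in prob_space) indep_set_mono:
  assumes "indep_set A B" "A' \<subseteq> A" "B' \<subseteq> B"
  shows "indep_set A' B'"
  using assms(1) unfolding indep_set_def
  by (rule indep_sets_mono_sets) (use assms(2,3) in \<open>auto split: bool.split\<close>)

text \<open>\<open>standard_brownian_motion\<close> provides independence of successive increments
  only. The event is therefore rewritten through increments along the sorted times of
  \<open>R\<close>: values of \<open>B\<close> are their partial sums, almost surely, because
  \<open>B 0\<close> is almost surely 0.\<close>

lemma cylinder_increment_indep:
  assumes B: "standard_brownian_motion M B" and st: "0 \<le> s" "s \<le> t"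
    and R: "finite R" "R \<subseteq> {0..s}" and A: "\<And>r. A r \<in> sets borel" and D: "D \<in> sets borel"
  shows "measure M (cylinder M B R A \<inter> ((\<lambda>\<omega>. B t \<omega> - B s \<omega>) -` D \<inter> space M))
     = measure M (cylinder M B R A) * measure M ((\<lambda>\<omega>. B t \<omega> - B s \<omega>) -` D \<inter> space M)"
proof -
  interpret prob_space M using B by (simp add: standard_brownian_motion_def)
  define xs where "xs = sorted_list_of_set (insert 0 R)"
  define m where "m = length xs"
  \<comment> \<open>Time 0 is put in front so that partial sums start there; the entries after the
    sorted times are \<open>s\<close> and then \<open>t\<close>, so that increment number
    \<open>m\<close> is the one from \<open>s\<close> to \<open>t\<close>.\<close>
  define \<tau> where "\<tau> = (\<lambda>i. if i < m then xs ! i else if i = m then s else t)"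
  have set_xs: "set xs = insert 0 R" unfolding xs_def by (rule set_sorted_list_of_set) (use R in simp)
  have srt: "sorted xs" unfolding xs_def by (rule sorted_sorted_list_of_set)
  have m: "m > 0" using set_xs by (cases xs) (auto simp: m_def)
  have xs_mem: "xs ! i \<in> {0..s}" if "i < m" for i
  proof -
    have "xs ! i \<in> insert 0 R" using that set_xs nth_mem by (fastforce simp: m_def)
    then show ?thesis using R st by auto
  qed
  have \<tau>0: "\<tau> 0 = 0"
  proof -
    obtain i where "i < m" "xs ! i = 0" using set_xs by (metis in_set_conv_nth insertI1 m_def)
    then have "xs ! 0 \<le> 0" using srt by (metis m_def sorted_nth_mono le0)
    then show ?thesis using xs_mem[OF m] m by (simp add: \<tau>_def)
  qed
  have mono: "\<tau> i \<le> \<tau> (Suc i)" for i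
    using srt xs_mem[of i] st by (auto simp: \<tau>_def m_def sorted_nth_mono)
  have ge0: "0 \<le> \<tau> i" for i using xs_mem[of i] st by (auto simp: \<tau>_def)
  define X where "X = (\<lambda>i \<omega>. B (\<tau> (Suc i)) \<omega> - B (\<tau> i) \<omega>)"
  have ind: "indep_vars (\<lambda>_. borel) X {..<Suc m}"
    unfolding X_def by (rule brownian_increments_indep[OF B]) (use \<tau>0 mono in auto)
  have Xm: "X m = (\<lambda>\<omega>. B t \<omega> - B s \<omega>)" by (simp add: X_def \<tau>_def)
  have iv: "indep_var (PiM {..<m} (\<lambda>_. borel)) (\<lambda>\<omega>. restrict (\<lambda>i. X i \<omega>) {..<m}) (PiM {m} (\<lambda>_. borel)) (\<lambda>\<omega>. restrict (\<lambda>i. X i \<omega>) {m})"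
    by (rule indep_var_restrict[OF ind]) auto
  let ?P = "PiM {..<m} (\<lambda>_. borel) :: (nat \<Rightarrow> real) measure"
  \<comment> \<open>Only indices whose time belongs to \<open>R\<close> are constrained; this leaves
    out the inserted time 0 unless it is in \<open>R\<close>.\<close>
  define E where "E = {x \<in> space ?P. \<forall>i\<in>{i. i < m \<and> \<tau> i \<in> R}. (\<Sum>k<i. x k) \<in> A (\<tau> i)}"
  define E' where "E' = {x \<in> space (PiM {m} (\<lambda>_. borel) :: (nat \<Rightarrow> real) measure). x m \<in> D}"
  have E: "E \<in> sets ?P"
    unfolding E_def
  proof (rule sets.sets_Collect_finite_All)
    show "finite {i. i < m \<and> \<tau> i \<in> R}" by simp
    fix i assume i: "i \<in> {i. i < m \<and> \<tau> i \<in> R}"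
    have "(\<lambda>x. \<Sum>k<i. x k) \<in> borel_measurable ?P"
      using i by (intro borel_measurable_sum measurable_component_singleton) auto
    from measurable_sets[OF this A[of "\<tau> i"]] show "{x \<in> space ?P. (\<Sum>k<i. x k) \<in> A (\<tau> i)} \<in> sets ?P"
      by (simp add: vimage_def Collect_conj_eq Int_commute)
  qed
  have E': "E' \<in> sets (PiM {m} (\<lambda>_. borel) :: (nat \<Rightarrow> real) measure)"
    using measurable_sets[OF measurable_component_singleton[of m "{m}" "\<lambda>_. borel"] D]
    by (simp add: E'_def vimage_def Collect_conj_eq Int_commute)
  define V where "V = (\<lambda>\<omega>. restrict (\<lambda>i. X i \<omega>) {..<m}) -` E \<inter> space M"
  have sp: "restrict (\<lambda>i. X i \<omega>) J \<in> space (PiM J (\<lambda>_. borel))" for J \<omega> by (simp add: space_PiM)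
  have V': "(\<lambda>\<omega>. restrict (\<lambda>i. X i \<omega>) {m}) -` E' \<inter> space M = (\<lambda>\<omega>. B t \<omega> - B s \<omega>) -` D \<inter> space M"
    using sp by (auto simp: E'_def Xm)
  have Vm: "V \<in> sets M"
    unfolding V_def by (rule measurable_sets[OF indep_var_rv1[OF iv] E])
  have Dm: "(\<lambda>\<omega>. B t \<omega> - B s \<omega>) -` D \<inter> space M \<in> sets M"
    unfolding V'[symmetric] by (rule measurable_sets[OF indep_var_rv2[OF iv] E'])
  have "prob (V \<inter> ((\<lambda>\<omega>. B t \<omega> - B s \<omega>) -` D \<inter> space M)) = prob V * prob ((\<lambda>\<omega>. B t \<omega> - B s \<omega>) -` D \<inter> space M)"
  proof -
    have "(\<lambda>\<omega>. (restrict (\<lambda>i. X i \<omega>) {..<m}, restrict (\<lambda>i. X i \<omega>) {m})) -` (E \<times> E') \<inter> space M = V \<inter> ((\<lambda>\<omega>. B t \<omega> - B s \<omega>) -` D \<inter> space M)"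
      unfolding V'[symmetric] V_def by auto
    with indep_varD[OF iv E E'] show ?thesis unfolding V' V_def by simp
  qed
  moreover have ae: "AE \<omega> in M. \<omega> \<in> cylinder M B R A \<longleftrightarrow> \<omega> \<in> V"
  proof -
    have "AE \<omega> in M. B 0 \<omega> = 0" using B by (simp add: standard_brownian_motion_def)
    then show ?thesis
    proof (eventually_elim)
      case (elim \<omega>)
      have sum: "(\<Sum>k<i. restrict (\<lambda>i. X i \<omega>) {..<m} k) = B (\<tau> i) \<omega>" if "i < m" for i
      proof -
        have "(\<Sum>k<i. restrict (\<lambda>i. X i \<omega>) {..<m} k) = (\<Sum>k<i. B (\<tau> (Suc k)) \<omega> - B (\<tau> k) \<omega>)"
          using that by (intro sum.cong) (auto simp: X_def)
        also have "\<dots> = B (\<tau> i) \<omega> - B (\<tau> 0) \<omega>" by (rule sum_lessThan_telescope)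
        finally show ?thesis using elim by (simp add: \<tau>0)
      qed
      have "(\<forall>r\<in>R. B r \<omega> \<in> A r) \<longleftrightarrow> (\<forall>i\<in>{i. i < m \<and> \<tau> i \<in> R}. B (\<tau> i) \<omega> \<in> A (\<tau> i))"
      proof (intro iffI ballI)
        fix r assume *: "\<forall>i\<in>{i. i < m \<and> \<tau> i \<in> R}. B (\<tau> i) \<omega> \<in> A (\<tau> i)" and r: "r \<in> R"
        then have "r \<in> set xs" using set_xs by simp
        then obtain i where "i < m" "xs ! i = r" by (metis in_set_conv_nth m_def)
        then have "i < m" "\<tau> i = r" by (auto simp: \<tau>_def)
        with * r show "B r \<omega> \<in> A r" by blast
      qed auto
      then show ?case using sp sum by (auto simp: cylinder_def V_def E_def)
    qed
  qed
  moreover have cm: "cylinder M B R A \<in> sets M" by (rule sets_cylinder[OF B R A])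
  ultimately have vd: "prob (V \<inter> ((\<lambda>\<omega>. B t \<omega> - B s \<omega>) -` D \<inter> space M)) = prob V * prob ((\<lambda>\<omega>. B t \<omega> - B s \<omega>) -` D \<inter> space M)"
    by simp
  have "prob (cylinder M B R A) = prob V"
    using ae by (intro measure_eq_AE cm Vm)
  moreover have "prob (cylinder M B R A \<inter> ((\<lambda>\<omega>. B t \<omega> - B s \<omega>) -` D \<inter> space M)) = prob (V \<inter> ((\<lambda>\<omega>. B t \<omega> - B s \<omega>) -` D \<inter> space M))"
    using ae by (intro measure_eq_AE sets.Int cm Vm Dm) auto
  ultimately show ?thesis using vd by simp
qed

text \<open>Cylinders over finitely many times up to \<open>s\<close> form an intersection-stable
  generator of the past, so the product formula extends to the generated \<sigma>-algebra.\<close>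

lemma past_increment_indep:
  assumes B: "standard_brownian_motion M B" and st: "0 \<le> s" "s \<le> t"
  shows "prob_space.indep_set M (sets (past M B s)) {(\<lambda>\<omega>. B t \<omega> - B s \<omega>) -` D \<inter> space M | D. D \<in> sets borel}"
proof -
  interpret prob_space M using B by (simp add: standard_brownian_motion_def)
  let ?G = "{cylinder M B R A | R A. finite R \<and> R \<subseteq> {0..s} \<and> (\<forall>r. A r \<in> sets borel)}"
  let ?D = "{(\<lambda>\<omega>. B t \<omega> - B s \<omega>) -` D \<inter> space M | D. D \<in> sets borel}"
  have dm: "(\<lambda>\<omega>. B t \<omega> - B s \<omega>) \<in> borel_measurable M"
    using brownian_measurable[OF B] st by (intro borel_measurable_diff) auto
  have "indep_set ?G ?D"
  proof (rule indep_setI)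
    show "?G \<subseteq> events" by (auto intro!: sets_cylinder[OF B])
    show "?D \<subseteq> events" using measurable_sets[OF dm] by auto
    show "prob (a \<inter> b) = prob a * prob b" if "a \<in> ?G" "b \<in> ?D" for a b
      using that cylinder_increment_indep[OF B st] by auto
  qed
  moreover have "Int_stable ?G"
    unfolding Int_stable_def
  proof (intro ballI)
    fix a b assume "a \<in> ?G" "b \<in> ?G"
    then obtain R A R' A' where a: "a = cylinder M B R A" "finite R" "R \<subseteq> {0..s}" "\<forall>r. A r \<in> sets borel"
      and b: "b = cylinder M B R' A'" "finite R'" "R' \<subseteq> {0..s}" "\<forall>r. A' r \<in> sets borel" by auto
    \<comment> \<open>A time that occurs in only one of the cylinders is left unconstrained by the
      other.\<close>
    have "a \<inter> b = cylinder M B (R \<union> R') (\<lambda>r. (if r \<in> R then A r else UNIV) \<inter> (if r \<in> R' then A' r else UNIV))"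
      unfolding a b cylinder_def by auto
    moreover have "(if r \<in> R then A r else UNIV) \<inter> (if r \<in> R' then A' r else UNIV) \<in> sets borel" for r
      using a b by auto
    ultimately show "a \<inter> b \<in> ?G" using a b by blast
  qed
  moreover have "Int_stable ?D" by (rule Int_stable_vimage)
  ultimately have ind: "indep_set (sigma_sets (space M) ?G) (sigma_sets (space M) ?D)"
    by (rule indep_set_sigma_sets)
  have sub: "sets (past M B s) \<subseteq> sigma_sets (space M) ?G"
    unfolding sets_past
  proof (rule sigma_sets_mono)
    show "{B r -` A \<inter> space M | r A. 0 \<le> r \<and> r \<le> s \<and> A \<in> sets borel} \<subseteq> sigma_sets (space M) ?G"
    proof safe
      fix r and A :: "real set" assume *: "0 \<le> r" "r \<le> s" "A \<in> sets borel"
      have "B r -` A \<inter> space M = cylinder M B {r} (\<lambda>_. A)" by (auto simp: cylinder_def)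
      with * show "B r -` A \<inter> space M \<in> sigma_sets (space M) ?G"
        by (intro sigma_sets.Basic) (auto intro!: exI[of _ "{r}"] exI[of _ "\<lambda>_. A"])
    qed
  qed
  have "?D \<subseteq> sigma_sets (space M) ?D" by (rule sigma_sets_superset_generator)
  with ind sub show ?thesis by (rule indep_set_mono)
qed

section \<open>Enlargement by the initial values\<close>

text \<open>The whole \<sigma>-algebra of the second factor is present from time 0 on, as the random
  initial values are known at the start.\<close>

definition enlarged_filtration :: "'a measure \<Rightarrow> (real \<Rightarrow> 'a \<Rightarrow> real) \<Rightarrow> 'b measure \<Rightarrow> real \<Rightarrow> ('a \<times> 'b) measure" where
  "enlarged_filtration M B N s = past M B s \<Otimes>\<^sub>M N"

lemma measurable_enlarged_filtration:
  "0 \<le> r \<Longrightarrow> r \<le> s \<Longrightarrow> (\<lambda>\<omega>. B r (fst \<omega>)) \<in> borel_measurable (enlarged_filtration M B N s)"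
  unfolding enlarged_filtration_def by (rule measurable_compose[OF measurable_fst measurable_past])

lemma space_enlarged_filtration[simp]: "space (enlarged_filtration M B N s) = space (M \<Otimes>\<^sub>M N)"
  by (simp add: enlarged_filtration_def space_pair_measure)

lemma sets_pair_measure_mono:
  assumes "space M = space M'" "sets M \<subseteq> sets M'"
  shows "sets (M \<Otimes>\<^sub>M N) \<subseteq> sets (M' \<Otimes>\<^sub>M N)"
  unfolding sets_pair_measure assms(1) using assms(2) by (intro sigma_sets_mono') blast

text \<open>The first projection maps the product measure to \<open>M\<close>, so all laws of
  functions of \<open>fst \<omega>\<close> are those on \<open>M\<close>; independence is
  transferred as a statement about joint laws.\<close>

lemma standard_brownian_motion_lift:
  assumes B: "standard_brownian_motion M B" and N: "prob_space N"
  shows "standard_brownian_motion (M \<Otimes>\<^sub>M N) (lift_process B)"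
proof -
  interpret M: prob_space M using B by (simp add: standard_brownian_motion_def)
  interpret N: prob_space N by fact
  interpret P: pair_prob_space M N ..
  note f = N.distr_pair_fst[of M]
  have distr: "distr (M \<Otimes>\<^sub>M N) K (\<lambda>\<omega>. g (fst \<omega>)) = distr M K g" if "g \<in> measurable M K" for K and g :: "'a \<Rightarrow> 'c"
    by (subst (2) f[symmetric], subst distr_distr) (use that in \<open>auto simp: o_def\<close>)
  show ?thesis
    unfolding standard_brownian_motion_def lift_process_def
  proof (intro conjI allI impI)
    show "prob_space (M \<Otimes>\<^sub>M N)" by (rule P.P.prob_space_axioms)
    fix x :: real assume "0 \<le> x"
    then show "(\<lambda>\<omega>. B x (fst \<omega>)) \<in> borel_measurable (M \<Otimes>\<^sub>M N)"
      using brownian_measurable[OF B] by measurable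
  next
    have "AE \<omega> in distr (M \<Otimes>\<^sub>M N) M fst. B 0 \<omega> = 0"
      unfolding f using B by (simp add: standard_brownian_motion_def)
    then show "AE \<omega> in M \<Otimes>\<^sub>M N. B 0 (fst \<omega>) = 0"
      by (rule AE_distrD[rotated]) simp
  next
    fix s t :: real assume st: "0 \<le> s \<and> s < t"
    then have d: "distributed M lborel (\<lambda>\<omega>. B t \<omega> - B s \<omega>) (normal_density 0 (sqrt (t - s)))"
      by (intro brownian_increment_distributed[OF B]) auto
    then have m: "(\<lambda>\<omega>. B t \<omega> - B s \<omega>) \<in> borel_measurable M" using distributed_measurable by force
    show "distributed (M \<Otimes>\<^sub>M N) lborel (\<lambda>\<omega>. B t (fst \<omega>) - B s (fst \<omega>)) (normal_density 0 (sqrt (t - s)))"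
      using d distr[of "\<lambda>\<omega>. B t \<omega> - B s \<omega>" lborel] m unfolding distributed_def by auto
  next
    fix k and t :: "nat \<Rightarrow> real" assume t: "0 \<le> t 0 \<and> (\<forall>i<k. t i \<le> t (Suc i))"
    define X where "X = (\<lambda>i \<omega>. B (t (Suc i)) \<omega> - B (t i) \<omega>)"
    have ind: "M.indep_vars (\<lambda>_. borel) X {..<k}"
      unfolding X_def using t by (intro brownian_increments_indep[OF B]) auto
    have Xm: "X i \<in> borel_measurable M" if "i \<in> {..<k}" for i using ind that unfolding M.indep_vars_def by blast
    have Xf: "(\<lambda>\<omega>. X i (fst \<omega>)) \<in> borel_measurable (M \<Otimes>\<^sub>M N)" if "i \<in> {..<k}" for i
      using Xm[OF that] by measurable
    have "P.indep_vars (\<lambda>_. borel) (\<lambda>i \<omega>. X i (fst \<omega>)) {..<k}"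
    \<comment> \<open>The description of independence by product laws used below is for nonempty
      index sets.\<close>
    proof (cases "k = 0")
      case True then show ?thesis by (simp add: P.indep_vars_def P.indep_sets_def)
    next
      case False
      then have ne: "{..<k} \<noteq> {}" by auto
      show ?thesis
      proof (subst P.P.indep_vars_iff_distr_eq_PiM'[OF ne Xf])
        have mm: "(\<lambda>x. \<lambda>i\<in>{..<k}. X i x) \<in> measurable M (PiM {..<k} (\<lambda>_. borel))"
          by (rule measurable_restrict) (rule Xm)
        have "distr (M \<Otimes>\<^sub>M N) (PiM {..<k} (\<lambda>_. borel)) (\<lambda>x. \<lambda>i\<in>{..<k}. X i (fst x)) = distr M (PiM {..<k} (\<lambda>_. borel)) (\<lambda>x. \<lambda>i\<in>{..<k}. X i x)"
          by (rule distr[OF mm])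
        also have "\<dots> = PiM {..<k} (\<lambda>i. distr M borel (X i))"
          using ind by (subst (asm) M.indep_vars_iff_distr_eq_PiM'[OF ne Xm]) auto
        also have "\<dots> = PiM {..<k} (\<lambda>i. distr (M \<Otimes>\<^sub>M N) borel (\<lambda>\<omega>. X i (fst \<omega>)))"
          by (intro PiM_cong refl distr[symmetric] Xm)
        finally show "distr (M \<Otimes>\<^sub>M N) (PiM {..<k} (\<lambda>_. borel)) (\<lambda>x. \<lambda>i\<in>{..<k}. X i (fst x)) = PiM {..<k} (\<lambda>i. distr (M \<Otimes>\<^sub>M N) borel (\<lambda>\<omega>. X i (fst \<omega>)))" .
      qed auto
    qed
    then show "P.indep_vars (\<lambda>_. borel) (\<lambda>i \<omega>. B (t (Suc i)) (fst \<omega>) - B (t i) (fst \<omega>)) {..<k}" by (simp add: X_def)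
  next
    show "continuous_paths (M \<Otimes>\<^sub>M N) (\<lambda>x \<omega>. B x (fst \<omega>))"
      using B by (auto simp: standard_brownian_motion_def continuous_paths_def space_pair_measure)
  qed
qed

text \<open>For rectangles the increment constrains the first factor only, so the product measure
  and \<open>past_increment_indep\<close> give the product formula; rectangles are
  intersection-stable and generate the filtration.\<close>

lemma brownian_motion_wrt_enlarged_filtration:
  assumes B: "standard_brownian_motion M B" and N: "prob_space N"
  shows "brownian_motion_wrt (M \<Otimes>\<^sub>M N) (enlarged_filtration M B N) (lift_process B)"
proof -
  interpret M: prob_space M using B by (simp add: standard_brownian_motion_def)
  interpret N: prob_space N by fact
  interpret P: pair_prob_space M N ..
  have sub: "sets (enlarged_filtration M B N s) \<subseteq> sets (M \<Otimes>\<^sub>M N)" for s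
    unfolding enlarged_filtration_def by (rule sets_pair_measure_mono) (auto intro: sets_past_subset[OF B, THEN subsetD])
  show ?thesis
    unfolding brownian_motion_wrt_def
  proof (intro conjI allI impI)
    show "standard_brownian_motion (M \<Otimes>\<^sub>M N) (lift_process B)" by (rule standard_brownian_motion_lift[OF B N])
    show "filtration (space (M \<Otimes>\<^sub>M N)) (enlarged_filtration M B N)"
    proof (rule filtration.intro)
      fix i j :: real assume "i \<le> j"
      then show "sets (enlarged_filtration M B N i) \<subseteq> sets (enlarged_filtration M B N j)"
        unfolding enlarged_filtration_def by (intro sets_pair_measure_mono sets_past_mono) simp_all
    qed simp
    show "subalgebra (M \<Otimes>\<^sub>M N) (enlarged_filtration M B N x)" for x
      using sub by (simp add: subalgebra_def)
    show "adapted (enlarged_filtration M B N) (lift_process B)"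
      unfolding adapted_def lift_process_def by (intro allI impI measurable_enlarged_filtration) auto
    fix s t :: real assume "0 \<le> s \<and> s \<le> t"
    then have st: "0 \<le> s" "s \<le> t" by auto
    let ?R = "{a \<times> b | a b. a \<in> sets (past M B s) \<and> b \<in> sets N}"
    let ?D = "{(\<lambda>\<omega>. lift_process B t \<omega> - lift_process B s \<omega>) -` A \<inter> space (M \<Otimes>\<^sub>M N) | A. A \<in> sets borel}"
    have dm: "(\<lambda>\<omega>. lift_process B t \<omega> - lift_process B s \<omega>) \<in> borel_measurable (M \<Otimes>\<^sub>M N)"
      using brownian_measurable[OF standard_brownian_motion_lift[OF B N]] st by (intro borel_measurable_diff) auto
    have dm0: "(\<lambda>\<omega>. B t \<omega> - B s \<omega>) \<in> borel_measurable M"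
      using brownian_measurable[OF B] st by (intro borel_measurable_diff) auto
    have "P.indep_set ?R ?D"
    proof (rule P.P.indep_setI)
      show "?R \<subseteq> sets (M \<Otimes>\<^sub>M N)" using sets_past_subset[OF B] by auto
      show "?D \<subseteq> sets (M \<Otimes>\<^sub>M N)" using measurable_sets[OF dm] by auto
      fix x y assume "x \<in> ?R" "y \<in> ?D"
      then obtain a b A where x: "x = a \<times> b" "a \<in> sets (past M B s)" "b \<in> sets N"
        and y: "y = (\<lambda>\<omega>. lift_process B t \<omega> - lift_process B s \<omega>) -` A \<inter> space (M \<Otimes>\<^sub>M N)" "A \<in> sets borel" by auto
      define d where "d = (\<lambda>\<omega>. B t \<omega> - B s \<omega>) -` A \<inter> space M"
      have d: "d \<in> sets M" using measurable_sets[OF dm0 y(2)] by (simp add: d_def)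
      have a: "a \<in> sets M" using x sets_past_subset[OF B] by auto
      have y': "y = d \<times> space N" using y by (auto simp: d_def lift_process_def space_pair_measure)
      have xy: "x \<inter> y = (a \<inter> d) \<times> b" using x sets.sets_into_space by (fastforce simp: y')
      have ind: "measure M (a \<inter> d) = measure M a * measure M d"
        by (rule M.indep_setD[OF past_increment_indep[OF B st] x(2)]) (use y in \<open>auto simp: d_def\<close>)
      have times: "measure (M \<Otimes>\<^sub>M N) (a \<times> b) = measure M a * measure N b" if "a \<in> sets M" "b \<in> sets N" for a b
        using that by (simp add: measure_def N.emeasure_pair_measure_Times enn2real_mult)
      show "P.prob (x \<inter> y) = P.prob x * P.prob y"
        unfolding xy unfolding x(1) y' using a d x(3) ind by (simp add: times N.prob_space)
    qed
    moreover have "Int_stable ?R" by (rule Int_stable_pair_measure_generator)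
    moreover have "Int_stable ?D" by (rule Int_stable_vimage)
    ultimately have ind: "P.indep_set (sigma_sets (space (M \<Otimes>\<^sub>M N)) ?R) (sigma_sets (space (M \<Otimes>\<^sub>M N)) ?D)"
      by (rule P.P.indep_set_sigma_sets)
    have "sets (enlarged_filtration M B N s) = sigma_sets (space (M \<Otimes>\<^sub>M N)) ?R"
      by (simp add: enlarged_filtration_def sets_pair_measure space_pair_measure)
    moreover have "?D \<subseteq> sigma_sets (space (M \<Otimes>\<^sub>M N)) ?D" by (rule sigma_sets_superset_generator)
    ultimately show "P.indep_set (sets (enlarged_filtration M B N s)) ?D"
      by (intro P.P.indep_set_mono[OF ind]) simp_all
  qed
qed

section \<open>Stratonovich integrals\<close>

lemma partition_mono:
  assumes "is_partition x k t" "i \<le> j" "j \<le> k"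
  shows "t i \<le> t j"
  using assms(2,3)
proof (induction j rule: dec_induct)
  case (step m)
  then have "t m \<le> t (Suc m)" using assms(1) by (simp add: is_partition_def)
  with step show ?case by simp
qed simp

lemma partition_mem:
  assumes "is_partition x k t" "i \<le> k"
  shows "t i \<in> {0..x}"
  using partition_mono[OF assms(1), of 0 i] partition_mono[OF assms(1), of i k] assms by (auto simp: is_partition_def)

lemma partition_sum: "is_partition x k t \<Longrightarrow> (\<Sum>i<k. f (t (Suc i)) - f (t i)) = f x - (f 0 :: real)"
  using sum_lessThan_telescope[of "\<lambda>i. f (t i)" k] by (simp add: is_partition_def)

lemma partition_integral_sum:
  fixes f :: "real \<Rightarrow> real"
  assumes p: "is_partition x k t" and f: "continuous_on {0..x} f"
  shows "(\<Sum>i<k. integral {t i..t (Suc i)} f) = integral {0..x} f"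
proof -
  have split: "integral {t i..t (Suc i)} f = integral {0..t (Suc i)} f - integral {0..t i} f" if "i < k" for i
  proof -
    have m: "t i \<in> {0..x}" "t (Suc i) \<in> {0..x}" "t i \<le> t (Suc i)"
      using partition_mem[OF p, of i] partition_mem[OF p, of "Suc i"] partition_mono[OF p, of i "Suc i"] that by auto
    have "f integrable_on {0..t (Suc i)}"
      using m by (intro integrable_continuous_real continuous_on_subset[OF f]) auto
    from Henstock_Kurzweil_Integration.integral_combine[of 0 "t i" "t (Suc i)" f, OF _ _ this] m show ?thesis by simp
  qed
  have "(\<Sum>i<k. integral {t i..t (Suc i)} f) = (\<Sum>i<k. integral {0..t (Suc i)} f - integral {0..t i} f)"
    using split by (intro sum.cong) auto
  also have "\<dots> = integral {0..x} f" using partition_sum[OF p, of "\<lambda>s. integral {0..s} f"] by simp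
  finally show ?thesis .
qed

text \<open>The trapezoidal rule is exact for affine functions, so its error for \<open>exp\<close>
  is cubic in the step: the error \<open>f\<close> vanishes at \<open>a\<close> and
  \<open>f'\<close> is quadratically small. This is why quadratic variation leaves no trace in
  Stratonovich sums.\<close>

lemma trapezoid_exp:
  fixes a b :: real
  shows "\<bar>(exp a + exp b) / 2 * (b - a) - (exp b - exp a)\<bar> \<le> \<bar>b - a\<bar> ^ 3 * (exp a + exp b)"
proof -
  have *: "\<bar>(exp a + exp b) / 2 * (b - a) - (exp b - exp a)\<bar> \<le> (b - a) ^ 3 * (exp a + exp b)" if "a < b" for a b :: real
  proof -
    define f where "f = (\<lambda>y. (exp a + exp y) / 2 * (y - a) - (exp y - exp a))"
    define f' where "f' = (\<lambda>y. (exp a + exp y) / 2 + exp y / 2 * (y - a) - exp y)"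
    have "\<exists>z. a < z \<and> z < b \<and> f b - f a = (b - a) * f' z"
      by (rule MVT2[OF that]) (auto simp: f_def f'_def intro!: derivative_eq_intros)
    then obtain z where z: "a < z" "z < b" "f b - f a = (b - a) * f' z" by blast
    have e: "0 \<le> exp z - exp a" "exp z - exp a \<le> (z - a) * exp z" "(z - a) * exp a \<le> exp z - exp a"
    proof -
      show "0 \<le> exp z - exp a" using z by simp
      have "exp z * (1 + (a - z)) \<le> exp z * exp (a - z)" by simp
      then show "exp z - exp a \<le> (z - a) * exp z" by (simp add: algebra_simps flip: exp_add)
      have "exp a * (1 + (z - a)) \<le> exp a * exp (z - a)" by simp
      then show "(z - a) * exp a \<le> exp z - exp a" by (simp add: algebra_simps flip: exp_add)
    qed
    have eq: "2 * f' z = (z - a) * exp z - (exp z - exp a)" by (simp add: f'_def field_simps)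
    have "0 \<le> 2 * f' z" unfolding eq using e by simp
    moreover have "2 * f' z \<le> (z - a) * exp z - (z - a) * exp a" unfolding eq using e by simp
    moreover have "(z - a) * exp z - (z - a) * exp a \<le> (z - a) * ((z - a) * exp z)"
      using e z by (simp only: right_diff_distrib[symmetric]) (intro mult_left_mono, auto)
    moreover have "(z - a) * ((z - a) * exp z) \<le> (b - a) * ((b - a) * exp b)"
      using z by (intro mult_mono) auto
    ultimately have f': "0 \<le> f' z" "f' z \<le> (b - a)\<^sup>2 * exp b"
      by (simp_all add: power2_eq_square mult.assoc)
    have "f a = 0" by (simp add: f_def)
    then have "f b = (b - a) * f' z" using z by simp
    then have "\<bar>f b\<bar> = (b - a) * f' z" using f' that by simp
    also have "\<dots> \<le> (b - a) * ((b - a)\<^sup>2 * exp b)" using f' that by (intro mult_left_mono) auto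
    also have "\<dots> = (b - a) ^ 3 * exp b" by (simp add: power3_eq_cube power2_eq_square)
    also have "\<dots> \<le> (b - a) ^ 3 * (exp a + exp b)" using that by (intro mult_left_mono) auto
    finally show ?thesis by (simp add: f_def)
  qed
  consider "a < b" | "a = b" | "b < a" by linarith
  then show ?thesis
  proof cases
    case 1 then show ?thesis using *[OF 1] by simp
  next
    case 3
    have "(exp b + exp a) / 2 * (a - b) - (exp a - exp b) = - ((exp a + exp b) / 2 * (b - a) - (exp b - exp a))"
      by (simp add: field_simps)
    then show ?thesis using *[OF 3] 3 by (simp add: abs_minus_commute add.commute)
  qed simp
qed

text \<open>
  Since \<open>d (ln U) = - U dx - 2 dY\<close>, the trapezoidal sums telescope up to the cubic variation of \<open>ln U\<close>.
\<close>

lemma trapezoidal_sum_converges: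
  fixes L Y :: "real \<Rightarrow> real"
  assumes x: "x \<ge> 0" and L: "continuous_on {0..x} L"
    and Y: "\<And>s t. 0 \<le> s \<Longrightarrow> s \<le> t \<Longrightarrow> t \<le> x \<Longrightarrow> Y t - Y s = - (L t - L s) / 2 - integral {s..t} (\<lambda>r. exp (L r)) / 2"
    and \<epsilon>: "\<epsilon> > 0"
  shows "\<exists>\<delta>>0. \<forall>k t. is_partition x k t \<and> (\<forall>i<k. t (Suc i) - t i < \<delta>) \<and> (\<Sum>i<k. \<bar>L (t (Suc i)) - L (t i)\<bar> ^ 3) < \<delta> \<longrightarrow>
    \<bar>(\<Sum>i<k. (exp (L (t i)) + exp (L (t (Suc i)))) / 2 * (Y (t (Suc i)) - Y (t i)))
      - (exp (L 0) - exp (L x) - integral {0..x} (\<lambda>r. (exp (L r))\<^sup>2)) / 2\<bar> < \<epsilon>"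
proof -
  define U where "U = (\<lambda>r. exp (L r))"
  have U: "continuous_on {0..x} U" unfolding U_def by (intro continuous_intros L)
  have "bounded (U ` {0..x})" using compact_imp_bounded[OF compact_continuous_image[OF U]] by simp
  then obtain R0 where "\<forall>y\<in>U ` {0..x}. norm y \<le> R0" unfolding bounded_iff by blast
  then have R0: "\<And>r. r \<in> {0..x} \<Longrightarrow> \<bar>U r\<bar> \<le> R0" by simp
  define R where "R = max 1 R0"
  have R: "\<And>r. r \<in> {0..x} \<Longrightarrow> U r \<le> R" "R \<ge> 1" using R0 unfolding R_def by (fastforce simp: abs_le_iff)+
  \<comment> \<open>The modulus of continuity for the error \<open>C\<close>, which is at most
    \<open>e * (R * x)\<close>; adding 1 keeps the denominator positive when
    \<open>x = 0\<close>.\<close>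
  define e where "e = \<epsilon> / (2 * (R * x + 1))"
  have e: "e > 0" using \<epsilon> R x by (simp add: e_def add_nonneg_pos)
  have "uniformly_continuous_on {0..x} U" by (intro compact_uniformly_continuous U) auto
  then obtain \<delta>1 where \<delta>1: "\<delta>1 > 0" "\<And>r s. r \<in> {0..x} \<Longrightarrow> s \<in> {0..x} \<Longrightarrow> \<bar>s - r\<bar> < \<delta>1 \<Longrightarrow> \<bar>U s - U r\<bar> < e"
    using e unfolding uniformly_continuous_on_def dist_real_def by metis
  \<comment> \<open>The second entry makes the cubic variation, multiplied by the bound
    \<open>2 * R\<close> on the sum of the two endpoint values, smaller than \<epsilon>.\<close>
  define \<delta> where "\<delta> = min \<delta>1 (\<epsilon> / (2 * R))"
  have \<delta>: "\<delta> > 0" using \<delta>1 \<epsilon> R by (simp add: \<delta>_def)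
  show ?thesis
  proof (intro exI[of _ \<delta>] conjI \<delta> allI impI)
    fix k t assume *: "is_partition x k t \<and> (\<forall>i<k. t (Suc i) - t i < \<delta>) \<and> (\<Sum>i<k. \<bar>L (t (Suc i)) - L (t i)\<bar> ^ 3) < \<delta>"
    then have p: "is_partition x k t" by simp
    have mem: "t i \<in> {0..x}" "t (Suc i) \<in> {0..x}" "t i \<le> t (Suc i)" "t (Suc i) - t i < \<delta>1" if "i < k" for i
      using partition_mem[OF p, of i] partition_mem[OF p, of "Suc i"] partition_mono[OF p, of i "Suc i"] that * by (auto simp: \<delta>_def)
    let ?I = "\<lambda>i. integral {t i..t (Suc i)} U" and ?q = "\<lambda>i. integral {t i..t (Suc i)} (\<lambda>r. (U r)\<^sup>2)"
      and ?m = "\<lambda>i. (U (t i) + U (t (Suc i))) / 2" and ?dL = "\<lambda>i. L (t (Suc i)) - L (t i)"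
      and ?dU = "\<lambda>i. U (t (Suc i)) - U (t i)" and ?dY = "\<lambda>i. Y (t (Suc i)) - Y (t i)"
    \<comment> \<open>\<open>A\<close> is the error of the trapezoidal rule for d exp(L), and
      \<open>C\<close> the error of replacing the mean of the endpoint values by U under the
      integral of U.\<close>
    define A where "A = (\<Sum>i<k. ?m i * ?dL i - ?dU i)"
    define C where "C = (\<Sum>i<k. ?m i * ?I i - ?q i)"
    have "(\<Sum>i<k. ?m i * ?dY i)
      = (\<Sum>i<k. - ((?m i * ?dL i - ?dU i) / 2)
        - (?m i * ?I i - ?q i) / 2
        - ?dU i / 2 - ?q i / 2)"
    proof (intro sum.cong refl)
      fix i assume "i \<in> {..<k}"
      then have Yi: "?dY i = - ?dL i / 2 - ?I i / 2"
        using mem[of i] Y[of "t i" "t (Suc i)"] by (simp add: U_def)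
      show "?m i * ?dY i =
        - ((?m i * ?dL i - ?dU i) / 2)
        - (?m i * ?I i - ?q i) / 2
        - ?dU i / 2 - ?q i / 2"
        unfolding Yi by (simp add: field_simps)
    qed
    also have "\<dots> = - (A / 2) - C / 2 - (U x - U 0) / 2 - integral {0..x} (\<lambda>r. (U r)\<^sup>2) / 2"
    proof -
      have "(\<Sum>i<k. - (a i / 2) - c i / 2 - d i / 2 - q i / 2) =
          - ((\<Sum>i<k. a i) / 2) - (\<Sum>i<k. c i) / 2 - (\<Sum>i<k. d i) / 2 - (\<Sum>i<k. q i) / 2" for a c d q :: "nat \<Rightarrow> real"
        by (simp add: sum_subtractf sum_negf sum_divide_distrib)
      moreover have "(\<Sum>i<k. ?q i) = integral {0..x} (\<lambda>r. (U r)\<^sup>2)"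
        by (rule partition_integral_sum[OF p]) (intro continuous_intros U)
      ultimately show ?thesis unfolding A_def C_def partition_sum[OF p, of U, symmetric] by (simp only:)
    qed
    finally have eq: "(\<Sum>i<k. ?m i * ?dY i)
        - (U 0 - U x - integral {0..x} (\<lambda>r. (U r)\<^sup>2)) / 2 = - (A / 2) - C / 2" by (simp add: field_simps)
    have "\<bar>A\<bar> \<le> (\<Sum>i<k. \<bar>?dL i\<bar> ^ 3 * (2 * R))"
      unfolding A_def
    proof (rule order_trans[OF sum_abs], rule sum_mono)
      fix i assume "i \<in> {..<k}"
      then have i: "i < k" by simp
      have "\<bar>?m i * ?dL i - ?dU i\<bar>
        \<le> \<bar>?dL i\<bar> ^ 3 * (U (t i) + U (t (Suc i)))"
        unfolding U_def by (rule trapezoid_exp)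
      also have "\<dots> \<le> \<bar>?dL i\<bar> ^ 3 * (2 * R)"
        using R(1)[OF mem(1)[OF i]] R(1)[OF mem(2)[OF i]] by (intro mult_left_mono) auto
      finally show "\<bar>?m i * ?dL i - ?dU i\<bar>
        \<le> \<bar>?dL i\<bar> ^ 3 * (2 * R)" .
    qed
    also have "\<dots> = (\<Sum>i<k. \<bar>?dL i\<bar> ^ 3) * (2 * R)" by (simp add: sum_distrib_right)
    also have "\<dots> < (\<epsilon> / (2 * R)) * (2 * R)"
      using * R by (intro mult_strict_right_mono) (auto simp: \<delta>_def)
    finally have A: "\<bar>A\<bar> < \<epsilon>" using R by simp
    have "\<bar>C\<bar> \<le> (\<Sum>i<k. e * ?I i)"
      unfolding C_def
    proof (rule order_trans[OF sum_abs], rule sum_mono)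
      fix i assume "i \<in> {..<k}"
      then have i: "i < k" by simp
      define c where "c = ?m i"
      have cont: "continuous_on {t i..t (Suc i)} U" using mem[OF i] by (intro continuous_on_subset[OF U]) auto
      have int: "(\<lambda>r. c * U r) integrable_on {t i..t (Suc i)}" "(\<lambda>r. (U r)\<^sup>2) integrable_on {t i..t (Suc i)}"
          "(\<lambda>r. e * U r) integrable_on {t i..t (Suc i)}"
        by (intro integrable_continuous_real continuous_intros cont)+
      have "c * ?I i - ?q i = integral {t i..t (Suc i)} (\<lambda>r. c * U r - (U r)\<^sup>2)"
        using int by (simp add: Henstock_Kurzweil_Integration.integral_diff)
      also have "\<bar>\<dots>\<bar> \<le> integral {t i..t (Suc i)} (\<lambda>r. e * U r)"
        unfolding real_norm_def[symmetric]
      proof (rule integral_norm_bound_integral)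
        fix r assume r: "r \<in> {t i..t (Suc i)}"
        then have rx: "r \<in> {0..x}" "\<bar>r - t i\<bar> < \<delta>1" "\<bar>r - t (Suc i)\<bar> < \<delta>1" using mem[OF i] by auto
        have "\<bar>U r - U (t i)\<bar> < e" "\<bar>U r - U (t (Suc i))\<bar> < e"
          using rx mem[OF i] by (auto intro!: \<delta>1(2))
        then have "\<bar>c - U r\<bar> \<le> e" unfolding c_def by (simp add: abs_less_iff abs_le_iff field_simps)
        then have "\<bar>c - U r\<bar> * U r \<le> e * U r" by (intro mult_right_mono) (auto simp: U_def)
        moreover have "c * U r - (U r)\<^sup>2 = (c - U r) * U r" by (simp add: power2_eq_square algebra_simps)
        ultimately show "norm (c * U r - (U r)\<^sup>2) \<le> e * U r" by (simp add: abs_mult U_def)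
      qed (use int in \<open>auto intro: Henstock_Kurzweil_Integration.integrable_diff\<close>)
      finally show "\<bar>?m i * ?I i - ?q i\<bar> \<le> e * ?I i"
        by (simp add: c_def)
    qed
    also have "\<dots> = e * integral {0..x} U" by (simp add: sum_distrib_left[symmetric] partition_integral_sum[OF p U])
    also have "integral {0..x} U \<le> integral {0..x} (\<lambda>_. R)"
      using R U by (intro integral_le integrable_continuous_real) auto
    also have "integral {0..x} (\<lambda>_. R) = R * x" using x by simp
    finally have "\<bar>C\<bar> \<le> e * (R * x)" using e by (simp add: mult_left_mono)
    also have "\<dots> < \<epsilon>"
    proof -
      have Rx: "R * x \<ge> 0" using R x by simp
      then have "e * (R * x) \<le> e * (R * x + 1)" using e by (intro mult_left_mono) auto
      also have "\<dots> = \<epsilon> / 2" using Rx by (simp add: e_def field_simps)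
      also have "\<dots> < \<epsilon>" using \<epsilon> by simp
      finally show ?thesis .
    qed
    finally have C: "\<bar>C\<bar> < \<epsilon>" .
    have "\<bar>- (A / 2) - C / 2\<bar> < \<epsilon>" using A C by (simp add: abs_less_iff)
    then show "\<bar>(\<Sum>i<k. (exp (L (t i)) + exp (L (t (Suc i)))) / 2 * (Y (t (Suc i)) - Y (t i)))
      - (exp (L 0) - exp (L x) - integral {0..x} (\<lambda>r. (exp (L r))\<^sup>2)) / 2\<bar> < \<epsilon>"
      using eq by (simp add: U_def)
  qed
qed

section \<open>Cubic variation of Brownian paths and limits in probability\<close>

text \<open>By scaling, the third absolute moment of an increment over a time d is c d sqrt d, with
  c that of a standard normal variable. One factor sqrt d is bounded by the mesh; the remaining
  lengths add up to x.\<close>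

lemma brownian_cubic_variation:
  assumes B: "standard_brownian_motion M B"
  shows "\<exists>c\<ge>0. \<forall>x k t \<delta>. is_partition x k t \<longrightarrow> (\<forall>i<k. t (Suc i) - t i < \<delta>) \<longrightarrow>
     (\<integral>\<^sup>+\<omega>. ennreal (\<Sum>i<k. \<bar>B (t (Suc i)) \<omega> - B (t i) \<omega>\<bar> ^ 3) \<partial>M) \<le> ennreal (c * x * sqrt \<delta>)"
proof -
  interpret prob_space M using B by (simp add: standard_brownian_motion_def)
  define c where "c = (\<integral>z. std_normal_density z * \<bar>z\<bar> ^ 3 \<partial>lborel)"
  have c: "c \<ge> 0" unfolding c_def by (intro Bochner_Integration.integral_nonneg) auto
  have c3: "(\<integral>\<^sup>+z. ennreal (std_normal_density z * \<bar>z\<bar> ^ 3) \<partial>lborel) = ennreal c"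
    unfolding c_def by (rule nn_integral_eq_integral) (auto intro: integrable_std_normal_moment_abs)
  have one: "(\<integral>\<^sup>+\<omega>. ennreal (\<bar>B t \<omega> - B s \<omega>\<bar> ^ 3) \<partial>M) \<le> ennreal (c * (t - s) * sqrt (t - s))" if st: "0 \<le> s" "s \<le> t" for s t
  proof (cases "s = t")
    case False
    with st have h: "t - s > 0" by simp
    have d: "distributed M lborel (\<lambda>\<omega>. (B t \<omega> - B s \<omega>) / sqrt (t - s)) std_normal_density"
      using brownian_increment_distributed[OF B, of s t] st False h
        normal_standard_normal_convert[of "sqrt (t - s)" "\<lambda>\<omega>. B t \<omega> - B s \<omega>" 0] by simp
    have "(\<integral>\<^sup>+\<omega>. ennreal (\<bar>B t \<omega> - B s \<omega>\<bar> ^ 3) \<partial>M) = (\<integral>\<^sup>+\<omega>. ennreal ((t - s) * sqrt (t - s)) * ennreal (\<bar>(B t \<omega> - B s \<omega>) / sqrt (t - s)\<bar> ^ 3) \<partial>M)"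
    proof (intro nn_integral_cong)
      fix \<omega>
      define \<zeta> where "\<zeta> = (B t \<omega> - B s \<omega>) / sqrt (t - s)"
      have "B t \<omega> - B s \<omega> = sqrt (t - s) * \<zeta>" using h by (simp add: \<zeta>_def)
      moreover have "sqrt (t - s) ^ 3 = (t - s) * sqrt (t - s)" using h by (simp add: power3_eq_cube)
      ultimately have "\<bar>B t \<omega> - B s \<omega>\<bar> ^ 3 = (t - s) * sqrt (t - s) * \<bar>\<zeta>\<bar> ^ 3"
        using h by (simp add: abs_mult power_mult_distrib)
      then show "ennreal (\<bar>B t \<omega> - B s \<omega>\<bar> ^ 3) = ennreal ((t - s) * sqrt (t - s)) * ennreal (\<bar>(B t \<omega> - B s \<omega>) / sqrt (t - s)\<bar> ^ 3)"
        using h by (simp add: \<zeta>_def ennreal_mult')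
    qed
    also have "\<dots> = ennreal ((t - s) * sqrt (t - s)) * (\<integral>\<^sup>+\<omega>. ennreal (\<bar>(B t \<omega> - B s \<omega>) / sqrt (t - s)\<bar> ^ 3) \<partial>M)"
    proof (rule nn_integral_cmult)
      have [measurable]: "B t \<in> borel_measurable M" "B s \<in> borel_measurable M"
        using st by (auto intro: brownian_measurable[OF B])
      show "(\<lambda>\<omega>. ennreal (\<bar>(B t \<omega> - B s \<omega>) / sqrt (t - s)\<bar> ^ 3)) \<in> borel_measurable M" by measurable
    qed
    also have "(\<integral>\<^sup>+\<omega>. ennreal (\<bar>(B t \<omega> - B s \<omega>) / sqrt (t - s)\<bar> ^ 3) \<partial>M) = (\<integral>\<^sup>+z. ennreal (std_normal_density z) * ennreal (\<bar>z\<bar> ^ 3) \<partial>lborel)"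
      by (rule distributed_nn_integral[OF d, symmetric]) auto
    also have "\<dots> = ennreal c" using c3 by (simp add: ennreal_mult')
    also have "ennreal ((t - s) * sqrt (t - s)) * ennreal c = ennreal (c * (t - s) * sqrt (t - s))"
      using h c by (simp add: ennreal_mult'[symmetric] mult_ac)
    finally show ?thesis by simp
  qed simp
  show ?thesis
  proof (intro exI[of _ c] conjI c allI impI)
    fix x k t \<delta> assume p: "is_partition x k t" and "\<forall>i<k. t (Suc i) - t i < \<delta>"
    then have \<delta>: "\<And>i. i < k \<Longrightarrow> t (Suc i) - t i < \<delta>" by simp
    have mem: "0 \<le> t i" "t i \<le> t (Suc i)" "0 \<le> t (Suc i)" if "i < k" for i
      using partition_mem[OF p, of i] partition_mem[OF p, of "Suc i"] partition_mono[OF p, of i "Suc i"] that by auto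
    have "(\<integral>\<^sup>+\<omega>. ennreal (\<Sum>i<k. \<bar>B (t (Suc i)) \<omega> - B (t i) \<omega>\<bar> ^ 3) \<partial>M) = (\<Sum>i<k. \<integral>\<^sup>+\<omega>. ennreal (\<bar>B (t (Suc i)) \<omega> - B (t i) \<omega>\<bar> ^ 3) \<partial>M)"
    proof (subst nn_integral_sum[symmetric])
      fix i assume "i \<in> {..<k}"
      then have "B (t (Suc i)) \<in> borel_measurable M" "B (t i) \<in> borel_measurable M" using mem[of i] by (auto intro: brownian_measurable[OF B])
      then show "(\<lambda>\<omega>. ennreal (\<bar>B (t (Suc i)) \<omega> - B (t i) \<omega>\<bar> ^ 3)) \<in> borel_measurable M" by measurable
    qed (simp add: sum_ennreal)
    also have "\<dots> \<le> (\<Sum>i<k. ennreal (c * sqrt \<delta> * (t (Suc i) - t i)))"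
    proof (intro sum_mono)
      fix i assume "i \<in> {..<k}"
      then have i: "i < k" by simp
      have "(\<integral>\<^sup>+\<omega>. ennreal (\<bar>B (t (Suc i)) \<omega> - B (t i) \<omega>\<bar> ^ 3) \<partial>M) \<le> ennreal (c * (t (Suc i) - t i) * sqrt (t (Suc i) - t i))"
        using mem[OF i] by (intro one) auto
      also have "\<dots> \<le> ennreal (c * sqrt \<delta> * (t (Suc i) - t i))"
      proof (rule ennreal_leI)
        have "c * (t (Suc i) - t i) * sqrt (t (Suc i) - t i) \<le> c * (t (Suc i) - t i) * sqrt \<delta>"
          using mem[OF i] \<delta>[OF i] c by (intro mult_left_mono) auto
        then show "c * (t (Suc i) - t i) * sqrt (t (Suc i) - t i) \<le> c * sqrt \<delta> * (t (Suc i) - t i)" by (simp add: mult_ac)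
      qed
      finally show "(\<integral>\<^sup>+\<omega>. ennreal (\<bar>B (t (Suc i)) \<omega> - B (t i) \<omega>\<bar> ^ 3) \<partial>M) \<le> ennreal (c * sqrt \<delta> * (t (Suc i) - t i))" .
    qed
    also have "\<dots> = ennreal (\<Sum>i<k. c * sqrt \<delta> * (t (Suc i) - t i))"
    proof (rule sum_ennreal)
      fix i assume "i \<in> {..<k}"
      then have "0 \<le> t (Suc i) - t i" "t (Suc i) - t i < \<delta>" using mem[of i] \<delta>[of i] by auto
      then show "0 \<le> c * sqrt \<delta> * (t (Suc i) - t i)" using c by simp
    qed
    also have "(\<Sum>i<k. c * sqrt \<delta> * (t (Suc i) - t i)) = c * x * sqrt \<delta>"
      using partition_sum[OF p, of "\<lambda>s. s"] by (simp add: sum_distrib_left[symmetric] mult_ac)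
    finally show "(\<integral>\<^sup>+\<omega>. ennreal (\<Sum>i<k. \<bar>B (t (Suc i)) \<omega> - B (t i) \<omega>\<bar> ^ 3) \<partial>M) \<le> ennreal (c * x * sqrt \<delta>)" .
  qed
qed

text \<open>
  By contradiction: along partitions with mesh below \<open>16\<^sup>-\<^sup>m\<close> the cubic variation of \<open>B\<close> tends to 0
  almost surely, because its expectations are summable.
\<close>

lemma brownian_limit_in_probability:
  assumes B: "standard_brownian_motion M B"
    and S: "\<And>k t. is_partition x k t \<Longrightarrow> S k t \<in> borel_measurable M" and J: "J \<in> borel_measurable M"
    and path: "\<And>\<omega> \<epsilon>. \<omega> \<in> space M \<Longrightarrow> \<epsilon> > 0 \<Longrightarrow> \<exists>\<delta>>0. \<forall>k t. is_partition x k t \<and> (\<forall>i<k. t (Suc i) - t i < \<delta>) \<and>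
        (\<Sum>i<k. \<bar>B (t (Suc i)) \<omega> - B (t i) \<omega>\<bar> ^ 3) < \<delta> \<longrightarrow> \<bar>S k t \<omega> - J \<omega>\<bar> < \<epsilon>"
    and \<epsilon>: "\<epsilon> > (0::real)"
  shows "\<exists>\<delta>>0. \<forall>k t. is_partition x k t \<and> (\<forall>i<k. t (Suc i) - t i < \<delta>) \<longrightarrow>
        measure M {\<omega> \<in> space M. \<bar>S k t \<omega> - J \<omega>\<bar> > \<epsilon>} < \<epsilon>"
proof (rule ccontr)
  interpret prob_space M using B by (simp add: standard_brownian_motion_def)
  assume neg: "\<not> ?thesis"
  define R where "R m p \<longleftrightarrow> is_partition x (fst p) (snd p) \<and> (\<forall>i<fst p. snd p (Suc i) - snd p i < (1/16) ^ m) \<and>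
      \<not> measure M {\<omega> \<in> space M. \<bar>S (fst p) (snd p) \<omega> - J \<omega>\<bar> > \<epsilon>} < \<epsilon>" for m :: nat and p
  have "\<exists>p. R m p" for m
  proof -
    have "(1/16::real) ^ m > 0" by simp
    with neg have "\<not> (\<forall>k t. is_partition x k t \<and> (\<forall>i<k. t (Suc i) - t i < (1/16) ^ m) \<longrightarrow>
        measure M {\<omega> \<in> space M. \<bar>S k t \<omega> - J \<omega>\<bar> > \<epsilon>} < \<epsilon>)" by blast
    then show ?thesis unfolding R_def by fastforce
  qed
  then have "\<exists>p. \<forall>m. R m (p m)" by (intro choice allI)
  then obtain p where p: "\<forall>m. R m (p m)" ..
  define k t where "k = (\<lambda>m. fst (p m))" and "t = (\<lambda>m. snd (p m))"
  have kt: "\<And>m::nat. is_partition x (k m) (t m)" "\<And>m i. i < k m \<Longrightarrow> t m (Suc i) - t m i < (1/16) ^ m"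
    "\<And>m. \<epsilon> \<le> measure M {\<omega> \<in> space M. \<bar>S (k m) (t m) \<omega> - J \<omega>\<bar> > \<epsilon>}"
    using p unfolding R_def k_def t_def not_less by auto
  obtain c where c: "c \<ge> 0" "\<forall>x k t \<delta>. is_partition x k t \<longrightarrow> (\<forall>i<k. t (Suc i) - t i < \<delta>) \<longrightarrow>
     (\<integral>\<^sup>+\<omega>. ennreal (\<Sum>i<k. \<bar>B (t (Suc i)) \<omega> - B (t i) \<omega>\<bar> ^ 3) \<partial>M) \<le> ennreal (c * x * sqrt \<delta>)"
    using brownian_cubic_variation[OF B] by blast
  have x: "x \<ge> 0" using partition_mem[OF kt(1)[of 0], of 0] by simp
  define Q where "Q = (\<lambda>m \<omega>. \<Sum>i<k m. \<bar>B (t m (Suc i)) \<omega> - B (t m i) \<omega>\<bar> ^ 3)"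
  have Q0: "Q m \<omega> \<ge> 0" for m \<omega> unfolding Q_def by (intro sum_nonneg) auto
  have Qm: "Q m \<in> borel_measurable M" for m
    unfolding Q_def
  proof (intro borel_measurable_sum)
    fix i assume "i \<in> {..<k m}"
    then have "t m i \<in> {0..x}" "t m (Suc i) \<in> {0..x}" using partition_mem[OF kt(1)[of m]] by auto
    then have [measurable]: "B (t m i) \<in> borel_measurable M" "B (t m (Suc i)) \<in> borel_measurable M"
      by (auto intro: brownian_measurable[OF B])
    show "(\<lambda>\<omega>. \<bar>B (t m (Suc i)) \<omega> - B (t m i) \<omega>\<bar> ^ 3) \<in> borel_measurable M" by measurable
  qed
  have QE: "(\<integral>\<^sup>+\<omega>. ennreal (Q m \<omega>) \<partial>M) \<le> ennreal (c * x * (1/4) ^ m)" for m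
  proof -
    \<comment> \<open>The square root of the mesh bound is geometric with ratio 1/4, hence
      summable.\<close>
    have "sqrt ((1/16) ^ m) = (1/4::real) ^ m"
      by (rule real_sqrt_unique) (simp_all add: power2_eq_square flip: power_mult_distrib)
    then show ?thesis unfolding Q_def using c(2)[rule_format, OF kt(1) kt(2), of m] by (simp only:)
  qed
  have "(\<integral>\<^sup>+\<omega>. (\<Sum>m. ennreal (Q m \<omega>)) \<partial>M) = (\<Sum>m. \<integral>\<^sup>+\<omega>. ennreal (Q m \<omega>) \<partial>M)"
    by (rule nn_integral_suminf) (use Qm in auto)
  also have "\<dots> \<le> (\<Sum>m. ennreal (c * x * (1/4) ^ m))" by (intro suminf_le QE) auto
  also have "\<dots> = ennreal (\<Sum>m. c * x * (1/4) ^ m)"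
    using c x by (intro suminf_ennreal2 summable_mult summable_geometric) auto
  also have "\<dots> < \<infinity>" by simp
  finally have "AE \<omega> in M. (\<Sum>m. ennreal (Q m \<omega>)) \<noteq> \<infinity>"
    using Qm by (intro nn_integral_PInf_AE) auto
  then have Qlim: "AE \<omega> in M. (\<lambda>m. Q m \<omega>) \<longlonglongrightarrow> 0"
    by eventually_elim (auto intro!: summable_LIMSEQ_zero summable_suminf_not_top Q0)
  let ?E = "\<lambda>m. {\<omega> \<in> space M. \<bar>S (k m) (t m) \<omega> - J \<omega>\<bar> > \<epsilon>}"
  have Em: "?E m \<in> sets M" for m
  proof -
    note [measurable] = S[OF kt(1)[of m]] J
    show ?thesis by measurable
  qed
  \<comment> \<open>The threshold \<delta> depends on the path, so each path leaves the exceptional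
    events eventually, at no uniform rate. Dominated convergence then contradicts probabilities of
    at least \<epsilon>.\<close>
  have Elim: "AE \<omega> in M. (\<lambda>m. indicator (?E m) \<omega> :: real) \<longlonglongrightarrow> 0"
    using Qlim AE_space
  proof eventually_elim
    case (elim \<omega>)
    obtain \<delta> where \<delta>: "\<delta> > 0" "\<And>k t. is_partition x k t \<Longrightarrow> (\<forall>i<k. t (Suc i) - t i < \<delta>) \<Longrightarrow>
        (\<Sum>i<k. \<bar>B (t (Suc i)) \<omega> - B (t i) \<omega>\<bar> ^ 3) < \<delta> \<Longrightarrow> \<bar>S k t \<omega> - J \<omega>\<bar> < \<epsilon>"
      using path[OF elim(2) \<epsilon>] by blast
    have "(\<lambda>m. (1/16::real) ^ m) \<longlonglongrightarrow> 0" by (rule LIMSEQ_power_zero) simp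
    then have "\<forall>\<^sub>F m in sequentially. (1/16::real) ^ m < \<delta>" using \<delta>(1) by (rule order_tendstoD)
    moreover have "\<forall>\<^sub>F m in sequentially. Q m \<omega> < \<delta>" using elim(1) \<delta>(1) by (rule order_tendstoD)
    ultimately have "\<forall>\<^sub>F m in sequentially. indicator (?E m) \<omega> = (0::real)"
    proof eventually_elim
      case (elim m)
      have "\<bar>S (k m) (t m) \<omega> - J \<omega>\<bar> < \<epsilon>"
        by (rule \<delta>(2)[OF kt(1)]) (use kt(2)[of _ m] elim in \<open>fastforce simp: Q_def\<close>)+
      then show ?case by (auto simp: indicator_def)
    qed
    then show ?case by (rule tendsto_eventually)
  qed
  have "(\<lambda>m. \<integral>\<omega>. indicator (?E m) \<omega> \<partial>M :: real) \<longlonglongrightarrow> (\<integral>\<omega>. 0 \<partial>M)"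
    by (rule integral_dominated_convergence[where w="\<lambda>_. 1"]) (use Em Elim in \<open>auto simp: indicator_def\<close>)
  moreover have "(\<integral>\<omega>. indicator (?E m) \<omega> \<partial>M :: real) = measure M (?E m)" for m
    using Em[of m] by (simp add: Int_absorb1)
  ultimately have "(\<lambda>m. measure M (?E m)) \<longlonglongrightarrow> 0" by simp
  then have "\<forall>\<^sub>F m in sequentially. measure M (?E m) < \<epsilon>" using \<epsilon> by (rule order_tendstoD)
  then obtain m where "measure M (?E m) < \<epsilon>" by (auto simp: eventually_sequentially)
  with kt(3)[of m] show False by simp
qed

section \<open>Increments of the explicit solution\<close>

text \<open>The integrated forms of d ln u = - u dx - 2 dW and of the relation between successive
  drivers, since \<open>integral_exp_tower_log\<close> identifies the logarithm with \<integral> u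
  dx.\<close>

lemma tower_log_increment:
  assumes z: "continuous_on {0..} z" and st: "0 \<le> s" "s \<le> t"
  shows "tower_log l z j t - tower_log l z j s = - 2 * (tower l z j t - tower l z j s) - integral {s..t} (\<lambda>r. exp (tower_log l z j r))"
    and "tower l z (Suc j) t - tower l z (Suc j) s = - (tower l z j t - tower l z j s) - integral {s..t} (\<lambda>r. exp (tower_log l z j r))"
proof -
  let ?U = "\<lambda>r. exp (tower_log l z j r)"
  have "?U integrable_on {0..t}"
    by (intro integrable_continuous_real continuous_intros continuous_on_subset[OF continuous_on_tower_log[OF z]]) auto
  from Henstock_Kurzweil_Integration.integral_combine[OF st this]
  have "integral {s..t} ?U = integral {0..t} ?U - integral {0..s} ?U" by simp
  also have "\<dots> = ln (1 + exp (l j) * integral {0..t} (\<lambda>s. exp (- 2 * tower l z j s))) - ln (1 + exp (l j) * integral {0..s} (\<lambda>s. exp (- 2 * tower l z j s)))"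
    using integral_exp_tower_log[OF z, of t l j] integral_exp_tower_log[OF z, of s l j] st by simp
  finally have i: "integral {s..t} ?U = \<dots>" .
  show "tower_log l z j t - tower_log l z j s = - 2 * (tower l z j t - tower l z j s) - integral {s..t} ?U"
  proof -
    have "a - b = - 2 * (p - q) - e" if "e = lt - ls" "a = c - 2 * p - lt" "b = c - 2 * q - ls" for a b c e p q lt ls :: real
      using that by simp
    from this[OF i tower_log_def tower_log_def] show ?thesis .
  qed
  show "tower l z (Suc j) t - tower l z (Suc j) s = - (tower l z j t - tower l z j s) - integral {s..t} ?U"
    using i unfolding tower.simps by linarith
qed

lemma integral_exp_tower_log_bound:
  assumes z: "continuous_on {0..} z"
  obtains R where "R \<ge> 0" "\<And>s t. 0 \<le> s \<Longrightarrow> s \<le> t \<Longrightarrow> t \<le> x \<Longrightarrow> \<bar>integral {s..t} (\<lambda>r. exp (tower_log l z j r))\<bar> \<le> R * (t - s)"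
proof -
  let ?U = "\<lambda>r. exp (tower_log l z j r)"
  have U: "continuous_on {0..x} ?U"
    by (intro continuous_intros continuous_on_subset[OF continuous_on_tower_log[OF z]]) auto
  then have "bounded (?U ` {0..x})" using compact_imp_bounded[OF compact_continuous_image[OF U]] by simp
  then obtain R where "\<forall>y\<in>?U ` {0..x}. norm y \<le> R" unfolding bounded_iff by blast
  then have R: "\<And>r. r \<in> {0..x} \<Longrightarrow> \<bar>?U r\<bar> \<le> R" by simp
  show thesis
  proof (rule that[of "max 0 R"])
    fix s t assume st: "0 \<le> s" "s \<le> t" "t \<le> x"
    have "norm (integral {s..t} ?U) \<le> max 0 R * (t - s)"
    proof (rule integral_bound)
      show "continuous_on {s..t} ?U" using st by (intro continuous_on_subset[OF U]) auto
      show "norm (?U r) \<le> max 0 R" if "r \<in> {s..t}" for r using R[of r] that st by (simp add: le_max_iff_disj)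
    qed (use st in auto)
    then show "\<bar>integral {s..t} ?U\<bar> \<le> max 0 R * (t - s)" by simp
  qed simp
qed

text \<open>Up to sign, every level is the driver \<open>z\<close> plus a path that is Lipschitz on
  bounded intervals. Hence its cubic variation is controlled by that of \<open>z\<close>; the
  constant depends on the path, which a pathwise argument permits.\<close>

lemma tower_increment_bound:
  assumes z: "continuous_on {0..} z"
  shows "\<exists>C\<ge>0. \<forall>s t. 0 \<le> s \<longrightarrow> s \<le> t \<longrightarrow> t \<le> x \<longrightarrow> \<bar>tower l z j t - tower l z j s\<bar> \<le> \<bar>z t - z s\<bar> + C * (t - s)"
proof (induction j)
  case 0 show ?case by (intro exI[of _ 0]) auto
next
  case (Suc j)
  then obtain C where C: "C \<ge> 0" "\<And>s t. 0 \<le> s \<Longrightarrow> s \<le> t \<Longrightarrow> t \<le> x \<Longrightarrow> \<bar>tower l z j t - tower l z j s\<bar> \<le> \<bar>z t - z s\<bar> + C * (t - s)" by blast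
  obtain R where R: "R \<ge> 0" "\<And>s t. 0 \<le> s \<Longrightarrow> s \<le> t \<Longrightarrow> t \<le> x \<Longrightarrow> \<bar>integral {s..t} (\<lambda>r. exp (tower_log l z j r))\<bar> \<le> R * (t - s)"
    using integral_exp_tower_log_bound[OF z, of x l j] by metis
  show ?case
  proof (intro exI[of _ "C + R"] conjI allI impI)
    fix s t assume st: "0 \<le> s" "s \<le> t" "t \<le> x"
    have "\<bar>tower l z (Suc j) t - tower l z (Suc j) s\<bar> \<le> \<bar>- (tower l z j t - tower l z j s)\<bar> + \<bar>integral {s..t} (\<lambda>r. exp (tower_log l z j r))\<bar>"
      unfolding tower_log_increment(2)[OF z st(1,2)] by (rule abs_triangle_ineq4)
    also have "\<dots> \<le> (\<bar>z t - z s\<bar> + C * (t - s)) + R * (t - s)"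
      unfolding abs_minus_cancel by (rule add_mono[OF C(2)[OF st] R(2)[OF st]])
    finally show "\<bar>tower l z (Suc j) t - tower l z (Suc j) s\<bar> \<le> \<bar>z t - z s\<bar> + (C + R) * (t - s)" by (simp add: algebra_simps)
  qed (use C R in auto)
qed

lemma tower_log_increment_bound:
  assumes z: "continuous_on {0..} z"
  obtains C where "C \<ge> 0" "\<And>s t. 0 \<le> s \<Longrightarrow> s \<le> t \<Longrightarrow> t \<le> x \<Longrightarrow> \<bar>tower_log l z j t - tower_log l z j s\<bar> \<le> 2 * \<bar>z t - z s\<bar> + C * (t - s)"
proof -
  obtain C where C: "C \<ge> 0" "\<And>s t. 0 \<le> s \<Longrightarrow> s \<le> t \<Longrightarrow> t \<le> x \<Longrightarrow> \<bar>tower l z j t - tower l z j s\<bar> \<le> \<bar>z t - z s\<bar> + C * (t - s)"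
    using tower_increment_bound[OF z, of x l j] by blast
  obtain R where R: "R \<ge> 0" "\<And>s t. 0 \<le> s \<Longrightarrow> s \<le> t \<Longrightarrow> t \<le> x \<Longrightarrow> \<bar>integral {s..t} (\<lambda>r. exp (tower_log l z j r))\<bar> \<le> R * (t - s)"
    using integral_exp_tower_log_bound[OF z, of x l j] by metis
  show thesis
  proof (rule that[of "2 * C + R"])
    fix s t assume st: "0 \<le> s" "s \<le> t" "t \<le> x"
    have "\<bar>tower_log l z j t - tower_log l z j s\<bar> \<le> \<bar>- 2 * (tower l z j t - tower l z j s)\<bar> + \<bar>integral {s..t} (\<lambda>r. exp (tower_log l z j r))\<bar>"
      unfolding tower_log_increment(1)[OF z st(1,2)] by (rule abs_triangle_ineq4)
    also have "\<bar>- 2 * (tower l z j t - tower l z j s)\<bar> = 2 * \<bar>tower l z j t - tower l z j s\<bar>" by (simp only: abs_mult abs_neg_numeral)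
    also have "2 * \<bar>tower l z j t - tower l z j s\<bar> + \<bar>integral {s..t} (\<lambda>r. exp (tower_log l z j r))\<bar>
        \<le> 2 * (\<bar>z t - z s\<bar> + C * (t - s)) + R * (t - s)"
      using C(2)[OF st] by (intro add_mono mult_left_mono R(2)[OF st]) auto
    finally show "\<bar>tower_log l z j t - tower_log l z j s\<bar> \<le> 2 * \<bar>z t - z s\<bar> + (2 * C + R) * (t - s)" by (simp add: algebra_simps)
  qed (use C R in auto)
qed

lemma cube_add_le:
  fixes a b :: real
  assumes "a \<ge> 0" "b \<ge> 0"
  shows "(a + b) ^ 3 \<le> 4 * (a ^ 3 + b ^ 3)"
proof -
  have "0 \<le> 3 * ((a + b) * (a - b)\<^sup>2)" using assms by simp
  also have "\<dots> = 4 * (a ^ 3 + b ^ 3) - (a + b) ^ 3"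
    by (simp add: power3_eq_cube power2_eq_square algebra_simps)
  finally show ?thesis by simp
qed

section \<open>Verification of the system\<close>

text \<open>\<open>tower\<close> is normalised at 0, whereas \<open>W_seq\<close> starts from
  \<open>B 0\<close>; the recursion negates this constant at each level. It cancels in
  increments.\<close>

lemma W_seq_sol:
  assumes z: "continuous_on {0..} (driver \<mu> B (fst \<omega>))" and x: "x \<ge> 0"
  shows "W_seq (\<lambda>_. 1) (lift_process (\<lambda>x \<omega>. \<mu> * x + B x \<omega>)) (sol \<mu> B) (Suc j) x \<omega>
    = tower (snd \<omega>) (driver \<mu> B (fst \<omega>)) j x - (-1) ^ j * B 0 (fst \<omega>)"
proof (induction j)
  case 0
  show ?case by (simp add: sol_def lift_process_def driver_def)
next
  case (Suc j)
  have "W_seq (\<lambda>_. 1) (lift_process (\<lambda>x \<omega>. \<mu> * x + B x \<omega>)) (sol \<mu> B) (Suc (Suc j)) x \<omega>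
    = - integral {0..x} (\<lambda>y. exp (tower_log (snd \<omega>) (driver \<mu> B (fst \<omega>)) j y))
      - W_seq (\<lambda>_. 1) (lift_process (\<lambda>x \<omega>. \<mu> * x + B x \<omega>)) (sol \<mu> B) (Suc j) x \<omega>"
    by (subst W_seq.simps(2)) (simp add: sol_def level_state_def)
  then show ?case
    unfolding Suc integral_exp_tower_log[OF z x] by simp
qed

lemma measurable_driver_filtration:
  assumes "0 \<le> s" "s \<le> x"
  shows "(\<lambda>\<omega>. driver \<mu> B (fst \<omega>) s) \<in> borel_measurable (enlarged_filtration M B N x)"
proof -
  have [measurable]: "(\<lambda>\<omega>. B s (fst \<omega>)) \<in> borel_measurable (enlarged_filtration M B N x)"
    "(\<lambda>\<omega>. B 0 (fst \<omega>)) \<in> borel_measurable (enlarged_filtration M B N x)"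
    using assms by (auto intro!: measurable_enlarged_filtration)
  show ?thesis unfolding driver_def by measurable
qed

text \<open>The limit is the value that the equation forces on the integral. Smallness is expressed
  through the cubic variation of \<open>B\<close>, the quantity with controlled expectation, rather
  than that of ln u.\<close>

lemma stratonovich_sum_sol_converges:
  fixes j :: nat
  assumes z: "continuous_on {0..} (driver \<mu> B (fst \<omega>))" and \<mu>: "\<mu> > 0" and x: "x \<ge> 0" and \<epsilon>: "\<epsilon> > 0"
  defines "u \<equiv> sol \<mu> B (Suc j)" and "Y \<equiv> W_seq (\<lambda>_. 1) (lift_process (\<lambda>x \<omega>. \<mu> * x + B x \<omega>)) (sol \<mu> B) (Suc j)"
  shows "\<exists>\<delta>>0. \<forall>k t. is_partition x k t \<and> (\<forall>i<k. t (Suc i) - t i < \<delta>) \<and>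
      (\<Sum>i<k. \<bar>lift_process B (t (Suc i)) \<omega> - lift_process B (t i) \<omega>\<bar> ^ 3) < \<delta> \<longrightarrow>
      \<bar>stratonovich_sum u Y k t \<omega> - (u 0 \<omega> - u x \<omega> - integral {0..x} (\<lambda>r. (u r \<omega>)\<^sup>2)) / 2\<bar> < \<epsilon>"
proof -
  let ?J = "(u 0 \<omega> - u x \<omega> - integral {0..x} (\<lambda>r. (u r \<omega>)\<^sup>2)) / 2"
  let ?L = "\<lambda>x. tower_log (snd \<omega>) (driver \<mu> B (fst \<omega>)) j x"
  have s: "u t \<omega> = exp (?L t)" for t by (simp add: u_def sol_def level_state_def)
  have Lc: "continuous_on {0..} ?L" by (rule continuous_on_tower_log[OF z])
  let ?z = "driver \<mu> B (fst \<omega>)" and ?b = "\<lambda>s t. \<bar>B t (fst \<omega>) - B s (fst \<omega>)\<bar>"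
  have Wi: "Y t \<omega> - Y s \<omega> = - (?L t - ?L s) / 2 - integral {s..t} (\<lambda>r. exp (?L r)) / 2"
    if "0 \<le> s" "s \<le> t" for s t
  proof -
    have "Y t \<omega> - Y s \<omega> = tower (snd \<omega>) ?z j t - tower (snd \<omega>) ?z j s"
      using W_seq_sol[OF z, of t j] W_seq_sol[OF z, of s j] that unfolding Y_def by (simp del: W_seq.simps)
    moreover have "w = - (a - b) / 2 - e / 2" if "w = p - q" "a - b = - 2 * (p - q) - e" for w p q a b e :: real
      unfolding that by (simp add: field_simps)
    ultimately show ?thesis using tower_log_increment(1)[OF z that, of "snd \<omega>" j] by blast
  qed
  obtain \<delta>0 where \<delta>0: "\<delta>0 > 0" "\<And>k t. is_partition x k t \<Longrightarrow> (\<forall>i<k. t (Suc i) - t i < \<delta>0) \<Longrightarrow> (\<Sum>i<k. \<bar>?L (t (Suc i)) - ?L (t i)\<bar> ^ 3) < \<delta>0 \<Longrightarrow>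
      \<bar>stratonovich_sum u Y k t \<omega> - ?J\<bar> < \<epsilon>"
    using trapezoidal_sum_converges[OF x continuous_on_subset[OF Lc] Wi \<epsilon>]
    unfolding stratonovich_sum_def s by (auto simp: subset_eq)
  obtain C where C: "C \<ge> 0" "\<And>s t. 0 \<le> s \<Longrightarrow> s \<le> t \<Longrightarrow> t \<le> x \<Longrightarrow> \<bar>?L t - ?L s\<bar> \<le> 2 * \<bar>?z t - ?z s\<bar> + C * (t - s)"
    using tower_log_increment_bound[OF z, of x "snd \<omega>" j] by metis
  \<comment> \<open>The Lipschitz part of ln u: \<open>C\<close> from the integrals of the levels,
    and \<open>2 * \<mu>\<close> from the drift of the driver, which enters ln u with factor
    2.\<close>
  define D where "D = C + 2 * \<mu>"
  have D: "D \<ge> 0" using C \<mu> by (simp add: D_def)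
  have LB: "\<bar>?L t - ?L s\<bar> ^ 3 \<le> 32 * ?b s t ^ 3 + 4 * D ^ 3 * (t - s) ^ 3"
    if st: "0 \<le> s" "s \<le> t" "t \<le> x" for s t
  proof -
    have "?z t - ?z s = - (B t (fst \<omega>) - B s (fst \<omega>)) - \<mu> * (t - s)" by (simp add: driver_def algebra_simps)
    then have "\<bar>?z t - ?z s\<bar> \<le> \<bar>- (B t (fst \<omega>) - B s (fst \<omega>))\<bar> + \<bar>\<mu> * (t - s)\<bar>" by (simp only: abs_triangle_ineq4)
    also have "\<bar>\<mu> * (t - s)\<bar> = \<mu> * (t - s)" using \<mu> st by simp
    finally have "\<bar>?z t - ?z s\<bar> \<le> ?b s t + \<mu> * (t - s)" by simp
    with C(2)[OF st] have "\<bar>?L t - ?L s\<bar> \<le> 2 * ?b s t + D * (t - s)"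
      by (simp add: D_def algebra_simps)
    then have "\<bar>?L t - ?L s\<bar> ^ 3 \<le> (2 * ?b s t + D * (t - s)) ^ 3"
      by (rule power_mono) simp
    also have "\<dots> \<le> 4 * ((2 * ?b s t) ^ 3 + (D * (t - s)) ^ 3)"
      using D st by (intro cube_add_le) auto
    finally show ?thesis by (simp add: power_mult_distrib)
  qed
  \<comment> \<open>The cubic variation of ln u is at most 32 times that of \<open>B\<close> plus
    \<open>4 * D ^ 3 * x * \<delta>\<close>, where 32 is 4 times the cube of 2. The entry 33 leaves
    room above 32, and \<delta> \<le> 1 gives d^3 \<le> \<delta> d for the step lengths d.\<close>
  define \<delta> where "\<delta> = min 1 (min \<delta>0 (\<delta>0 / (33 + 4 * D ^ 3 * x)))"
  have den: "33 + 4 * D ^ 3 * x > 0" using D x by (intro add_pos_nonneg) auto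
  have \<delta>: "\<delta> > 0" "\<delta> \<le> 1" "\<delta> \<le> \<delta>0" using \<delta>0 den by (auto simp: \<delta>_def)
  have "\<delta> \<le> \<delta>0 / (33 + 4 * D ^ 3 * x)" by (simp add: \<delta>_def)
  then have \<delta>3: "(33 + 4 * D ^ 3 * x) * \<delta> \<le> \<delta>0" using den by (simp add: pos_le_divide_eq mult.commute)
  show ?thesis
  proof (intro exI[of _ \<delta>] conjI \<delta> allI impI)
    fix k t assume *: "is_partition x k t \<and> (\<forall>i<k. t (Suc i) - t i < \<delta>) \<and>
      (\<Sum>i<k. \<bar>lift_process B (t (Suc i)) \<omega> - lift_process B (t i) \<omega>\<bar> ^ 3) < \<delta>"
    then have p: "is_partition x k t" and mesh: "\<And>i. i < k \<Longrightarrow> t (Suc i) - t i < \<delta>"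
      and Q: "(\<Sum>i<k. ?b (t i) (t (Suc i)) ^ 3) < \<delta>"
      by (auto simp: lift_process_def)
    have mem: "0 \<le> t i" "t i \<le> t (Suc i)" "t (Suc i) \<le> x" if "i < k" for i
      using partition_mem[OF p, of i] partition_mem[OF p, of "Suc i"] partition_mono[OF p, of i "Suc i"] that by auto
    have "(\<Sum>i<k. \<bar>?L (t (Suc i)) - ?L (t i)\<bar> ^ 3)
      \<le> (\<Sum>i<k. 32 * ?b (t i) (t (Suc i)) ^ 3 + 4 * D ^ 3 * \<delta> * (t (Suc i) - t i))"
    proof (rule sum_mono)
      fix i assume "i \<in> {..<k}"
      then have i: "i < k" by simp
      define d where "d = t (Suc i) - t i"
      have d: "0 \<le> d" "d \<le> \<delta>" "d \<le> 1" using mem[OF i] mesh[OF i] \<delta> by (auto simp: d_def)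
      have "d ^ 3 = d * (d * d)" by (simp add: power3_eq_cube)
      also have "\<dots> \<le> \<delta> * (1 * d)" using d by (intro mult_mono) auto
      finally have "4 * D ^ 3 * d ^ 3 \<le> 4 * D ^ 3 * (\<delta> * d)" using D by (intro mult_left_mono) auto
      then show "\<bar>?L (t (Suc i)) - ?L (t i)\<bar> ^ 3
        \<le> 32 * ?b (t i) (t (Suc i)) ^ 3 + 4 * D ^ 3 * \<delta> * (t (Suc i) - t i)"
        using LB[OF mem[OF i]] by (simp add: d_def mult.assoc)
    qed
    also have "\<dots> = 32 * (\<Sum>i<k. ?b (t i) (t (Suc i)) ^ 3) + 4 * D ^ 3 * \<delta> * x"
      using partition_sum[OF p, of "\<lambda>s. s"] by (simp add: sum.distrib sum_distrib_left[symmetric])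
    also have "\<dots> < 33 * \<delta> + 4 * D ^ 3 * \<delta> * x" using Q \<delta> by simp
    also have "\<dots> = (33 + 4 * D ^ 3 * x) * \<delta>" by (simp add: algebra_simps)
    also note \<delta>3
    finally show "\<bar>stratonovich_sum u Y k t \<omega> - ?J\<bar> < \<epsilon>"
      using mesh \<delta>(3) by (intro \<delta>0(2)[OF p]) fastforce+
  qed
qed

lemma sol_solves_system:
  assumes B: "standard_brownian_motion M B" and \<mu>: "\<mu> > 0"
  shows "solves_system (M \<Otimes>\<^sub>M levels \<mu>) (enlarged_filtration M B (levels \<mu>)) (\<lambda>_. 1)
    (lift_process (\<lambda>x \<omega>. \<mu> * x + B x \<omega>)) (sol \<mu> B)"
proof -
  interpret M: prob_space M using B by (simp add: standard_brownian_motion_def)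
  interpret N: prob_space "levels \<mu>" by (rule prob_space_levels) fact
  interpret P: pair_prob_space M "levels \<mu>" ..
  let ?P = "M \<Otimes>\<^sub>M levels \<mu>" and ?F = "enlarged_filtration M B (levels \<mu>)"
  let ?W = "W_seq (\<lambda>_. 1) (lift_process (\<lambda>x \<omega>. \<mu> * x + B x \<omega>)) (sol \<mu> B)"
  have lift: "standard_brownian_motion ?P (lift_process B)"
    by (rule standard_brownian_motion_lift[OF B N.prob_space_axioms])
  have Bm: "(\<lambda>\<omega>. B x (fst \<omega>)) \<in> borel_measurable ?P" if "x \<ge> 0" for x
    using brownian_measurable[OF lift that] by (simp add: lift_process_def)
  have z: "continuous_on {0..} (driver \<mu> B (fst \<omega>))" if "\<omega> \<in> space ?P" for \<omega>
    using that by (intro continuous_on_driver[OF B]) (auto simp: space_pair_measure)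
  have zm: "(\<lambda>\<omega>. driver \<mu> B (fst \<omega>) s) \<in> borel_measurable ?P" if "0 \<le> s" for s
  proof -
    note [measurable] = Bm[OF that] Bm[OF order_refl]
    show ?thesis unfolding driver_def by measurable
  qed
  show ?thesis
    unfolding solves_system_def
  proof
    fix n
    show "adapted ?F (sol \<mu> B n) \<and> continuous_paths ?P (sol \<mu> B n) \<and>
      (\<exists>J. (\<forall>x\<ge>0. has_stratonovich_integral ?P (sol \<mu> B n) (?W n) x (J x)) \<and>
        (AE \<omega> in ?P. \<forall>x\<ge>0. sol \<mu> B n x \<omega> = sol \<mu> B n 0 \<omega> - integral {0..x} (\<lambda>y. (sol \<mu> B n y \<omega>)\<^sup>2) - 2 * J x \<omega>))"
    proof (cases n)
      case 0
      have s0: "sol \<mu> B 0 = (\<lambda>_ _. 0)" by (simp add: sol_def fun_eq_iff)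
      have "has_stratonovich_integral ?P (\<lambda>_ _. 0) (?W 0) x (\<lambda>_. 0)" for x
        unfolding has_stratonovich_integral_def
      proof (intro conjI ballI allI impI)
        fix y assume "y \<in> {0..x}"
        then have [measurable]: "(\<lambda>\<omega>. B y (fst \<omega>)) \<in> borel_measurable ?P" by (intro Bm) auto
        show "?W 0 y \<in> borel_measurable ?P" unfolding W_seq.simps lift_process_def by measurable
      qed (auto simp: stratonovich_sum_def intro!: exI[of _ 1])
      then show ?thesis unfolding 0 s0
        by (auto simp: adapted_def continuous_paths_def intro!: exI[of _ "\<lambda>_ _. 0"])
    next
      case (Suc j)
      let ?L = "\<lambda>x \<omega>. tower_log (snd \<omega>) (driver \<mu> B (fst \<omega>)) j x"
      have s: "sol \<mu> B n = (\<lambda>x \<omega>. exp (?L x \<omega>))" by (simp add: Suc sol_def level_state_def fun_eq_iff)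
      have Lc: "continuous_on {0..} (\<lambda>x. ?L x \<omega>)" if "\<omega> \<in> space ?P" for \<omega>
        by (rule continuous_on_tower_log[OF z[OF that]])
      have Lm: "?L x \<in> borel_measurable ?P" if "x \<ge> 0" for x
        by (rule measurable_tower(2)[OF measurable_snd_component zm z that])
      have Wm: "?W n x \<in> borel_measurable ?P" if x: "x \<ge> 0" for x
      proof -
        have "(\<lambda>\<omega>. tower (snd \<omega>) (driver \<mu> B (fst \<omega>)) j x - (-1) ^ j * B 0 (fst \<omega>)) \<in> borel_measurable ?P"
          by (intro borel_measurable_diff borel_measurable_times borel_measurable_const Bm
                measurable_tower(1)[OF measurable_snd_component zm z x]) auto
        then show ?thesis unfolding Suc by (subst measurable_cong[OF W_seq_sol[OF z x]])
      qed
      \<comment> \<open>Obtained by solving the equation for the integral, so the equation holds at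
        every sample point; what remains is that \<open>J\<close> is the Stratonovich
        integral.\<close>
      define J where "J = (\<lambda>x \<omega>. (sol \<mu> B n 0 \<omega> - sol \<mu> B n x \<omega> - integral {0..x} (\<lambda>r. (sol \<mu> B n r \<omega>)\<^sup>2)) / 2)"
      have Jm: "J x \<in> borel_measurable ?P" if x: "x \<ge> 0" for x
      proof -
        have "(\<lambda>\<omega>. integral {0..x} (\<lambda>r. (exp (?L r \<omega>))\<^sup>2)) \<in> borel_measurable ?P"
          using Lm by (intro measurable_integral_continuous[OF x] borel_measurable_power borel_measurable_exp
            continuous_intros continuous_on_subset[OF Lc]) auto
        then show ?thesis unfolding J_def s using Lm[of 0] Lm[OF x] by simp
      qed
      have "adapted ?F (sol \<mu> B n)"
        unfolding adapted_def s
      proof (intro allI impI)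
        fix x :: real assume x: "0 \<le> x"
        have "(\<lambda>\<omega>. snd \<omega> i) \<in> borel_measurable (?F x)" for i
          unfolding enlarged_filtration_def by (rule measurable_snd_component)
        then have "(\<lambda>\<omega>. ?L x \<omega>) \<in> borel_measurable (?F x)"
          by (rule measurable_tower(2)[OF _ measurable_driver_filtration _ x]) (auto intro: z)
        then show "(\<lambda>\<omega>. exp (?L x \<omega>)) \<in> borel_measurable (?F x)" by measurable
      qed
      moreover have "continuous_paths ?P (sol \<mu> B n)"
        unfolding continuous_paths_def s by (intro ballI continuous_intros Lc)
      moreover have "has_stratonovich_integral ?P (sol \<mu> B n) (?W n) x (J x)" if x: "x \<ge> 0" for x
        unfolding has_stratonovich_integral_def
      proof (intro conjI ballI allI impI)
        show "J x \<in> borel_measurable ?P" by (rule Jm[OF x])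
        show sm: "sol \<mu> B n y \<in> borel_measurable ?P" if "y \<in> {0..x}" for y
          unfolding s using Lm[of y] that by simp
        show wm: "?W n y \<in> borel_measurable ?P" if "y \<in> {0..x}" for y
          using Wm[of y] that by simp
        fix \<epsilon> :: real assume \<epsilon>: "\<epsilon> > 0"
        show "\<exists>\<delta>>0. \<forall>k t. is_partition x k t \<and> (\<forall>i<k. t (Suc i) - t i < \<delta>) \<longrightarrow>
            measure ?P {\<omega> \<in> space ?P. \<bar>stratonovich_sum (sol \<mu> B n) (?W n) k t \<omega> - J x \<omega>\<bar> > \<epsilon>} < \<epsilon>"
        proof (rule brownian_limit_in_probability[OF lift _ Jm[OF x] _ \<epsilon>])
          fix k t assume p: "is_partition x k t"
          show "stratonovich_sum (sol \<mu> B n) (?W n) k t \<in> borel_measurable ?P"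
            unfolding stratonovich_sum_def
          proof (intro borel_measurable_sum)
            fix i assume "i \<in> {..<k}"
            then have m: "t i \<in> {0..x}" "t (Suc i) \<in> {0..x}" using partition_mem[OF p] by auto
            note [measurable] = sm[OF m(1)] sm[OF m(2)] wm[OF m(1)] wm[OF m(2)]
            show "(\<lambda>\<omega>. (sol \<mu> B n (t i) \<omega> + sol \<mu> B n (t (Suc i)) \<omega>) / 2 * (?W n (t (Suc i)) \<omega> - ?W n (t i) \<omega>)) \<in> borel_measurable ?P"
              by measurable
          qed
        next
          fix \<omega> and \<epsilon> :: real assume \<omega>: "\<omega> \<in> space ?P" and \<epsilon>: "\<epsilon> > 0"
          show "\<exists>\<delta>>0. \<forall>k t. is_partition x k t \<and> (\<forall>i<k. t (Suc i) - t i < \<delta>) \<and>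
              (\<Sum>i<k. \<bar>lift_process B (t (Suc i)) \<omega> - lift_process B (t i) \<omega>\<bar> ^ 3) < \<delta> \<longrightarrow>
              \<bar>stratonovich_sum (sol \<mu> B n) (?W n) k t \<omega> - J x \<omega>\<bar> < \<epsilon>"
            using stratonovich_sum_sol_converges[where j=j, OF z[OF \<omega>] \<mu> x \<epsilon>] unfolding J_def Suc .
        qed
      qed
      moreover have "sol \<mu> B n x \<omega> = sol \<mu> B n 0 \<omega> - integral {0..x} (\<lambda>y. (sol \<mu> B n y \<omega>)\<^sup>2) - 2 * J x \<omega>" for x \<omega>
        by (simp add: J_def field_simps)
      ultimately show ?thesis by blast
    qed
  qed
qed

theorem theorem3:
  fixes M :: "'a measure" and B W :: "real \<Rightarrow> 'a \<Rightarrow> real" and a :: "real \<Rightarrow> real" and \<mu> :: real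
  assumes "standard_brownian_motion M B"
    and "\<mu> > 0"
    and "W = (\<lambda>x \<omega>. \<mu> * x + B x \<omega>)"
    and "a = (\<lambda>_. 1)"
  shows "\<exists>(N :: (nat \<Rightarrow> real) measure) (F :: real \<Rightarrow> ('a \<times> (nat \<Rightarrow> real)) measure)
           (u :: nat \<Rightarrow> real \<Rightarrow> 'a \<times> (nat \<Rightarrow> real) \<Rightarrow> real).
           prob_space N \<and>
           brownian_motion_wrt (M \<Otimes>\<^sub>M N) F (lift_process B) \<and>
           solves_system (M \<Otimes>\<^sub>M N) F a (lift_process W) u \<and>
           stationary_sequence (M \<Otimes>\<^sub>M N) u \<and>
           (\<forall>x\<ge>0. \<forall>\<omega>\<in>space (M \<Otimes>\<^sub>M N). u 0 x \<omega> = 0) \<and>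
           (\<forall>x\<ge>0. prob_space.indep_vars (M \<Otimes>\<^sub>M N) (\<lambda>_. borel) (\<lambda>n. u n x) {1..}) \<and>
           (\<exists>\<kappa>>0. \<exists>\<theta>>0. \<forall>n\<ge>1. \<forall>x\<ge>0.
              distributed (M \<Otimes>\<^sub>M N) lborel (u n x) (gamma_density \<kappa> \<theta>))"
proof (intro exI conjI)
  note B = assms(1) and \<mu> = assms(2)
  show N: "prob_space (levels \<mu>)" by (rule prob_space_levels[OF \<mu>])
  show "brownian_motion_wrt (M \<Otimes>\<^sub>M levels \<mu>) (enlarged_filtration M B (levels \<mu>)) (lift_process B)"
    by (rule brownian_motion_wrt_enlarged_filtration[OF B N])
  show "solves_system (M \<Otimes>\<^sub>M levels \<mu>) (enlarged_filtration M B (levels \<mu>)) a (lift_process W) (sol \<mu> B)"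
    unfolding assms(3,4) by (rule sol_solves_system[OF B \<mu>])
  show "stationary_sequence (M \<Otimes>\<^sub>M levels \<mu>) (sol \<mu> B)" by (rule stationary_sol[OF B \<mu>])
  show "\<forall>x\<ge>0. \<forall>\<omega>\<in>space (M \<Otimes>\<^sub>M levels \<mu>). sol \<mu> B 0 x \<omega> = 0" by (simp add: sol_def)
  show "\<forall>x\<ge>0. prob_space.indep_vars (M \<Otimes>\<^sub>M levels \<mu>) (\<lambda>_. borel) (\<lambda>n. sol \<mu> B n x) {1..}"
    by (intro allI impI sol_indep[OF B \<mu>])
  \<comment> \<open>These facts fix the shape and the scale of the gamma law.\<close>
  show "\<mu> > 0" "(2::real) > 0" using \<mu> by simp_all
  show "\<forall>n\<ge>1. \<forall>x\<ge>0. distributed (M \<Otimes>\<^sub>M levels \<mu>) lborel (sol \<mu> B n x) (gamma_density \<mu> 2)"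
    by (intro allI impI sol_distributed[OF B \<mu>])
qed

end
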